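(* The Merkle Mountain Belt (MMB), with the membership and increment proofs described in the context, is a succinct, incremental and optimally additive commitment scheme for an append-only list $X$. More precisely, for $n=|X|$: the commitment consists of $O(1)$ hashes; the manager needs $O(\log n)$ memory and $O(1)$ time per append; and a participant needs $O(\log n)$ memory and $O(\log k)$ communication and computational complexity to perform any of the four resync operations (updating the commitment from $\langle X_m\rangle$ to $\langle X_n\rangle$; retrieving and verifying the increment proof $\pi_{X_m\prec X_n}$; retrieving and verifying a new membership proof $\pi_{x_i\in X_n}$ with $m<i\le n$; updating and verifying an old membership proof from $\pi_{x_i\in X_m}$ to $\pi_{x_i\in X_n}$) after a $k$-increment from $X_m$ to $X_n$, $k=n-m\ge 1$.
   Context: Setting. $X=(x_1,x_2,\dots)$ is an append-only list of bit strings; $X_n=(x_1,\dots,x_n)$ is its state after $n$ appends; a $k$-increment is the change from state $X_m$ to $X_n$ with $k=n-m$. $H$ is a fixed public collision-resistant hash function; the leaf of $x_i$ is $h_i=H(x_i)$, and every non-leaf node is labelled with $H(\text{left}\,\|\,\text{right})$ of its children (a node with a single child uses a fixed default value for the missing child). Costs of computing leaf hashes are ignored. A manager performs appends and keeps the structure updated, publishing the commitment and all new node hashes on a public board; participants retrieve data and verify it. "Communication and computational complexity" (CCC) counts hashes transmitted and hash computations/elementary operations. U-MMB. A mountain of height $s\ge 0$ is a perfect binary tree with $2^s$ leaves; its root is its peak. The U-MMB for $X_n$ is an ordered (left-to-right) list of mountains whose leaves, read left to right, are $h_1,\dots,h_n$. It is built inductively from the empty list: to append $x_n$, (1) add $h_n$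 as a height-0 mountain at the right end; (2) if some two consecutive mountains have equal height (a mergeable pair), take the rightmost such pair, of height $s$, and replace it in place by one mountain of height $s+1$ whose new peak has the two old peaks as children. MMB. The U-MMB mountain list is partitioned into ranges: two consecutive mountains $M,M'$ ($M$ immediately left of $M'$) lie in different ranges iff their heights differ by 2, or the mountain immediately left of $M$ exists and has the same height as $M$. For a range with peaks $P_1,\dots,P_r$ (left to right), range nodes are $R_1$ (single child $P_1$) and $R_j$ with children $R_{j-1},P_j$; $R_r$ is the range root. For ranges with roots $Q_1,\dots,Q_q$ (left to right), belt nodes are $B_1$ (single child $Q_1$) and $B_j$ with children $B_{j-1},Q_j$; $B_q$ is the root, whose hash is the commitment $\langle X_n\rangle$. The membership proof $\pi_{x_i\in X_n}$ is the list of hashes (with handedness) of the siblings of the nodes on the path from $h_i$ to the root (a missing sibling contributes nothing); it is verified by recomputing the root. An increment proof $\pi_{X_m\prec X_n}$ is a set $C_n$ of pairwise non-ancestral nodes of the MMB for $X_n$ whose descendant leaves are exactly $h_1,\dots,h_n$, containing a subset $C_m$ whose descendant leaves are exactly $h_1,\dots,h_m$, together with instructions, such that the root of the MMB for $X_m$ is derivable from $C_m$ and the root for $X_n$ from $C_n$ by repeatedly replacing two siblings by their parent; it is verified against $\langle X_m\rangle$ and $\langle X_n\rangle$. Properties. Succinct: retrieving the current commitment, retrieving and verifying any membership proof, and retrieving and verifying any increment proof each have CCC polylogarithmic in $n$. Incremental: after a $k$-increment, each of the four resync operations listed in the claim has CCC depending only on $k$, not on $n$. Optimally additive: an append together with the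 corresponding update of the scheme and commitment takes the manager $O(1)$ time. *)

theory Defs
  imports Complex_Main "HOL-Library.Landau_Symbols" "HOL-Library.Sublist"
begin

section \<open>The Merkle mountain belt\<close>

text \<open>
  A node is identified with the tree below it. This makes sense of a node being shared by the
  belts of \<open>X\<^sub>m\<close> and \<open>X\<^sub>n\<close>, since leaves carry their index. \<open>Missing\<close> is the absent left child
  of the first range node of a range and of the first belt node; it is not itself a node.
\<close>

datatype tree = Missing | Leaf nat | Node tree tree

type_synonym hash = "bool list"
type_synonym hash_fun = "bool list \<Rightarrow> hash"

fun leaves :: "tree \<Rightarrow> nat set" where
  "leaves Missing = {}"
| "leaves (Leaf i) = {i}"
| "leaves (Node l r) = leaves l \<union> leaves r"

fun nodes :: "tree \<Rightarrow> tree set" where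
  "nodes Missing = {}"
| "nodes (Leaf i) = {Leaf i}"
| "nodes (Node l r) = insert (Node l r) (nodes l \<union> nodes r)"

text \<open>\<open>d\<close> is the default value for a missing child; \<open>x i\<close> is the \<open>i\<close>-th list element, \<open>i \<ge> 1\<close>.\<close>

fun label :: "hash_fun \<Rightarrow> hash \<Rightarrow> (nat \<Rightarrow> bool list) \<Rightarrow> tree \<Rightarrow> hash" where
  "label H d x Missing = d"
| "label H d x (Leaf i) = H (x i)"
| "label H d x (Node l r) = H (label H d x l @ label H d x r)"

fun height :: "tree \<Rightarrow> nat" where
  "height (Node l r) = Suc (max (height l) (height r))"
| "height _ = 0"

fun has_mergeable :: "tree list \<Rightarrow> bool" where
  "has_mergeable (a # b # ts) \<longleftrightarrow> height a = height b \<or> has_mergeable (b # ts)"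
| "has_mergeable _ \<longleftrightarrow> False"

fun merge_rightmost :: "tree list \<Rightarrow> tree list" where
  "merge_rightmost (a # b # ts) =
    (if has_mergeable (b # ts) then a # merge_rightmost (b # ts)
     else if height a = height b then Node a b # ts
     else a # b # ts)"
| "merge_rightmost ts = ts"

fun ummb :: "nat \<Rightarrow> tree list" where
  "ummb 0 = []"
| "ummb (Suc n) = merge_rightmost (ummb n @ [Leaf (Suc n)])"

definition range_boundary :: "tree option \<Rightarrow> tree \<Rightarrow> tree \<Rightarrow> bool" where
  "range_boundary p a b \<longleftrightarrow>
     height a = height b + 2 \<or> height b = height a + 2 \<or>
     (\<exists>c. p = Some c \<and> height c = height a)"

text \<open>The first argument is the mountain immediately to the left of the given list, if any.\<close>

fun ranges :: "tree option \<Rightarrow> tree list \<Rightarrow> tree list list" where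
  "ranges p [] = []"
| "ranges p [a] = [[a]]"
| "ranges p (a # b # ts) =
    (let rs = ranges (Some a) (b # ts)
     in if range_boundary p a b then [a] # rs else (a # hd rs) # tl rs)"

text \<open>Used both for the range nodes over peaks and for the belt nodes over range roots.\<close>

fun chain :: "tree list \<Rightarrow> tree" where
  "chain [] = Missing"
| "chain (t # ts) = foldl Node (Node Missing t) ts"

definition mmb :: "nat \<Rightarrow> tree" where
  "mmb n = chain (map chain (ranges None (ummb n)))"

definition root_hash :: "hash_fun \<Rightarrow> hash \<Rightarrow> (nat \<Rightarrow> bool list) \<Rightarrow> nat \<Rightarrow> hash" where
  "root_hash H d x n = label H d x (mmb n)"

definition commitment :: "hash_fun \<Rightarrow> hash \<Rightarrow> (nat \<Rightarrow> bool list) \<Rightarrow> nat \<Rightarrow> hash list" where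
  "commitment H d x n = [root_hash H d x n]"

section \<open>Membership proofs\<close>

text \<open>
  A missing sibling contributes no hash, but the verifier has to know where the default value
  enters; this is the marker \<open>NoSib\<close>, which is charged for like any other entry.
\<close>

datatype step = LeftSib hash | RightSib hash | NoSib

fun path :: "nat \<Rightarrow> tree \<Rightarrow> tree list" where
  "path i Missing = []"
| "path i (Leaf j) = [Leaf j]"
| "path i (Node l r) = (if i \<in> leaves l then path i l else path i r) @ [Node l r]"

fun siblings :: "hash_fun \<Rightarrow> hash \<Rightarrow> (nat \<Rightarrow> bool list) \<Rightarrow> nat \<Rightarrow> tree \<Rightarrow> step list" where
  "siblings H d x i (Node l r) =
    (if i \<in> leaves l then siblings H d x i l @ [RightSib (label H d x r)]
     else siblings H d x i r @ [if l = Missing then NoSib else LeftSib (label H d x l)])"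
| "siblings H d x i _ = []"

definition membership_proof ::
    "hash_fun \<Rightarrow> hash \<Rightarrow> (nat \<Rightarrow> bool list) \<Rightarrow> nat \<Rightarrow> nat \<Rightarrow> step list" where
  "membership_proof H d x n i = siblings H d x i (mmb n)"

fun climb :: "hash_fun \<Rightarrow> hash \<Rightarrow> hash \<Rightarrow> step \<Rightarrow> hash" where
  "climb H d h (LeftSib g) = H (g @ h)"
| "climb H d h (RightSib g) = H (h @ g)"
| "climb H d h NoSib = H (d @ h)"

definition recompute :: "hash_fun \<Rightarrow> hash \<Rightarrow> hash \<Rightarrow> step list \<Rightarrow> hash" where
  "recompute H d h \<pi> = foldl (climb H d) h \<pi>"

text \<open>
  The number of lowest proof entries that are the same for \<open>X\<^sub>m\<close> and \<open>X\<^sub>n\<close> because the paths from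
  leaf \<open>i\<close> still coincide one node higher up.
\<close>

definition kept :: "nat \<Rightarrow> nat \<Rightarrow> nat \<Rightarrow> nat" where
  "kept m n i = length (longest_common_prefix (path i (mmb m)) (path i (mmb n))) - 1"

section \<open>Increment proofs\<close>

text \<open>
  The instructions rewrite a left-to-right list of nodes into a single one, with the help of a
  stack: \<open>Shift\<close> moves the next node to the stack, \<open>Join\<close> replaces the two topmost nodes by their
  parent, \<open>JoinDefault\<close> replaces the topmost node by its parent with a missing left child.
\<close>

datatype instr = Shift | Join | JoinDefault

fun reduce_nodes :: "('a \<Rightarrow> 'a \<Rightarrow> 'a) \<Rightarrow> 'a \<Rightarrow> instr list \<Rightarrow> 'a list \<Rightarrow> 'a list \<Rightarrow> 'a option" where
  "reduce_nodes f d [] [] [r] = Some r"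
| "reduce_nodes f d (Shift # is) (a # as) st = reduce_nodes f d is as (a # st)"
| "reduce_nodes f d (Join # is) as (b # a # st) = reduce_nodes f d is as (f a b # st)"
| "reduce_nodes f d (JoinDefault # is) as (a # st) = reduce_nodes f d is as (f d a # st)"
| "reduce_nodes f d _ _ _ = None"

text \<open>
  An increment proof \<open>(C, D, is, js)\<close> has \<open>C\<^sub>m = set C\<close> and \<open>C\<^sub>n = set (C @ D)\<close>; \<open>is\<close> and \<open>js\<close> are
  the instructions for the roots of \<open>X\<^sub>m\<close> and \<open>X\<^sub>n\<close>. With node hashes in place of nodes this is
  what is transmitted and verified.
\<close>

type_synonym 'a increment_proof = "'a list \<times> 'a list \<times> instr list \<times> instr list"

definition is_increment_proof :: "nat \<Rightarrow> nat \<Rightarrow> tree increment_proof \<Rightarrow> bool" where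
  "is_increment_proof m n = (\<lambda>(C, D, is, js).
     distinct (C @ D) \<and>
     set (C @ D) \<subseteq> nodes (mmb n) \<and>
     (\<forall>u \<in> set (C @ D). \<forall>v \<in> set (C @ D). u \<in> nodes v \<longrightarrow> u = v) \<and>
     (\<Union>v \<in> set C. leaves v) = {1..m} \<and>
     (\<Union>v \<in> set (C @ D). leaves v) = {1..n} \<and>
     reduce_nodes Node Missing is C [] = Some (mmb m) \<and>
     reduce_nodes Node Missing js (C @ D) [] = Some (mmb n))"

definition hash_increment_proof ::
    "hash_fun \<Rightarrow> hash \<Rightarrow> (nat \<Rightarrow> bool list) \<Rightarrow> tree increment_proof \<Rightarrow> hash increment_proof" where
  "hash_increment_proof H d x =
     (\<lambda>(C, D, is, js). (map (label H d x) C, map (label H d x) D, is, js))"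

definition increment_accepts ::
    "hash_fun \<Rightarrow> hash \<Rightarrow> hash \<Rightarrow> hash \<Rightarrow> hash increment_proof \<Rightarrow> bool" where
  "increment_accepts H d cm cn = (\<lambda>(C, D, is, js).
     reduce_nodes (\<lambda>a b. H (a @ b)) d is C [] = Some cm \<and>
     reduce_nodes (\<lambda>a b. H (a @ b)) d js (C @ D) [] = Some cn)"

section \<open>The cost model\<close>

text \<open>
  A random access machine with unit costs. A memory cell holds a number and a hash. Hashes can only
  be copied, compared, hashed in pairs, received and published; numbers only added, subtracted and
  compared. Every operator of an expression, every command, every received token and every
  published hash costs 1. A program mentions neither the hash function nor the default value,
  so it can obtain hashes only by paying for them.
\<close>

type_synonym memory = "nat \<Rightarrow> nat \<times> hash"
type_synonym token = "nat \<times> hash"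

datatype aexp = Num nat | Val aexp | Plus aexp aexp | Minus aexp aexp
datatype hexp = Default | Cell aexp | Hash hexp hexp
datatype bexp = Less aexp aexp | Same hexp hexp | More | Not bexp
datatype cmd =
    Skip
  | Store aexp aexp
  | StoreHash aexp hexp
  | Fetch aexp
  | Publish hexp
  | Seq cmd cmd
  | If bexp cmd cmd
  | While bexp cmd

fun aval :: "memory \<Rightarrow> aexp \<Rightarrow> nat" where
  "aval M (Num k) = k"
| "aval M (Val a) = fst (M (aval M a))"
| "aval M (Plus a b) = aval M a + aval M b"
| "aval M (Minus a b) = aval M a - aval M b"

fun hval :: "hash_fun \<Rightarrow> hash \<Rightarrow> memory \<Rightarrow> hexp \<Rightarrow> hash" where
  "hval H d M Default = d"
| "hval H d M (Cell a) = snd (M (aval M a))"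
| "hval H d M (Hash a b) = H (hval H d M a @ hval H d M b)"

fun bval :: "hash_fun \<Rightarrow> hash \<Rightarrow> memory \<Rightarrow> token list \<Rightarrow> bexp \<Rightarrow> bool" where
  "bval H d M inp (Less a b) \<longleftrightarrow> aval M a < aval M b"
| "bval H d M inp (Same a b) \<longleftrightarrow> hval H d M a = hval H d M b"
| "bval H d M inp More \<longleftrightarrow> inp \<noteq> []"
| "bval H d M inp (Not b) \<longleftrightarrow> \<not> bval H d M inp b"

fun acost :: "aexp \<Rightarrow> nat" where
  "acost (Num k) = 1"
| "acost (Val a) = 1 + acost a"
| "acost (Plus a b) = 1 + acost a + acost b"
| "acost (Minus a b) = 1 + acost a + acost b"

fun hcost :: "hexp \<Rightarrow> nat" where
  "hcost Default = 1"
| "hcost (Cell a) = 1 + acost a"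
| "hcost (Hash a b) = 1 + hcost a + hcost b"

fun bcost :: "bexp \<Rightarrow> nat" where
  "bcost (Less a b) = 1 + acost a + acost b"
| "bcost (Same a b) = 1 + hcost a + hcost b"
| "bcost More = 1"
| "bcost (Not b) = 1 + bcost b"

text \<open>
  A configuration consists of the memory, the tokens not yet received and the hashes published
  so far. \<open>exec H d B c s t s'\<close>: with \<open>B\<close> memory cells, \<open>c\<close> leads from \<open>s\<close> to \<open>s'\<close> at cost \<open>t\<close>.
  A program that writes outside the first \<open>B\<close> cells, or receives more than there is, has no
  execution.
\<close>

type_synonym config = "memory \<times> token list \<times> hash list"

inductive exec :: "hash_fun \<Rightarrow> hash \<Rightarrow> nat \<Rightarrow> cmd \<Rightarrow> config \<Rightarrow> nat \<Rightarrow> config \<Rightarrow> bool"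
  for H :: hash_fun and d :: hash and B :: nat where
  Skip: "exec H d B Skip s 1 s"
| Store: "\<lbrakk>k = aval M a; k < B\<rbrakk> \<Longrightarrow>
    exec H d B (Store a e) (M, inp, out) (1 + acost a + acost e)
      (M(k := (aval M e, snd (M k))), inp, out)"
| StoreHash: "\<lbrakk>k = aval M a; k < B\<rbrakk> \<Longrightarrow>
    exec H d B (StoreHash a e) (M, inp, out) (1 + acost a + hcost e)
      (M(k := (fst (M k), hval H d M e)), inp, out)"
| Fetch: "aval M a < B \<Longrightarrow>
    exec H d B (Fetch a) (M, tok # inp, out) (1 + acost a) (M(aval M a := tok), inp, out)"
| Publish:
    "exec H d B (Publish e) (M, inp, out) (1 + hcost e) (M, inp, out @ [hval H d M e])"
| Seq: "\<lbrakk>exec H d B c1 s1 t1 s2; exec H d B c2 s2 t2 s3\<rbrakk> \<Longrightarrow>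
    exec H d B (Seq c1 c2) s1 (1 + t1 + t2) s3"
| IfTrue: "\<lbrakk>bval H d M inp b; exec H d B c1 (M, inp, out) t s\<rbrakk> \<Longrightarrow>
    exec H d B (If b c1 c2) (M, inp, out) (1 + bcost b + t) s"
| IfFalse: "\<lbrakk>\<not> bval H d M inp b; exec H d B c2 (M, inp, out) t s\<rbrakk> \<Longrightarrow>
    exec H d B (If b c1 c2) (M, inp, out) (1 + bcost b + t) s"
| WhileFalse: "\<not> bval H d M inp b \<Longrightarrow>
    exec H d B (While b c) (M, inp, out) (1 + bcost b) (M, inp, out)"
| WhileTrue: "\<lbrakk>bval H d M inp b; exec H d B c (M, inp, out) t1 s; exec H d B (While b c) s t2 s'\<rbrakk> \<Longrightarrow>
    exec H d B (While b c) (M, inp, out) (1 + bcost b + t1 + t2) s'"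

text \<open>The whole message \<open>msg\<close> is received, and exactly \<open>pub\<close> is published.\<close>

definition runs ::
    "hash_fun \<Rightarrow> hash \<Rightarrow> nat \<Rightarrow> cmd \<Rightarrow> memory \<Rightarrow> token list \<Rightarrow> nat \<Rightarrow> memory \<Rightarrow> hash list \<Rightarrow> bool" where
  "runs H d B c M msg t M' pub \<longleftrightarrow> exec H d B c (M, msg, []) t (M', [], pub)"

definition fits :: "nat \<Rightarrow> memory \<Rightarrow> bool" where
  "fits B M \<longleftrightarrow> (\<forall>a \<ge> B. M a = (0, []))"

section \<open>The commitment scheme\<close>

record scheme =
  append_prog :: cmd
  commitment_prog :: cmd
  increment_prog :: cmd
  membership_prog :: cmd
  update_prog :: cmd
  increment_choice :: "nat \<Rightarrow> nat \<Rightarrow> tree increment_proof"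

subsection \<open>The manager\<close>

inductive manager_memory ::
    "hash_fun \<Rightarrow> hash \<Rightarrow> (nat \<Rightarrow> bool list) \<Rightarrow> scheme \<Rightarrow> nat \<Rightarrow> memory \<Rightarrow> bool"
  for H :: hash_fun and d :: hash and x :: "nat \<Rightarrow> bool list" and P :: scheme where
  "manager_memory H d x P 0 (\<lambda>_. (0, []))"
| "\<lbrakk>manager_memory H d x P n M;
    runs H d B (append_prog P) M [(0, H (x (Suc n)))] t M' pub\<rbrakk> \<Longrightarrow>
   manager_memory H d x P (Suc n) M'"

definition appends_within ::
    "hash_fun \<Rightarrow> hash \<Rightarrow> (nat \<Rightarrow> bool list) \<Rightarrow> scheme \<Rightarrow> nat \<Rightarrow> nat \<Rightarrow> nat \<Rightarrow> memory \<Rightarrow> bool" where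
  "appends_within H d x P B c n M \<longleftrightarrow>
     (\<exists>t M' pub.
        runs H d B (append_prog P) M [(0, H (x (Suc n)))] t M'
          (pub @ commitment H d x (Suc n)) \<and>
        t \<le> c \<and> fits B M' \<and>
        label H d x ` (nodes (mmb (Suc n)) - nodes (mmb n))
          \<subseteq> set (pub @ commitment H d x (Suc n)))"

subsection \<open>The participants\<close>

text \<open>
  Layout of a participant's memory: cell 0 holds the current commitment and cell 2 the previous
  one; the number in cell 4 is the verdict of the last verification (1 for acceptance). A verified
  membership proof is stored with its length in cell 6, its \<open>j\<close>-th entry in cell \<open>8 + 4 * j\<close> and
  the intermediate hashes met in recomputing the root in the cells \<open>10 + 4 * j\<close>. Cells with an
  odd address are at the disposal of the programs.
\<close>

fun step_token :: "step \<Rightarrow> token" where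
  "step_token (LeftSib g) = (0, g)"
| "step_token (RightSib g) = (1, g)"
| "step_token NoSib = (2, [])"

fun instr_token :: "instr \<Rightarrow> token" where
  "instr_token Shift = (0, [])"
| "instr_token Join = (1, [])"
| "instr_token JoinDefault = (2, [])"

definition increment_message :: "hash increment_proof \<Rightarrow> token list" where
  "increment_message = (\<lambda>(C, D, is, js).
     [(length C, []), (length D, []), (length is, [])] @
     map (Pair 0) (C @ D) @ map instr_token (is @ js))"

definition stores_proof :: "hash_fun \<Rightarrow> hash \<Rightarrow> memory \<Rightarrow> hash \<Rightarrow> step list \<Rightarrow> bool" where
  "stores_proof H d M h \<pi> \<longleftrightarrow>
     fst (M 6) = length \<pi> \<and>
     (\<forall>j < length \<pi>. M (8 + 4 * j) = step_token (\<pi> ! j)) \<and>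
     (\<forall>j \<le> length \<pi>. snd (M (10 + 4 * j)) = recompute H d h (take j \<pi>))"

text \<open>
  The verification programs must give the right verdict on every message, honest or not. The
  first token for \<open>membership_prog\<close> is the participant's own input, the leaf hash; that of
  \<open>update_prog\<close> tells how many entries of the stored proof are retained.
\<close>

definition verifies_correctly :: "scheme \<Rightarrow> bool" where
  "verifies_correctly P \<longleftrightarrow> (\<forall>H d M.
     (\<forall>ip. \<exists>B t M'. runs H d B (increment_prog P) M (increment_message ip) t M' [] \<and>
        fst (M' 4) = of_bool (increment_accepts H d (snd (M 2)) (snd (M 0)) ip)) \<and>
     (\<forall>h \<pi>. \<exists>B t M'. runs H d B (membership_prog P) M ((0, h) # map step_token \<pi>) t M' [] \<and>
        fst (M' 4) = of_bool (recompute H d h \<pi> = snd (M 0)) \<and>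
        stores_proof H d M' h \<pi>) \<and>
     (\<forall>h \<pi> j \<pi>'. stores_proof H d M h \<pi> \<and> j \<le> length \<pi> \<longrightarrow>
        (\<exists>B t M'. runs H d B (update_prog P) M ((j, []) # map step_token \<pi>') t M' [] \<and>
           fst (M' 4) = of_bool (recompute H d h (take j \<pi> @ \<pi>') = snd (M 0)) \<and>
           stores_proof H d M' h (take j \<pi> @ \<pi>'))))"

definition is_mmb_scheme :: "scheme \<Rightarrow> bool" where
  "is_mmb_scheme P \<longleftrightarrow>
     verifies_correctly P \<and>
     (\<forall>m n. 1 \<le> m \<and> m < n \<longrightarrow> is_increment_proof m n (increment_choice P m n))"

text \<open>Below, \<open>B\<close> is the memory available to the participant and \<open>c\<close> a bound on the cost.\<close>

definition updates_commitment_within ::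
    "hash_fun \<Rightarrow> hash \<Rightarrow> (nat \<Rightarrow> bool list) \<Rightarrow> scheme \<Rightarrow> nat \<Rightarrow> nat \<Rightarrow> nat \<Rightarrow> bool" where
  "updates_commitment_within H d x P B c n \<longleftrightarrow> (\<forall>M. fits B M \<longrightarrow>
     (\<exists>t M'. runs H d B (commitment_prog P) M (map (Pair 0) (commitment H d x n)) t M' [] \<and>
        t \<le> c \<and> fits B M' \<and>
        snd (M' 0) = root_hash H d x n \<and> snd (M' 2) = snd (M 0) \<and>
        (\<forall>a. even a \<and> a \<notin> {0, 2} \<longrightarrow> M' a = M a)))"

definition verifies_increment_within ::
    "hash_fun \<Rightarrow> hash \<Rightarrow> (nat \<Rightarrow> bool list) \<Rightarrow> scheme \<Rightarrow> nat \<Rightarrow> nat \<Rightarrow> nat \<Rightarrow> nat \<Rightarrow> bool" where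
  "verifies_increment_within H d x P B c m n \<longleftrightarrow>
     (\<forall>M. fits B M \<and> snd (M 0) = root_hash H d x n \<and> snd (M 2) = root_hash H d x m \<longrightarrow>
     (\<exists>t M'. runs H d B (increment_prog P) M
          (increment_message (hash_increment_proof H d x (increment_choice P m n))) t M' [] \<and>
        t \<le> c \<and> fits B M' \<and> fst (M' 4) = 1 \<and>
        (\<forall>a. even a \<and> a \<noteq> 4 \<longrightarrow> M' a = M a)))"

definition retrieves_membership_within ::
    "hash_fun \<Rightarrow> hash \<Rightarrow> (nat \<Rightarrow> bool list) \<Rightarrow> scheme \<Rightarrow> nat \<Rightarrow> nat \<Rightarrow> nat \<Rightarrow> nat \<Rightarrow> bool" where
  "retrieves_membership_within H d x P B c n i \<longleftrightarrow>
     (\<forall>M. fits B M \<and> snd (M 0) = root_hash H d x n \<longrightarrow>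
     (\<exists>t M'. runs H d B (membership_prog P) M
          ((0, H (x i)) # map step_token (membership_proof H d x n i)) t M' [] \<and>
        t \<le> c \<and> fits B M' \<and> fst (M' 4) = 1 \<and>
        stores_proof H d M' (H (x i)) (membership_proof H d x n i) \<and>
        M' 0 = M 0 \<and> M' 2 = M 2))"

definition updates_membership_within ::
    "hash_fun \<Rightarrow> hash \<Rightarrow> (nat \<Rightarrow> bool list) \<Rightarrow> scheme \<Rightarrow> nat \<Rightarrow> nat \<Rightarrow> nat \<Rightarrow> nat \<Rightarrow> nat \<Rightarrow> bool" where
  "updates_membership_within H d x P B c m n i \<longleftrightarrow>
     (\<forall>M. fits B M \<and> snd (M 0) = root_hash H d x n \<and>
        stores_proof H d M (H (x i)) (membership_proof H d x m i) \<longrightarrow>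
     (\<exists>t M'. runs H d B (update_prog P) M
          ((kept m n i, []) #
             map step_token (drop (kept m n i) (membership_proof H d x n i))) t M' [] \<and>
        t \<le> c \<and> fits B M' \<and> fst (M' 4) = 1 \<and>
        stores_proof H d M' (H (x i)) (membership_proof H d x n i) \<and>
        M' 0 = M 0 \<and> M' 2 = M 2))"

text \<open>
  The empty list has no root, hence no increment proof starts from it; the operations that do
  not refer to the old commitment are also required for \<open>m = 0\<close>.
\<close>

definition resyncs_within ::
    "hash_fun \<Rightarrow> hash \<Rightarrow> (nat \<Rightarrow> bool list) \<Rightarrow> scheme \<Rightarrow> nat \<Rightarrow> nat \<Rightarrow> nat \<Rightarrow> nat \<Rightarrow> bool" where
  "resyncs_within H d x P B c m n \<longleftrightarrow>
     updates_commitment_within H d x P B c n \<and>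
     (1 \<le> m \<longrightarrow> verifies_increment_within H d x P B c m n) \<and>
     (\<forall>i. m < i \<and> i \<le> n \<longrightarrow> retrieves_membership_within H d x P B c n i) \<and>
     (\<forall>i. 1 \<le> i \<and> i \<le> m \<longrightarrow> updates_membership_within H d x P B c m n i)"

subsection \<open>Properties\<close>

definition polylogarithmic :: "(nat \<Rightarrow> nat) \<Rightarrow> bool" where
  "polylogarithmic T \<longleftrightarrow> (\<exists>e::nat. (\<lambda>n. real (T n)) \<in> O(\<lambda>n. ln (real n) ^ e))"

definition succinct :: "scheme \<Rightarrow> bool" where
  "succinct P \<longleftrightarrow> (\<exists>mem T. mono mem \<and> polylogarithmic T \<and> (\<forall>H d x n. 1 \<le> n \<longrightarrow>
     updates_commitment_within H d x P (mem n) (T n) n \<and>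
     (\<forall>i. 1 \<le> i \<and> i \<le> n \<longrightarrow> retrieves_membership_within H d x P (mem n) (T n) n i) \<and>
     (\<forall>m. 1 \<le> m \<and> m < n \<longrightarrow> verifies_increment_within H d x P (mem n) (T n) m n)))"

definition incremental :: "scheme \<Rightarrow> bool" where
  "incremental P \<longleftrightarrow> (\<exists>mem T. mono mem \<and>
     (\<forall>H d x m n. m < n \<longrightarrow> resyncs_within H d x P (mem n) (T (n - m)) m n))"

definition optimally_additive :: "scheme \<Rightarrow> bool" where
  "optimally_additive P \<longleftrightarrow> (\<exists>mem c. mono mem \<and>
     (\<forall>H d x n M. manager_memory H d x P n M \<longrightarrow> appends_within H d x P (mem (Suc n)) c n M))"

end

theory Submission
  imports Defs "HOL-Library.Discrete_Functions"
begin

text \<open>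
  Write \<open>N = n + 1\<close> in binary. The mountains of \<open>X\<^sub>n\<close> correspond to the digits of \<open>N\<close> below the
  leading one, and an append increments \<open>N\<close>: a carry stopping at digit \<open>j\<close> merges the two mountains
  of height \<open>j\<close>, and the mountains to their right form the last range. Hence an append creates at
  most six nodes, and those that do not contain the new leaf end at leaf \<open>N + 1 - 2 ^ j\<close>.

  After a \<open>k\<close>-increment from \<open>m\<close> to \<open>n\<close>, a node of the new belt with an old leaf that is not a node
  of the old belt either lies on the path from leaf \<open>m + 1\<close>, which has length \<open>O(log k)\<close>, or was
  created by an append \<open>p\<close> whose carry clears enough digits of \<open>p + 1\<close> to get down to at most \<open>m\<close>.
  There are only \<open>O(log k)\<close> such appends. This bounds both the part of a membership proof that
  changes and the increment proof built from the maximal common nodes of the two belts.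
\<close>

section \<open>Mountains, ranges and belt\<close>

lemma halving_induct [consumes 1, case_names one halve]:
  fixes N :: nat
  assumes "1 \<le> N"
    and one: "\<And>i. P i 1"
    and halve: "\<And>i N. 2 \<le> N \<Longrightarrow> 1 \<le> N div 2 \<Longrightarrow> P (Suc i) (N div 2) \<Longrightarrow> P i N"
  shows "P i N"
  using \<open>1 \<le> N\<close>
proof (induction N arbitrary: i rule: less_induct)
  case (less N)
  show ?case
  proof (cases "N = 1")
    case False
    with less.prems have "2 \<le> N" "1 \<le> N div 2" "N div 2 < N" by auto
    then show ?thesis using less.IH halve by blast
  qed (use one in simp)
qed

fun perfect :: "nat \<Rightarrow> nat \<Rightarrow> tree" where
  "perfect 0 k = Leaf (Suc k)"
| "perfect (Suc h) k = Node (perfect h k) (perfect h (k + 2 ^ h))"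

lemma height_perfect [simp]: "height (perfect h k) = h"
  by (induction h arbitrary: k) auto

lemma perfect_not_Missing [simp]: "perfect h k \<noteq> Missing"
  by (cases h) auto

declare perfect.simps(2) [simp del]

text \<open>
  With \<open>N = n + 1\<close>, the \<open>i\<close>-th mountain from the right in the list for \<open>n\<close> has height \<open>i\<close> plus the
  \<open>i\<close>-th binary digit of \<open>N\<close>. The mountains of index at least \<open>i\<close> only depend on \<open>N div 2 ^ i\<close>,
  which is the second argument of the functions below.
\<close>

definition last_leaf :: "nat \<Rightarrow> nat \<Rightarrow> nat" where
  "last_leaf i N = 2 ^ i * (N - 1)"

definition mountain :: "nat \<Rightarrow> nat \<Rightarrow> tree" where
  "mountain i N = perfect (i + N mod 2) (last_leaf (Suc i) (N div 2))"

fun mountains :: "nat \<Rightarrow> nat \<Rightarrow> tree list" where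
  "mountains i N = (if N < 2 then [] else mountains (Suc i) (N div 2) @ [mountain i N])"

declare mountains.simps [simp del]

lemma last_leaf_one [simp]: "last_leaf i (Suc 0) = 0"
  by (simp add: last_leaf_def)

lemma last_leaf_zero [simp]: "last_leaf 0 N = N - 1"
  by (simp add: last_leaf_def)

lemma last_leaf_double: "1 \<le> q \<Longrightarrow> last_leaf i (2 * q) = last_leaf (Suc i) q + 2 ^ i"
  by (cases q) (simp_all add: last_leaf_def algebra_simps)

lemma last_leaf_Suc_double: "1 \<le> q \<Longrightarrow> last_leaf i (Suc (2 * q)) = last_leaf (Suc i) q + 2 ^ Suc i"
  by (cases q) (simp_all add: last_leaf_def algebra_simps)

lemma mountain_not_Missing [simp]: "mountain i N \<noteq> Missing"
  by (simp add: mountain_def)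

lemma height_mountain: "height (mountain i N) = i + N mod 2"
  by (simp add: mountain_def)

lemma mountain_double: "mountain i (2 * q) = perfect i (last_leaf (Suc i) q)"
  by (simp add: mountain_def)

lemma mountain_Suc_double: "mountain i (Suc (2 * q)) = perfect (Suc i) (last_leaf (Suc i) q)"
  by (simp add: mountain_def)

lemma mountain_0_Suc: "odd n \<Longrightarrow> mountain 0 (Suc n) = Leaf n"
  by (auto simp: mountain_def last_leaf_def elim!: oddE)

lemma mountain_Suc_double_eq_Node:
  "1 \<le> q \<Longrightarrow>
    mountain i (Suc (2 * q)) = Node (mountain i (2 * q)) (perfect i (last_leaf i (2 * q)))"
  by (simp add: mountain_double mountain_Suc_double last_leaf_double perfect.simps(2))

lemma mountains_one [simp]: "mountains i (Suc 0) = []"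
  by (simp add: mountains.simps)

lemma mountains_snoc: "2 \<le> N \<Longrightarrow> mountains i N = mountains (Suc i) (N div 2) @ [mountain i N]"
  by (subst mountains.simps) simp

lemma has_mergeable_snoc:
  "has_mergeable (ts @ [a, b]) \<longleftrightarrow> height a = height b \<or> has_mergeable (ts @ [a])"
proof (induction ts)
  case (Cons c ts)
  then show ?case by (cases ts) auto
qed simp

lemma merge_rightmost_same:
  "height a = height b \<Longrightarrow> merge_rightmost (ts @ [a, b]) = ts @ [Node a b]"
proof (induction ts)
  case (Cons c ts)
  moreover have "has_mergeable (ts @ [a, b])"
    using Cons.prems by (simp add: has_mergeable_snoc)
  ultimately show ?case
    by (cases "ts @ [a, b]") auto
qed simp

lemma merge_rightmost_different:
  "height a \<noteq> height b \<Longrightarrow> merge_rightmost (ts @ [a, b]) = merge_rightmost (ts @ [a]) @ [b]"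
proof (induction ts)
  case (Cons c ts)
  show ?case
  proof (cases ts)
    case Nil
    then show ?thesis using Cons by auto
  next
    case (Cons e us)
    then show ?thesis
      using Cons.IH Cons.prems has_mergeable_snoc [of ts a b] by auto
  qed
qed simp

lemma merge_rightmost_mountains:
  assumes "1 \<le> N"
  shows "merge_rightmost (mountains i N @ [perfect i (last_leaf i N)]) = mountains i (Suc N)"
  using assms
proof (induction i N rule: halving_induct)
  case (one i)
  then show ?case by (simp add: mountains_snoc mountain_def numeral_2_eq_2 last_leaf_def)
next
  case (halve i N)
  define q where "q = N div 2"
  let ?left = "mountains (Suc i) q" and ?new = "perfect i (last_leaf i N)"
  have mountains_N: "mountains i N = ?left @ [mountain i N]"
    using halve.hyps by (simp add: mountains_snoc q_def)
  show ?case
  proof (cases "even N")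
    case True
    then have N_eq: "N = 2 * q" by (simp add: q_def)
    have "merge_rightmost (mountains i N @ [?new]) = ?left @ [Node (mountain i N) ?new]"
      unfolding mountains_N by (simp add: merge_rightmost_same height_mountain True)
    also have "Node (mountain i N) ?new = mountain i (Suc N)"
      using mountain_Suc_double_eq_Node [of q i] halve.hyps by (simp add: N_eq)
    finally show ?thesis
      using halve.hyps by (simp add: mountains_snoc N_eq)
  next
    case False
    then have N_eq: "N = Suc (2 * q)" by (simp add: q_def)
    have "merge_rightmost (mountains i N @ [?new]) =
        merge_rightmost (?left @ [mountain i N]) @ [?new]"
      unfolding mountains_N by (simp add: merge_rightmost_different height_mountain N_eq)
    also have "merge_rightmost (?left @ [mountain i N]) = mountains (Suc i) (Suc q)"
      using halve.IH by (simp add: N_eq mountain_Suc_double)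
    finally show ?thesis
      using mountain_double [of i "Suc q"]
      by (simp add: mountains_snoc N_eq last_leaf_def mult.assoc mult.left_commute)
  qed
qed

lemma ummb_eq: "ummb n = mountains 0 (Suc n)"
proof (induction n)
  case (Suc n)
  then show ?case using merge_rightmost_mountains [of "Suc n" 0] by simp
qed simp

lemma ranges_nonempty: "ts \<noteq> [] \<Longrightarrow> ranges p ts \<noteq> []"
  by (cases "(p, ts)" rule: ranges.cases) (auto simp: Let_def)

lemma ranges_snoc:
  "ranges p (ts @ [a, b]) =
    (let rs = ranges p (ts @ [a]) in
     if range_boundary (if ts = [] then p else Some (last ts)) a b then rs @ [[b]]
     else butlast rs @ [last rs @ [b]])"
proof (induction ts arbitrary: p)
  case Nil
  then show ?case by (simp add: Let_def)
next
  case (Cons c ts)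
  show ?case
  proof (cases ts)
    case Nil
    then show ?thesis by (simp add: Let_def)
  next
    case (Cons e us)
    obtain r rs where "ranges (Some c) (ts @ [a]) = r # rs"
      using ranges_nonempty [of "ts @ [a]"]
      by (metis Nil_is_append_conv list.exhaust not_Cons_self2)
    then show ?thesis
      using Cons Cons.IH [of "Some c"] by (auto simp: Let_def)
  qed
qed

lemma chain_snoc: "chain (ts @ [t]) = Node (chain ts) t"
  by (cases ts) auto

lemma chain_eq_Node: "ts \<noteq> [] \<Longrightarrow> chain ts = Node (chain (butlast ts)) (last ts)"
  by (metis append_butlast_last_id chain_snoc)

text \<open>The last three digits of \<open>N\<close> decide whether a range starts at the rightmost mountain.\<close>

definition range_starts :: "nat \<Rightarrow> bool" where
  "range_starts N \<longleftrightarrow> 4 \<le> N \<and> N mod 8 \<in> {2, 3, 6}"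

fun last_range :: "nat \<Rightarrow> nat \<Rightarrow> tree" where
  "last_range i N = (if N < 2 then Missing else
     Node (if range_starts N then Missing else last_range (Suc i) (N div 2)) (mountain i N))"

text \<open>The belt node over all ranges but the last one.\<close>

fun left_belt :: "nat \<Rightarrow> nat \<Rightarrow> tree" where
  "left_belt i N = (if N < 2 then Missing else
     if range_starts N then Node (left_belt (Suc i) (N div 2)) (last_range (Suc i) (N div 2))
     else left_belt (Suc i) (N div 2))"

declare last_range.simps [simp del] left_belt.simps [simp del]

lemma left_belt_one [simp]: "left_belt i (Suc 0) = Missing"
  and last_range_one [simp]: "last_range i (Suc 0) = Missing"
  by (simp_all add: left_belt.simps last_range.simps)

lemma range_starts_ge: "range_starts N \<Longrightarrow> 4 \<le> N"
  by (simp add: range_starts_def)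

lemma left_belt_starts:
    "range_starts N \<Longrightarrow>
      left_belt i N = Node (left_belt (Suc i) (N div 2)) (last_range (Suc i) (N div 2))"
  and last_range_starts:
    "range_starts N \<Longrightarrow> last_range i N = Node Missing (mountain i N)"
  using range_starts_ge [of N] by (subst left_belt.simps last_range.simps; simp)+

lemma left_belt_continues:
    "2 \<le> N \<Longrightarrow> \<not> range_starts N \<Longrightarrow> left_belt i N = left_belt (Suc i) (N div 2)"
  and last_range_continues:
    "2 \<le> N \<Longrightarrow> \<not> range_starts N \<Longrightarrow>
      last_range i N = Node (last_range (Suc i) (N div 2)) (mountain i N)"
  by (subst left_belt.simps last_range.simps; simp)+

lemmas belt_unfold =
  left_belt_starts last_range_starts left_belt_continues last_range_continues

lemma range_boundary_iff_range_starts: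
  assumes "4 \<le> N"
  shows "range_boundary (if N < 8 then None else Some (mountain (Suc (Suc i)) (N div 4)))
           (mountain (Suc i) (N div 2)) (mountain i N) \<longleftrightarrow> range_starts N"
proof -
  define u v w where "u = N mod 2" and "v = N div 2 mod 2" and "w = N div 4 mod 2"
  have digits: "u = 0 \<or> u = 1" "v = 0 \<or> v = 1" "w = 0 \<or> w = 1"
    by (auto simp: u_def v_def w_def)
  have mod_8: "N mod 8 = u + 2 * v + 4 * w"
    unfolding u_def v_def w_def using mod_mult2_eq [of N 2 4] mod_mult2_eq [of "N div 2" 2 2]
    by (simp add: div_mult2_eq [symmetric])
  have heights: "height (mountain i N) = i + u" "height (mountain (Suc i) (N div 2)) = Suc i + v"
    "height (mountain (Suc (Suc i)) (N div 4)) = Suc (Suc i) + w"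
    by (simp_all add: height_mountain u_def v_def w_def)
  have differ_by_two: "Suc i + v = i + u + 2 \<or> i + u = Suc i + v + 2 \<longleftrightarrow> u = 0 \<and> v = 1"
    and left_neighbour: "Suc (Suc i) + w = Suc i + v \<longleftrightarrow> w = 0 \<and> v = 1"
    using digits by auto
  have "w = 1" if "N < 8" using that assms by (auto simp: w_def div_nat_eqI)
  then have "range_boundary (if N < 8 then None else Some (mountain (Suc (Suc i)) (N div 4)))
      (mountain (Suc i) (N div 2)) (mountain i N) \<longleftrightarrow> u = 0 \<and> v = 1 \<or> w = 0 \<and> v = 1"
    using differ_by_two left_neighbour by (auto simp: range_boundary_def heights)
  also have "\<dots> \<longleftrightarrow> range_starts N"
    using digits assms unfolding range_starts_def mod_8 by (elim disjE) simp_all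
  finally show ?thesis .
qed

lemma ranges_mountains_step:
  fixes i N :: nat
  assumes "4 \<le> N"
  defines "rs \<equiv> ranges None (mountains (Suc i) (N div 2))"
  shows "ranges None (mountains i N) =
    (if range_starts N then rs @ [[mountain i N]] else butlast rs @ [last rs @ [mountain i N]])"
proof -
  let ?left = "mountains (Suc (Suc i)) (N div 4)"
  have "N div 2 div 2 = N div 4" by (simp add: div_mult2_eq [symmetric])
  then have snoc: "mountains (Suc i) (N div 2) = ?left @ [mountain (Suc i) (N div 2)]"
    using assms(1) by (simp add: mountains_snoc)
  then have snoc2: "mountains i N = ?left @ [mountain (Suc i) (N div 2), mountain i N]"
    using assms(1) by (simp add: mountains_snoc)
  have neighbour: "(if ?left = [] then None else Some (last ?left)) =
      (if N < 8 then None else Some (mountain (Suc (Suc i)) (N div 4)))"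
    by (subst (1 2) mountains.simps) auto
  show ?thesis
    unfolding snoc2 ranges_snoc neighbour range_boundary_iff_range_starts [OF assms(1)]
    by (simp add: rs_def snoc Let_def)
qed

lemma belt_of_ranges:
  assumes "1 \<le> N" "2 \<le> N"
  shows "left_belt i N = chain (map chain (butlast (ranges None (mountains i N)))) \<and>
    last_range i N = chain (last (ranges None (mountains i N)))"
  using assms
proof (induction i N rule: halving_induct)
  case (halve i N)
  let ?rs = "ranges None (mountains (Suc i) (N div 2))"
  show ?case
  proof (cases "N < 4")
    case True
    then have "\<not> range_starts N" "N div 2 = 1"
      using halve.prems by (auto simp: range_starts_def)
    then show ?thesis
      using halve.prems by (simp add: belt_unfold mountains_snoc)
  next
    case False
    then have left_ranges: "left_belt (Suc i) (N div 2) = chain (map chain (butlast ?rs))"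
      "last_range (Suc i) (N div 2) = chain (last ?rs)"
      using halve.IH by auto
    have "?rs \<noteq> []"
      using False by (intro ranges_nonempty) (simp add: mountains_snoc)
    then have "chain (map chain ?rs) = Node (chain (map chain (butlast ?rs))) (chain (last ?rs))"
      by (simp add: chain_eq_Node map_butlast last_map)
    then show ?thesis
      using False left_ranges
      by (cases "range_starts N") (simp_all add: ranges_mountains_step belt_unfold chain_snoc)
  qed
qed simp

lemma mmb_eq: "1 \<le> n \<Longrightarrow> mmb n = Node (left_belt 0 (Suc n)) (last_range 0 (Suc n))"
proof -
  assume "1 \<le> n"
  let ?rs = "ranges None (mountains 0 (Suc n))"
  have "?rs \<noteq> []"
    using \<open>1 \<le> n\<close> by (intro ranges_nonempty) (simp add: mountains_snoc)
  then have "mmb n = Node (chain (map chain (butlast ?rs))) (chain (last ?rs))"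
    by (simp add: mmb_def ummb_eq chain_eq_Node map_butlast last_map)
  then show ?thesis
    using belt_of_ranges [of "Suc n" 0] \<open>1 \<le> n\<close> by simp
qed

lemma mmb_0 [simp]: "mmb 0 = Missing"
  by (simp add: mmb_def)

section \<open>Subtrees and paths\<close>

fun spans :: "tree \<Rightarrow> nat \<Rightarrow> nat \<Rightarrow> bool" where
  "spans Missing a b \<longleftrightarrow> a = b"
| "spans (Leaf i) a b \<longleftrightarrow> i = Suc a \<and> b = Suc a"
| "spans (Node l r) a b \<longleftrightarrow> (\<exists>c. a \<le> c \<and> c < b \<and> spans l a c \<and> spans r c b)"

lemma leaves_eq_if_spans: "spans t a b \<Longrightarrow> leaves t = {a<..b}"
  by (induction t arbitrary: a b) fastforce+

lemma spans_le: "spans t a b \<Longrightarrow> a \<le> b"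
  by (induction t arbitrary: a b) fastforce+

lemma spans_less: "spans t a b \<Longrightarrow> t \<noteq> Missing \<Longrightarrow> a < b"
  by (cases t) auto

lemma spans_NodeE:
  assumes "spans (Node l r) a b"
  obtains c where "a \<le> c" "c < b" "spans l a c" "spans r c b"
    "leaves l \<inter> leaves r = {}" "r \<noteq> Missing"
proof -
  from assms obtain c where split: "a \<le> c" "c < b" "spans l a c" "spans r c b" by auto
  then have "leaves l \<inter> leaves r = {}" "r \<noteq> Missing"
    using leaves_eq_if_spans [of l a c] leaves_eq_if_spans [of r c b] by auto
  with split show thesis by (rule that)
qed

lemma leaves_subset_if_node: "v \<in> nodes t \<Longrightarrow> leaves v \<subseteq> leaves t"
  by (induction t) auto

lemma nodes_trans: "u \<in> nodes v \<Longrightarrow> v \<in> nodes t \<Longrightarrow> u \<in> nodes t"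
  by (induction t) auto

lemma nodes_self: "t \<noteq> Missing \<Longrightarrow> t \<in> nodes t"
  by (cases t) auto

lemma Missing_notin_nodes [simp]: "Missing \<notin> nodes t"
  by (induction t) auto

lemma size_less_if_node: "v \<in> nodes t \<Longrightarrow> v = t \<or> size v < size t"
  by (induction t) auto

lemma nodes_antisym: "u \<in> nodes v \<Longrightarrow> v \<in> nodes u \<Longrightarrow> u = v"
  using size_less_if_node by (metis less_asym)

lemma Node_notin_children: "Node l r \<notin> nodes l" "Node l r \<notin> nodes r"
  using size_less_if_node [of "Node l r" l] size_less_if_node [of "Node l r" r] by auto

lemma finite_nodes [simp]: "finite (nodes t)"
  by (induction t) auto

lemma Leaf_in_nodes_iff: "Leaf i \<in> nodes t \<longleftrightarrow> i \<in> leaves t"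
  by (induction t) auto

lemma spans_node: "spans t a b \<Longrightarrow> v \<in> nodes t \<Longrightarrow> \<exists>c e. spans v c e"
proof (induction t arbitrary: a b)
  case (Node l r)
  from Node.prems(1) obtain c where "spans l a c" "spans r c b" by (rule spans_NodeE)
  with Node consider "v = Node l r" | "\<exists>c e. spans v c e" by auto
  then show ?case using Node.prems(1) by cases blast+
next
  case (Leaf i)
  then show ?case by (metis nodes.simps(2) singletonD)
qed simp

lemma leaves_nonempty_if_node: "spans t a b \<Longrightarrow> v \<in> nodes t \<Longrightarrow> leaves v \<noteq> {}"
  using spans_node [of t a b v] spans_less [of v] leaves_eq_if_spans [of v]
  by (metis Missing_notin_nodes greaterThanAtMost_empty_iff not_less)

lemma nodes_disjoint:
  assumes "spans (Node l r) a b"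
  shows "nodes l \<inter> nodes r = {}"
  using assms
proof (rule spans_NodeE)
  fix c assume "spans l a c" "leaves l \<inter> leaves r = {}"
  then show ?thesis
    using leaves_subset_if_node [of _ l] leaves_subset_if_node [of _ r]
      leaves_nonempty_if_node [of l]
    by blast
qed

lemma path_subset_nodes: "set (path i t) \<subseteq> nodes t"
  by (induction t) auto

lemma distinct_path: "distinct (path i t)"
proof (induction t)
  case (Node l r)
  then show ?case
    using path_subset_nodes [of i l] path_subset_nodes [of i r] Node_notin_children [of l r] by auto
qed auto

lemma path_nonempty: "i \<in> leaves t \<Longrightarrow> path i t \<noteq> []"
  by (cases t) auto

lemma root_in_path: "i \<in> leaves t \<Longrightarrow> t \<in> set (path i t)"
  by (cases t) auto

lemma prefix_path:
  "spans t a b \<Longrightarrow> v \<in> nodes t \<Longrightarrow> i \<in> leaves v \<Longrightarrow> prefix (path i v) (path i t)"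
proof (induction t arbitrary: a b)
  case (Node l r)
  from Node.prems(1) obtain c where "spans l a c" "spans r c b" "leaves l \<inter> leaves r = {}"
    by (rule spans_NodeE)
  moreover have "v = Node l r \<or> v \<in> nodes l \<and> i \<in> leaves l \<or> v \<in> nodes r \<and> i \<in> leaves r"
    using Node.prems leaves_subset_if_node [of v l] leaves_subset_if_node [of v r] by auto
  ultimately show ?case
    using Node.IH Node.prems(3) by (elim disjE) (auto intro: prefix_prefix)
qed auto

lemma set_path: "spans t a b \<Longrightarrow> i \<in> leaves t \<Longrightarrow> set (path i t) = {v \<in> nodes t. i \<in> leaves v}"
proof (induction t arbitrary: a b)
  case (Node l r)
  from Node.prems(1) obtain c where "spans l a c" "spans r c b" "leaves l \<inter> leaves r = {}"
    by (rule spans_NodeE)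
  then show ?case
    using Node.IH Node.prems(2) leaves_subset_if_node [of _ l] leaves_subset_if_node [of _ r]
    by (cases "i \<in> leaves l") (auto, blast+)
qed auto

lemma spans_perfect: "spans (perfect h k) k (k + 2 ^ h)"
proof (induction h arbitrary: k)
  case (Suc h)
  from Suc [of k] Suc [of "k + 2 ^ h"] show ?case
    by (auto simp: perfect.simps(2) mult_2 add.assoc intro!: exI [of _ "k + 2 ^ h"])
qed simp

lemma spans_mountain:
  assumes "2 \<le> N"
  shows "spans (mountain i N) (last_leaf (Suc i) (N div 2)) (last_leaf i N)"
proof -
  define q where "q = N div 2"
  have "1 \<le> q" using assms by (simp add: q_def)
  have "N = 2 * q \<or> N = Suc (2 * q)" unfolding q_def by presburger
  then show ?thesis
  proof
    assume "N = 2 * q"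
    then show ?thesis
      using \<open>1 \<le> q\<close> spans_perfect by (simp add: mountain_double last_leaf_double)
  next
    assume "N = Suc (2 * q)"
    then show ?thesis
      using \<open>1 \<le> q\<close> spans_perfect [of "Suc i"]
      by (simp add: mountain_Suc_double last_leaf_Suc_double)
  qed
qed

lemma spans_belt:
  "1 \<le> N \<Longrightarrow> \<exists>c. spans (left_belt i N) 0 c \<and> spans (last_range i N) c (last_leaf i N)"
proof (induction i N rule: halving_induct)
  case (halve i N)
  let ?b = "last_leaf (Suc i) (N div 2)"
  obtain c where parts: "spans (left_belt (Suc i) (N div 2)) 0 c"
    "spans (last_range (Suc i) (N div 2)) c ?b"
    using halve.IH by blast
  have last: "spans (mountain i N) ?b (last_leaf i N)"
    using halve.hyps(1) by (rule spans_mountain)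
  then have "?b < last_leaf i N" by (rule spans_less) simp
  show ?case
  proof (cases "range_starts N")
    case True
    then have "last_range (Suc i) (N div 2) \<noteq> Missing"
      using range_starts_ge [OF True] by (simp add: last_range.simps)
    then have "c < ?b" using parts(2) by (intro spans_less)
    then show ?thesis
      using True parts last \<open>?b < last_leaf i N\<close> by (intro exI [of _ ?b]) (auto simp: belt_unfold)
  next
    case False
    then show ?thesis
      using halve.hyps parts last \<open>?b < last_leaf i N\<close> spans_le [OF parts(2)]
      by (intro exI [of _ c]) (auto simp: belt_unfold)
  qed
qed simp

lemma last_range_not_Missing: "2 \<le> N \<Longrightarrow> last_range i N \<noteq> Missing"
  by (simp add: last_range.simps)

lemma spans_mmb: "spans (mmb n) 0 n"
proof (cases "n = 0")
  case False
  obtain c where "spans (left_belt 0 (Suc n)) 0 c" "spans (last_range 0 (Suc n)) c n"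
    using spans_belt [of "Suc n" 0] by auto
  moreover from this(2) have "c < n"
    using False by (intro spans_less [of "last_range 0 (Suc n)"] last_range_not_Missing) auto
  ultimately show ?thesis
    using False by (auto simp: mmb_eq)
qed simp

lemma leaves_mmb: "leaves (mmb n) = {1..n}"
  using leaves_eq_if_spans [OF spans_mmb] by auto

lemma length_path_perfect: "length (path l (perfect h k)) = Suc h"
  by (induction h arbitrary: k) (auto simp: perfect.simps)

lemma length_path_mountain: "length (path l (mountain i N)) \<le> i + 2"
  by (simp add: mountain_def length_path_perfect)

lemma length_path_Node_le:
  assumes "l \<in> leaves (Node t u)"
    and "l \<in> leaves t \<Longrightarrow> length (path l t) \<le> k" "l \<in> leaves u \<Longrightarrow> length (path l u) \<le> k"
  shows "length (path l (Node t u)) \<le> Suc k"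
  using assms by auto

lemma leaves_belt_le:
  assumes "1 \<le> N" "t \<in> {left_belt i N, last_range i N}" "l \<in> leaves t"
  shows "l \<le> last_leaf i N"
proof -
  obtain c where left: "spans (left_belt i N) 0 c"
    and right: "spans (last_range i N) c (last_leaf i N)"
    using spans_belt assms(1) by blast
  show ?thesis
    using assms(2,3) leaves_eq_if_spans [OF left] leaves_eq_if_spans [OF right] spans_le [OF right]
    by auto
qed

lemma last_leaf_halve_le:
  assumes "2 \<le> N"
  shows "last_leaf (Suc i) (N div 2) + 2 ^ i \<le> last_leaf i N"
proof -
  have "N = 2 * (N div 2) \<or> N = Suc (2 * (N div 2))" by presburger
  then show ?thesis
    using last_leaf_double [of "N div 2" i] last_leaf_Suc_double [of "N div 2" i] assms by auto
qed

lemma length_path_belt: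
  assumes "1 \<le> N" "i \<le> e" "last_leaf i N < l + 2 ^ e"
    and "t \<in> {left_belt i N, last_range i N}" "l \<in> leaves t"
  shows "length (path l t) \<le> 2 * e + 3 - i"
  using assms
proof (induction i N arbitrary: t rule: halving_induct)
  case (halve i N)
  let ?old = "{left_belt (Suc i) (N div 2), last_range (Suc i) (N div 2)}"
  have old: "length (path l u) \<le> 2 * e + 2 - i \<and> i < e" if "u \<in> ?old" "l \<in> leaves u" for u
  proof -
    have "l + 2 ^ i < l + 2 ^ e"
      using leaves_belt_le [OF halve.hyps(2) that] last_leaf_halve_le [OF halve.hyps(1), of i]
        halve.prems(2) by linarith
    then have "i < e" by simp
    then show ?thesis
      using halve.IH [of u] that halve.prems(2) last_leaf_halve_le [OF halve.hyps(1), of i] by auto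
  qed
  have parts: "length (path l u) \<le> 2 * e + 2 - i"
    if "u \<in> {mountain i N, Missing} \<union> ?old" "l \<in> leaves u" for u
    using that old length_path_mountain [of l i N] halve.prems(1) by fastforce
  consider (inherited) "t \<in> ?old"
    | (joined) u v where "t = Node u v" "{u, v} \<subseteq> {mountain i N, Missing} \<union> ?old"
    using halve.hyps(1) halve.prems(3) by (cases "range_starts N") (auto simp: belt_unfold)
  then show ?case
  proof cases
    case inherited
    then show ?thesis using old [of t] halve.prems(4) by fastforce
  next
    case (joined u v)
    have "length (path l (Node u v)) \<le> Suc (2 * e + 2 - i)"
    proof (rule length_path_Node_le)
      show "l \<in> leaves (Node u v)" using halve.prems(4) joined(1) by simp
    qed (use parts joined(2) in blast)+
    then show ?thesis using halve.prems(1) unfolding joined(1) by linarith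
  qed
qed simp

lemma length_path_mmb:
  assumes "1 \<le> l" "l \<le> n" "n < l + 2 ^ e"
  shows "length (path l (mmb n)) \<le> 2 * e + 4"
proof -
  have "l \<in> leaves (mmb n)" using assms by (simp add: leaves_mmb)
  then have "length (path l (mmb n)) \<le> Suc (2 * e + 3 - 0)"
    using length_path_belt [of "Suc n" 0 e l] assms
    by (simp only: mmb_eq last_leaf_zero) (intro length_path_Node_le; simp)
  then show ?thesis by simp
qed

section \<open>The nodes created by an append\<close>

lemma range_starts_double: "range_starts (2 * q) \<longleftrightarrow> odd q \<and> 3 \<le> q"
proof -
  have "2 * r \<in> {2, 3, 6} \<longleftrightarrow> r = 1 \<or> r = 3" for r :: nat by (simp, presburger)
  moreover have "2 * q mod 8 = 2 * (q mod 4)" by (simp add: mult_mod_right)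
  ultimately have "range_starts (2 * q) \<longleftrightarrow> 4 \<le> 2 * q \<and> (q mod 4 = 1 \<or> q mod 4 = 3)"
    by (simp only: range_starts_def)
  then show ?thesis by presburger
qed

lemma range_starts_Suc_double: "range_starts (Suc (2 * q)) \<longleftrightarrow> q mod 4 = 1 \<and> 5 \<le> q"
proof -
  have "Suc (2 * r) \<in> {2, 3, 6} \<longleftrightarrow> r = 1" for r :: nat by (simp, presburger)
  moreover have "Suc (2 * q) mod 8 = Suc (2 * (q mod 4))"
    using mod_mult2_eq [of "Suc (2 * q)" 2 4] by simp
  ultimately have "range_starts (Suc (2 * q)) \<longleftrightarrow> 4 \<le> Suc (2 * q) \<and> q mod 4 = 1"
    by (simp only: range_starts_def)
  then show ?thesis by presburger
qed

text \<open>
  If \<open>N\<close> ends with two digits 1, appending the \<open>N\<close>-th element shifts the indices of its mountains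
  without changing the mountains and range nodes.
\<close>

lemma mountain_shift: "1 \<le> u \<Longrightarrow> mountain i (4 * u - 1) = mountain (Suc i) (2 * u)"
proof -
  assume "1 \<le> u"
  then have "4 * u - 1 = Suc (2 * (2 * u - 1))" by simp
  moreover have "last_leaf (Suc i) (2 * u - 1) = last_leaf (Suc (Suc i)) u"
    by (simp add: last_leaf_def diff_mult_distrib2)
  ultimately show ?thesis by (simp only: mountain_Suc_double mountain_double)
qed

lemma last_range_shift: "1 \<le> u \<Longrightarrow> last_range i (4 * u - 1) = last_range (Suc i) (2 * u)"
proof (induction i u rule: halving_induct)
  case (one i)
  have "mountain i (4 * 1 - 1) = mountain (Suc i) (2 * 1)" by (rule mountain_shift) simp
  then show ?case
    by (simp add: last_range_continues range_starts_def)
next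
  case (halve i u)
  then have shift: "mountain i (4 * u - 1) = mountain (Suc i) (2 * u)"
    by (intro mountain_shift) simp
  define w where "w = u - 1"
  have u_eq: "u = Suc w" using halve.hyps by (simp add: w_def)
  have half: "(4 * u - 1) div 2 = 2 * u - 1" by (simp add: u_eq)
  have "4 * u - 1 = Suc (2 * Suc (2 * w))" by (simp add: u_eq)
  then have "range_starts (4 * u - 1) \<longleftrightarrow> Suc (2 * w) mod 4 = 1 \<and> 5 \<le> Suc (2 * w)"
    by (simp only: range_starts_Suc_double)
  also have "\<dots> \<longleftrightarrow> odd u" using halve.hyps(1) unfolding u_eq by presburger
  finally have "range_starts (4 * u - 1) \<longleftrightarrow> odd u" .
  moreover have "range_starts (2 * u) \<longleftrightarrow> odd u"
    using halve.hyps(1) by (auto simp: range_starts_double le_less numeral_3_eq_3 Suc_le_eq)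
  moreover have "last_range (Suc i) (2 * u - 1) = last_range (Suc (Suc i)) u" if "even u"
    using halve.IH that by (auto elim!: evenE)
  ultimately show ?case
    using halve.hyps shift half
    by (cases "odd u") (simp_all add: last_range_starts last_range_continues)
qed

lemma left_belt_power: "even q \<Longrightarrow> 1 \<le> q \<Longrightarrow> left_belt i (2 ^ r * q) = left_belt (i + r) q"
proof (induction r arbitrary: i)
  case (Suc r)
  then have "left_belt i (2 * (2 ^ r * q)) = left_belt (Suc i) (2 ^ r * q)"
    by (simp add: left_belt_continues range_starts_double)
  with Suc show ?case by (simp add: mult.assoc)
qed simp

definition belt_nodes :: "nat \<Rightarrow> nat \<Rightarrow> tree set" where
  "belt_nodes i N = nodes (left_belt i N) \<union> nodes (last_range i N)"

lemma belt_nodes_half: "1 \<le> N \<Longrightarrow> belt_nodes (Suc i) (N div 2) \<subseteq> belt_nodes i N"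
  by (cases "N = 1"; cases "range_starts N")
     (auto simp: belt_nodes_def belt_unfold left_belt.simps [of _ 0] last_range.simps [of _ 0])

lemma belt_nodes_div: "1 \<le> N div 2 ^ h \<Longrightarrow> belt_nodes h (N div 2 ^ h) \<subseteq> belt_nodes 0 N"
proof (induction h)
  case (Suc h)
  have half: "N div 2 ^ Suc h = N div 2 ^ h div 2" by (simp only: div_mult2_eq power_Suc2)
  then have "1 \<le> N div 2 ^ h" using Suc.prems by (cases "N div 2 ^ h") auto
  then show ?case using Suc.IH belt_nodes_half [of "N div 2 ^ h" h] half by auto
qed simp

lemma nodes_mountain_subset: "2 \<le> N \<Longrightarrow> nodes (mountain i N) \<subseteq> belt_nodes i N"
  by (cases "range_starts N") (auto simp: belt_nodes_def last_range_starts last_range_continues)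

lemma belt_nodes_subset_mmb: "belt_nodes 0 (Suc n) \<subseteq> nodes (mmb n)"
  by (cases "n = 0") (auto simp: belt_nodes_def mmb_eq)

lemma div_eq_if_Suc_eq_mult: "Suc N = d * Suc q \<Longrightarrow> N div d = q"
  for N d q :: nat
proof -
  assume "Suc N = d * Suc q"
  then have "N = (d - 1) + q * d" "0 < d" by (cases d; simp)+
  then show ?thesis by (simp only: div_mult_self1) simp
qed

text \<open>
  Appending the \<open>N\<close>-th element increments the binary number \<open>N\<close>. If the carry stops at digit
  \<open>j\<close>, leaving the digits of \<open>a\<close> unchanged, two mountains of height \<open>j\<close> are merged (none if
  \<open>a = 0\<close>). The mountains right of the merged pair form the last range, so only the nodes next to
  the merge and next to the new leaf are created.
\<close>

locale carry =
  fixes N j a :: nat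
  assumes Suc_eq: "Suc N = 2 ^ j * Suc (2 * a)"

lemma ex_carry: "\<exists>j a. carry N j a"
  unfolding carry_def
proof (induction N rule: less_induct)
  case (less N)
  show ?case
  proof (cases "odd (Suc N)")
    case True
    then show ?thesis by (intro exI [of _ 0] exI [of _ "N div 2"]) auto
  next
    case False
    then obtain q where half: "Suc N = 2 * Suc q"
      by (metis dvdE mult_0_right nat.distinct(1) old.nat.exhaust)
    then obtain j a where "Suc q = 2 ^ j * Suc (2 * a)" using less.IH [of q] by auto
    with half have "Suc N = 2 ^ Suc j * Suc (2 * a)" by (simp add: mult.assoc)
    then show ?thesis by blast
  qed
qed

context carry
begin

abbreviation "pair_right \<equiv> perfect j (last_leaf j (2 * a))"

abbreviation "merged_peak \<equiv> mountain j (Suc (2 * a))"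

abbreviation "merged_range \<equiv> last_range j (Suc (2 * a))"

abbreviation "merged_left \<equiv> left_belt j (Suc (2 * a))"

abbreviation "merged_belt \<equiv> Node merged_left merged_range"

definition new_nodes :: "tree set" where
  "new_nodes = {Leaf N, last_range 0 (Suc N), mmb N} \<union>
     (if a = 0 then {} else {merged_peak, merged_range, merged_belt})"

lemma div_exponent: "N div 2 ^ j = 2 * a"
  using Suc_eq by (rule div_eq_if_Suc_eq_mult)

lemma Suc_div_exponent: "Suc N div 2 ^ j = Suc (2 * a)"
  by (simp add: Suc_eq)

lemma Suc_div_above:
  assumes "j < i"
  shows "Suc N div 2 ^ i = N div 2 ^ i"
proof -
  have split: "(2::nat) ^ i = 2 ^ j * (2 * 2 ^ (i - Suc j))"
    using assms by (simp flip: power_Suc power_add)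
  show ?thesis unfolding split div_mult2_eq div_exponent Suc_div_exponent by simp
qed

lemma carry_div: "i \<le> j \<Longrightarrow> carry (N div 2 ^ i) (j - i) a"
proof
  assume "i \<le> j"
  then have "Suc N = 2 ^ i * (2 ^ (j - i) * Suc (2 * a))"
    by (simp add: Suc_eq flip: mult.assoc power_add del: mult_Suc_right)
  moreover have "Suc (2 ^ (j - i) * Suc (2 * a) - 1) = 2 ^ (j - i) * Suc (2 * a)" by simp
  ultimately show "Suc (N div 2 ^ i) = 2 ^ (j - i) * Suc (2 * a)"
    by (metis div_eq_if_Suc_eq_mult)
qed

lemma div_below_exponent: "j = Suc r \<Longrightarrow> N div 2 ^ r = Suc (2 * (2 * a))"
  using carry_div [of r] by (simp add: carry_def)

lemma left_belt_Suc:
  "left_belt 0 (Suc N) = (if j = 0 then merged_left else if a = 0 then Missing else merged_belt)"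
proof (cases j)
  case (Suc r)
  have "left_belt 0 (2 ^ r * (2 * Suc (2 * a))) = left_belt r (2 * Suc (2 * a))"
    using left_belt_power [of "2 * Suc (2 * a)" 0 r] by simp
  moreover have "2 ^ r * (2 * Suc (2 * a)) = Suc N" by (simp add: Suc_eq Suc)
  ultimately show ?thesis
    using range_starts_double [of "Suc (2 * a)"] Suc
    by (auto simp: left_belt_starts left_belt_continues simp del: mult_Suc_right)
qed (use Suc_eq in simp)

lemma last_range_Suc_zero: "j = 0 \<Longrightarrow> last_range 0 (Suc N) = merged_range"
  using Suc_eq by simp

lemma last_range_Suc:
  assumes "1 \<le> j"
  shows "last_range 0 (Suc N) = Node (if j = 1 then Missing else last_range 0 N) (Leaf N)"
proof -
  obtain r where j_eq: "j = Suc r" using assms by (cases j) auto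
  define q where "q = 2 ^ r * Suc (2 * a)"
  have half: "Suc N = 2 * q" "1 \<le> q"
    by (simp_all add: q_def Suc_eq j_eq Suc_le_eq)
  have "odd N" using half(1) by presburger
  then have peak: "mountain 0 (2 * q) = Leaf N"
    using mountain_0_Suc by (simp only: half(1) [symmetric])
  show ?thesis
  proof (cases r)
    case 0
    then have "odd q" by (simp add: q_def)
    moreover from this have "3 \<le> q \<or> q = 1" by presburger
    ultimately have "range_starts (2 * q) \<or> q = 1"
      by (simp add: range_starts_double)
    moreover have "\<not> range_starts 2" by (simp add: range_starts_def)
    ultimately show ?thesis
      using 0 j_eq peak half by (auto simp: last_range_starts last_range_continues)
  next
    case (Suc s)
    define u where "u = 2 ^ s * Suc (2 * a)"
    have quarter: "q = 2 * u" "1 \<le> u"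
      by (simp_all add: u_def q_def Suc Suc_le_eq)
    have "N = 4 * u - 1" using half quarter by simp
    then have "last_range 0 N = last_range 1 q"
      using last_range_shift [of u 0] quarter by simp
    then show ?thesis
      using Suc j_eq peak half quarter range_starts_double [of q]
      by (simp add: last_range_continues)
  qed
qed

lemma nodes_pair_right_subset:
  assumes "1 \<le> a"
  shows "nodes pair_right \<subseteq> insert (Leaf N) (belt_nodes 0 N)"
proof (cases j)
  case 0
  then show ?thesis using Suc_eq assms by simp
next
  case (Suc r)
  have "pair_right = mountain r (Suc (2 * (2 * a)))"
    by (simp only: Suc mountain_Suc_double)
  then show ?thesis
    using nodes_mountain_subset [of "Suc (2 * (2 * a))" r] belt_nodes_div [of N r] assms
    unfolding div_below_exponent [OF Suc] by auto
qed

lemma nodes_merged_belt_subset: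
  assumes "1 \<le> a"
  shows "nodes merged_belt \<subseteq> belt_nodes 0 N \<union> new_nodes"
proof -
  let ?A = "belt_nodes 0 N \<union> new_nodes"
  have new: "Leaf N \<in> ?A" "merged_peak \<in> ?A" "merged_range \<in> ?A" "merged_belt \<in> ?A"
    using assms by (simp_all add: new_nodes_def)
  have old: "belt_nodes j (2 * a) \<subseteq> ?A"
    using belt_nodes_div [of N j] div_exponent assms by auto
  have older: "belt_nodes (Suc j) a \<subseteq> ?A"
    using belt_nodes_half [of "2 * a" j] assms old by auto
  have "nodes merged_peak \<subseteq> ?A"
    using nodes_mountain_subset [of "2 * a" j] nodes_pair_right_subset new old assms
    by (auto simp: mountain_Suc_double_eq_Node)
  moreover have "nodes merged_left \<subseteq> ?A \<and> nodes merged_range \<subseteq> nodes merged_peak \<union> ?A"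
  proof (cases "range_starts (Suc (2 * a))")
    case True
    moreover from this have "range_starts (2 * a)"
      unfolding range_starts_double range_starts_Suc_double by presburger
    ultimately show ?thesis
      using old new by (auto simp: belt_unfold belt_nodes_def)
  next
    case False
    then show ?thesis
      using older new assms by (auto simp: belt_unfold belt_nodes_def)
  qed
  ultimately show ?thesis using new by auto
qed

end

definition created :: "nat \<Rightarrow> tree set" where
  "created p = nodes (mmb p) - nodes (mmb (p - 1))"

lemma finite_created [simp]: "finite (created p)"
  by (simp add: created_def)

context carry
begin

lemma created_subset_new_nodes: "created N \<subseteq> new_nodes"
proof (cases "N = 0")
  case False
  then have old: "belt_nodes 0 N \<subseteq> nodes (mmb (N - 1))"
    using belt_nodes_subset_mmb [of "N - 1"] by simp
  have new: "mmb N \<in> new_nodes" "last_range 0 (Suc N) \<in> new_nodes" "Leaf N \<in> new_nodes"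
    by (auto simp: new_nodes_def)
  have nodes_mmb: "nodes (mmb N) =
      {mmb N} \<union> nodes (left_belt 0 (Suc N)) \<union> nodes (last_range 0 (Suc N))"
    using False by (auto simp: mmb_eq)
  have "nodes (mmb N) \<subseteq> belt_nodes 0 N \<union> new_nodes"
  proof (cases "j = 0")
    case True
    then have "1 \<le> a" using Suc_eq False by simp
    then show ?thesis
      using nodes_merged_belt_subset new True
      by (auto simp: nodes_mmb left_belt_Suc last_range_Suc_zero)
  next
    case False
    have "nodes (last_range 0 (Suc N)) \<subseteq> belt_nodes 0 N \<union> new_nodes"
      using last_range_Suc new False by (auto simp: belt_nodes_def)
    moreover have "nodes (left_belt 0 (Suc N)) \<subseteq> belt_nodes 0 N \<union> new_nodes"
      using nodes_merged_belt_subset False unfolding left_belt_Suc by (cases "a = 0") simp_all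
    ultimately show ?thesis
      using new unfolding nodes_mmb by blast
  qed
  then show ?thesis
    using old by (auto simp: created_def)
qed (simp add: created_def)

lemma leaves_new_nodes:
  assumes "1 \<le> N" "v \<in> new_nodes"
  shows "N \<in> leaves v \<or> Suc N - 2 ^ j \<in> leaves v"
proof -
  obtain c where range: "spans (last_range 0 (Suc N)) c N"
    using spans_belt [of "Suc N" 0] by auto
  have "c < N"
    using spans_less [OF range] assms(1) by (simp add: last_range_not_Missing)
  then have "N \<in> leaves (last_range 0 (Suc N))" "N \<in> leaves (mmb N)"
    using leaves_eq_if_spans [OF range] assms(1) by (auto simp: leaves_mmb)
  moreover have "Suc N - 2 ^ j \<in> leaves merged_peak \<and> Suc N - 2 ^ j \<in> leaves merged_range"
    if "a \<noteq> 0"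
  proof -
    have "Suc N - 2 ^ j = last_leaf j (Suc (2 * a))" by (simp add: Suc_eq last_leaf_def)
    moreover have peak: "spans merged_peak (last_leaf (Suc j) a) (last_leaf j (Suc (2 * a)))"
      using spans_mountain [of "Suc (2 * a)" j] that by simp
    ultimately have "Suc N - 2 ^ j \<in> leaves merged_peak"
      using leaves_eq_if_spans [OF peak] spans_less [OF peak] by simp
    then show ?thesis
      using that by (simp add: last_range.simps)
  qed
  ultimately show ?thesis
    using assms(2) unfolding new_nodes_def by (auto split: if_splits)
qed

end

lemma card_created_le: "card (created p) \<le> 6"
proof -
  obtain j a where "carry p j a" using ex_carry by blast
  then interpret carry p j a .
  have "finite new_nodes" "card new_nodes \<le> 6" by (auto simp: new_nodes_def card_insert_if)
  then show ?thesis
    using created_subset_new_nodes card_mono le_trans by blast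
qed

lemma leaves_created:
  assumes "1 \<le> p" "v \<in> created p"
  obtains "p \<in> leaves v" | j where "2 ^ j dvd Suc p" "Suc p - 2 ^ j \<in> leaves v"
proof -
  obtain j a where carry: "carry p j a" using ex_carry by blast
  then have "2 ^ j dvd Suc p" by (simp add: carry.Suc_eq)
  moreover have "p \<in> leaves v \<or> Suc p - 2 ^ j \<in> leaves v"
    using carry.leaves_new_nodes [OF carry assms(1)] carry.created_subset_new_nodes [OF carry]
      assms(2)
    by blast
  ultimately show thesis using that by blast
qed

section \<open>Nodes changed by an increment\<close>

definition settled :: "nat \<Rightarrow> tree \<Rightarrow> bool" where
  "settled m v \<longleftrightarrow> v \<in> nodes (mmb m) \<or> leaves v \<inter> {1..m} = {}"

definition reworked :: "nat \<Rightarrow> nat \<Rightarrow> tree set" where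
  "reworked m n = {v \<in> nodes (mmb n). \<not> settled m v}"

lemma finite_reworked [simp]: "finite (reworked m n)"
  by (simp add: reworked_def)

text \<open>The appends after time \<open>m\<close> whose merge only involves leaves up to \<open>m\<close>.\<close>

definition late_merges :: "nat \<Rightarrow> nat \<Rightarrow> nat set" where
  "late_merges m n = {p. m < p \<and> p \<le> n \<and> (\<exists>j. 2 ^ j dvd Suc p \<and> Suc p - 2 ^ j \<le> m)}"

lemma finite_late_merges [simp]: "finite (late_merges m n)"
  by (rule finite_subset [of _ "{..n}"]) (auto simp: late_merges_def)

lemma le_floor_log: "2 ^ j \<le> k \<Longrightarrow> j \<le> floor_log k"
  using monoD [OF floor_log_mono, of "2 ^ j" k] by simp

lemma add_le_if_dvd_less: "d dvd x \<Longrightarrow> d dvd y \<Longrightarrow> x < y \<Longrightarrow> x + d \<le> y"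
  for d x y :: nat
  using dvd_imp_le [of d "y - x"] by (simp add: dvd_diff_nat)

lemma card_le_if_increasing:
  fixes f :: "nat \<Rightarrow> nat"
  assumes "finite A"
    and less: "\<And>p q. p \<in> A \<Longrightarrow> q \<in> A \<Longrightarrow> p < q \<Longrightarrow> f p < f q"
    and bound: "\<And>p q. p \<in> A \<Longrightarrow> q \<in> A \<Longrightarrow> p < q \<Longrightarrow> f p \<le> k"
  shows "card A \<le> k + 2"
proof (cases "A = {}")
  case False
  let ?B = "A - {Max A}"
  have "inj_on f ?B"
    using less by (intro inj_onI) (metis DiffD1 less_irrefl nat_neq_iff)
  moreover have "f ` ?B \<subseteq> {..k}"
    using bound Max_ge [OF assms(1)] Max_in [OF assms(1) False] by (force simp: le_less)
  ultimately have "card ?B \<le> card {..k}" by (intro card_inj_on_le) auto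
  then show ?thesis
    using assms(1) False by (simp add: card_Diff_singleton_if split: if_splits)
qed simp

lemma merge_exponent_less:
  assumes "m < p" "p < p'" "2 ^ j dvd Suc p" "2 ^ j' dvd Suc p'" "Suc p' - 2 ^ j' \<le> m"
  shows "j < j'" "2 ^ j \<le> p' - m"
proof -
  show "j < j'"
  proof (rule ccontr)
    assume "\<not> j < j'"
    then have "2 ^ j' dvd Suc p" using assms(3) by (meson dvd_trans le_imp_power_dvd not_less)
    then have "Suc p + 2 ^ j' \<le> Suc p'" using assms(2,4) by (intro add_le_if_dvd_less) auto
    then show False using assms(1,5) by linarith
  qed
  then have "2 ^ j dvd Suc p'" using assms(4) by (meson dvd_trans le_imp_power_dvd less_imp_le)
  then have "Suc p + 2 ^ j \<le> Suc p'" using assms(2,3) by (intro add_le_if_dvd_less) auto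
  then show "2 ^ j \<le> p' - m" using assms(1) by linarith
qed

lemma card_late_merges: "card (late_merges m n) \<le> floor_log (n - m) + 2"
proof -
  have "\<forall>p\<in>late_merges m n. \<exists>j. 2 ^ j dvd Suc p \<and> Suc p - 2 ^ j \<le> m"
    by (auto simp: late_merges_def)
  then obtain f where exponent: "\<And>p. p \<in> late_merges m n \<Longrightarrow> 2 ^ f p dvd Suc p \<and> Suc p - 2 ^ f p \<le> m"
    by metis
  have "f p < f q \<and> f p \<le> floor_log (n - m)"
    if "p \<in> late_merges m n" "q \<in> late_merges m n" "p < q" for p q
  proof -
    have "m < p" "q \<le> n" using that by (auto simp: late_merges_def)
    then have "f p < f q" "2 ^ f p \<le> q - m"
      using merge_exponent_less [of m p q "f p" "f q"] exponent that by auto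
    moreover have "q - m \<le> n - m" using \<open>q \<le> n\<close> by simp
    ultimately show ?thesis using le_floor_log le_trans by blast
  qed
  then show ?thesis by (intro card_le_if_increasing [where f = f]) auto
qed

lemma created_between:
  assumes "m \<le> n" "v \<in> nodes (mmb n)" "v \<notin> nodes (mmb m)"
  obtains p where "m < p" "p \<le> n" "v \<in> created p"
proof -
  have "\<exists>p. m < p \<and> p \<le> n \<and> v \<in> created p"
    using assms
  proof (induction n rule: dec_induct)
    case (step n)
    show ?case
    proof (cases "v \<in> nodes (mmb n)")
      case False
      then show ?thesis using step by (intro exI [of _ "Suc n"]) (simp add: created_def)
    qed (use step in \<open>auto intro: le_SucI\<close>)
  qed simp
  then show thesis using that by blast
qed

lemma reworked_subset:
  assumes "m < n"
  shows "reworked m n \<subseteq> set (path (Suc m) (mmb n)) \<union> (\<Union>p\<in>late_merges m n. created p)"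
proof
  fix v assume "v \<in> reworked m n"
  then have in_new: "v \<in> nodes (mmb n)" "v \<notin> nodes (mmb m)" "leaves v \<inter> {1..m} \<noteq> {}"
    by (auto simp: reworked_def settled_def)
  show "v \<in> set (path (Suc m) (mmb n)) \<union> (\<Union>p\<in>late_merges m n. created p)"
  proof (cases "Suc m \<in> leaves v")
    case True
    then show ?thesis
      using in_new assms set_path [OF spans_mmb, of "Suc m" n] by (simp add: leaves_mmb)
  next
    case False
    obtain b c where "spans v b c" using spans_node [OF spans_mmb in_new(1)] by blast
    then have old: "leaves v \<subseteq> {..m}" using False in_new(3) leaves_eq_if_spans [of v b c] by auto
    obtain p where created: "m < p" "p \<le> n" "v \<in> created p"
      using created_between assms in_new(1,2) by (metis less_imp_le)
    have "1 \<le> p" using created(1) by simp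
    then obtain j where "2 ^ j dvd Suc p" "Suc p - 2 ^ j \<le> m"
      using created(3) by (rule leaves_created) (use old created(1) in auto)
    then show ?thesis
      using created by (auto simp: late_merges_def)
  qed
qed

lemma card_reworked:
  assumes "m < n"
  shows "card (reworked m n) \<le> 8 * floor_log (n - m) + 18"
proof -
  let ?k = "floor_log (n - m)" and ?path = "path (Suc m) (mmb n)"
  let ?late = "\<Union>p\<in>late_merges m n. created p"
  have "n < Suc m + 2 ^ Suc ?k" using floor_log_exp2_gt [of "n - m"] by simp
  then have path: "length ?path \<le> 2 * Suc ?k + 4"
    using assms by (intro length_path_mmb) auto
  have "card ?late \<le> (\<Sum>p\<in>late_merges m n. card (created p))"
    by (intro card_UN_le) simp
  also have "\<dots> \<le> card (late_merges m n) * 6"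
    using sum_bounded_above [of "late_merges m n" "\<lambda>p. card (created p)" 6] card_created_le by simp
  also have "\<dots> \<le> (?k + 2) * 6" by (intro mult_le_mono1 card_late_merges)
  finally have late: "card ?late \<le> (?k + 2) * 6" .
  have "card (reworked m n) \<le> card (set ?path \<union> ?late)"
    using reworked_subset [OF assms] by (intro card_mono) auto
  also have "\<dots> \<le> card (set ?path) + card ?late" by (rule card_Un_le)
  also have "\<dots> \<le> length ?path + card ?late" by (simp add: card_length)
  finally show ?thesis using path late by simp
qed

section \<open>Membership proofs\<close>

definition sibling_step :: "hash_fun \<Rightarrow> hash \<Rightarrow> (nat \<Rightarrow> bool list) \<Rightarrow> nat \<Rightarrow> tree \<Rightarrow> step" where
  "sibling_step H d x i v = (case v of Node l r \<Rightarrow>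
     if i \<in> leaves l then RightSib (label H d x r)
     else if l = Missing then NoSib else LeftSib (label H d x l) | _ \<Rightarrow> NoSib)"

lemma siblings_eq: "i \<in> leaves t \<Longrightarrow> siblings H d x i t = map (sibling_step H d x i) (tl (path i t))"
proof (induction t)
  case (Node l r)
  have "i \<in> leaves l \<Longrightarrow> path i l \<noteq> []" "i \<in> leaves r \<Longrightarrow> path i r \<noteq> []"
    by (simp_all add: path_nonempty)
  with Node show ?case by (auto simp: sibling_step_def)
qed auto

lemma membership_proof_eq:
  "1 \<le> i \<Longrightarrow> i \<le> n \<Longrightarrow>
    membership_proof H d x n i = map (sibling_step H d x i) (tl (path i (mmb n)))"
  by (simp add: membership_proof_def siblings_eq leaves_mmb)

lemma recompute_siblings:
  "i \<in> leaves t \<Longrightarrow> recompute H d (H (x i)) (siblings H d x i t) = label H d x t"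
  by (induction t) (auto simp: recompute_def)

lemma recompute_membership_proof:
  "1 \<le> i \<Longrightarrow> i \<le> n \<Longrightarrow> recompute H d (H (x i)) (membership_proof H d x n i) = root_hash H d x n"
  by (simp add: membership_proof_def root_hash_def recompute_siblings leaves_mmb)

lemma length_membership_proof:
  assumes "1 \<le> i" "i \<le> n" "n - i < k"
  shows "length (membership_proof H d x n i) \<le> 2 * floor_log k + 5"
proof -
  have "n < i + 2 ^ Suc (floor_log k)" using floor_log_exp2_gt [of k] assms(3) by simp
  then have "length (path i (mmb n)) \<le> 2 * Suc (floor_log k) + 4"
    using length_path_mmb [OF assms(1,2)] by blast
  then show ?thesis using assms by (simp add: membership_proof_eq)
qed

abbreviation kept_path :: "nat \<Rightarrow> nat \<Rightarrow> nat \<Rightarrow> tree list" where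
  "kept_path m n i \<equiv> longest_common_prefix (path i (mmb m)) (path i (mmb n))"

lemma take_kept:
  assumes "1 \<le> i" "i \<le> m" "i \<le> n"
  shows "kept m n i \<le> length (membership_proof H d x m i)"
    and "take (kept m n i) (membership_proof H d x m i) =
      take (kept m n i) (membership_proof H d x n i)"
proof -
  let ?old = "path i (mmb m)" and ?new = "path i (mmb n)" and ?common = "kept_path m n i"
  obtain us vs where split: "?old = ?common @ us" "?new = ?common @ vs"
    by (metis longest_common_prefix_prefix1 longest_common_prefix_prefix2 prefix_def)
  have "length ?common \<le> length ?old" by (subst split(1)) simp
  then show "kept m n i \<le> length (membership_proof H d x m i)"
    using assms by (simp add: kept_def membership_proof_eq)
  have "take (kept m n i) (tl ?old) = take (kept m n i) (tl ?new)"
  proof (cases "?common = []")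
    case False
    then show ?thesis by (subst split(1), subst split(2)) (simp add: kept_def)
  qed (simp add: kept_def)
  then show "take (kept m n i) (membership_proof H d x m i) =
      take (kept m n i) (membership_proof H d x n i)"
    using assms by (simp add: membership_proof_eq take_map)
qed

lemma changed_path_subset_reworked:
  assumes "1 \<le> i" "i \<le> m" "m < n" "path i (mmb n) = kept_path m n i @ vs"
  shows "set vs \<subseteq> reworked m n"
proof
  have "i \<in> leaves (mmb n)" using assms by (simp add: leaves_mmb)
  fix w assume "w \<in> set vs"
  then have "w \<in> set (path i (mmb n))" by (subst assms(4)) simp
  then have in_new: "w \<in> nodes (mmb n)" "i \<in> leaves w"
    using set_path [OF spans_mmb \<open>i \<in> leaves (mmb n)\<close>] by auto
  have "w \<notin> nodes (mmb m)"
  proof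
    assume "w \<in> nodes (mmb m)"
    then have "prefix (path i w) (kept_path m n i)"
      using in_new by (intro longest_common_prefix_max_prefix prefix_path [OF spans_mmb])
    then have "w \<in> set (kept_path m n i)"
      using root_in_path [OF in_new(2)] set_mono_prefix by blast
    moreover have "distinct (kept_path m n i @ vs)"
      using distinct_path [of i "mmb n"] assms(4) by simp
    ultimately show False using \<open>w \<in> set vs\<close> by auto
  qed
  then show "w \<in> reworked m n"
    using in_new assms by (auto simp: reworked_def settled_def)
qed

lemma length_drop_kept:
  assumes "1 \<le> i" "i \<le> m" "m < n"
  shows "length (drop (kept m n i) (membership_proof H d x n i)) \<le> 8 * floor_log (n - m) + 18"
proof -
  obtain vs where split: "path i (mmb n) = kept_path m n i @ vs"
    by (metis longest_common_prefix_prefix2 prefix_def)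
  then have "distinct vs" using distinct_path [of i "mmb n"] by (metis distinct_append)
  then have "length vs = card (set vs)" by (simp add: distinct_card)
  also have "\<dots> \<le> card (reworked m n)"
    using changed_path_subset_reworked [OF assms split] by (intro card_mono) simp_all
  also have "\<dots> \<le> 8 * floor_log (n - m) + 18" using assms(3) by (rule card_reworked)
  finally have "length vs \<le> 8 * floor_log (n - m) + 18" .
  moreover have "length (path i (mmb n)) = length (kept_path m n i) + length vs"
    by (subst split) simp
  ultimately show ?thesis
    using assms by (simp add: kept_def membership_proof_eq)
qed

section \<open>Increment proofs\<close>

fun frontier :: "(tree \<Rightarrow> bool) \<Rightarrow> tree \<Rightarrow> tree list" where
  "frontier Q Missing = []"
| "frontier Q (Leaf i) = [Leaf i]"
| "frontier Q (Node l r) = (if Q (Node l r) then [Node l r] else frontier Q l @ frontier Q r)"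

fun rebuild :: "(tree \<Rightarrow> bool) \<Rightarrow> tree \<Rightarrow> instr list" where
  "rebuild Q Missing = []"
| "rebuild Q (Leaf i) = [Shift]"
| "rebuild Q (Node l r) =
    (if Q (Node l r) then [Shift]
     else if l = Missing then rebuild Q r @ [JoinDefault]
     else rebuild Q l @ rebuild Q r @ [Join])"

definition maximal_nodes :: "(tree \<Rightarrow> bool) \<Rightarrow> tree \<Rightarrow> tree set" where
  "maximal_nodes Q t = {v \<in> nodes t. Q v \<and> (\<forall>w\<in>nodes t. Q w \<longrightarrow> v \<in> nodes w \<longrightarrow> w = v)}"

lemma reduce_rebuild_append:
  "spans t a b \<Longrightarrow> t \<noteq> Missing \<Longrightarrow>
   reduce_nodes Node Missing (rebuild Q t @ is) (frontier Q t @ vs) stk =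
   reduce_nodes Node Missing is vs (t # stk)"
proof (induction t arbitrary: a b "is" vs stk)
  case (Node l r)
  from Node.prems(1) obtain c where "spans l a c" "spans r c b" "r \<noteq> Missing"
    by (rule spans_NodeE)
  then show ?case using Node.IH by auto
qed auto

lemma reduce_rebuild:
  assumes "spans t a b" "t \<noteq> Missing"
  shows "reduce_nodes Node Missing (rebuild Q t) (frontier Q t) [] = Some t"
  using reduce_rebuild_append [OF assms, of Q "[]" "[]" "[]"] by simp

lemma frontier_subset_nodes: "set (frontier Q t) \<subseteq> nodes t"
  by (induction t) auto

lemma leaves_frontier: "(\<Union>v\<in>set (frontier Q t). leaves v) = leaves t"
  by (induction t) auto

lemma set_frontier:
  assumes "spans t a b" "\<And>i. i \<in> leaves t \<Longrightarrow> Q (Leaf i)"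
  shows "set (frontier Q t) = maximal_nodes Q t"
  using assms
proof (induction t arbitrary: a b)
  case (Node l r)
  show ?case
  proof (cases "Q (Node l r)")
    case True
    have "w = Node l r" if "w \<in> nodes (Node l r)" "Node l r \<in> nodes w" for w
      using that nodes_antisym by blast
    moreover have "Node l r \<in> nodes (Node l r)" by simp
    ultimately show ?thesis
      using True by (auto simp: maximal_nodes_def simp del: nodes.simps(3))
  next
    case False
    from Node.prems(1) obtain c where "spans l a c" "spans r c b" by (rule spans_NodeE)
    then have subtrees:
      "set (frontier Q l) = maximal_nodes Q l" "set (frontier Q r) = maximal_nodes Q r"
      using Node.IH Node.prems(2) by simp_all
    have "v \<notin> nodes w" if "v \<in> nodes l \<and> w \<in> nodes r \<or> v \<in> nodes r \<and> w \<in> nodes l" for v w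
      using that nodes_disjoint [OF Node.prems(1)] nodes_trans by blast
    then have "set (frontier Q l) \<union> set (frontier Q r) =
      {v \<in> nodes l \<union> nodes r. Q v \<and> (\<forall>w\<in>nodes l \<union> nodes r. Q w \<longrightarrow> v \<in> nodes w \<longrightarrow> w = v)}"
      unfolding subtrees maximal_nodes_def by blast
    then show ?thesis using False by (auto simp: maximal_nodes_def)
  qed
qed (auto simp: maximal_nodes_def)

lemma length_frontier: "spans t a b \<Longrightarrow> length (frontier Q t) \<le> Suc (card {v \<in> nodes t. \<not> Q v})"
proof (induction t arbitrary: a b)
  case (Node l r)
  from Node.prems obtain c where spans: "spans l a c" "spans r c b" by (rule spans_NodeE)
  show ?case
  proof (cases "Q (Node l r)")
    case False
    let ?l = "{v \<in> nodes l. \<not> Q v}" and ?r = "{v \<in> nodes r. \<not> Q v}"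
    have "{v \<in> nodes (Node l r). \<not> Q v} = insert (Node l r) (?l \<union> ?r)" using False by auto
    moreover have "Node l r \<notin> ?l \<union> ?r" by (simp add: Node_notin_children)
    moreover have "card (?l \<union> ?r) = card ?l + card ?r"
      using nodes_disjoint [OF Node.prems] by (intro card_Un_disjoint) auto
    ultimately show ?thesis
      using False Node.IH(1) [OF spans(1)] Node.IH(2) [OF spans(2)] by simp
  qed simp
qed auto

definition left_of :: "tree \<Rightarrow> tree \<Rightarrow> bool" where
  "left_of u v \<longleftrightarrow> leaves u \<noteq> {} \<and> leaves v \<noteq> {} \<and> (\<forall>i\<in>leaves u. \<forall>j\<in>leaves v. i < j)"

lemma left_of_asym: "left_of u v \<Longrightarrow> \<not> left_of v u"
  unfolding left_of_def by (meson all_not_in_conv less_asym)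

lemma sorted_frontier: "spans t a b \<Longrightarrow> sorted_wrt left_of (frontier Q t)"
proof (induction t arbitrary: a b)
  case (Node l r)
  from Node.prems obtain c where spans: "spans l a c" "spans r c b" by (rule spans_NodeE)
  have "left_of u v" if "u \<in> nodes l" "v \<in> nodes r" for u v
  proof -
    have "leaves u \<subseteq> {a<..c}" "leaves v \<subseteq> {c<..b}"
      using leaves_subset_if_node that leaves_eq_if_spans [OF spans(1)]
        leaves_eq_if_spans [OF spans(2)]
      by blast+
    then show ?thesis
      using leaves_nonempty_if_node [OF spans(1) that(1)]
        leaves_nonempty_if_node [OF spans(2) that(2)]
      by (fastforce simp: left_of_def)
  qed
  then show ?case
    using Node.IH(1) [OF spans(1)] Node.IH(2) [OF spans(2)]
      frontier_subset_nodes [of Q l] frontier_subset_nodes [of Q r]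
    by (auto simp: sorted_wrt_append)
qed auto

lemma sorted_wrt_unique:
  assumes asym: "\<And>x y. r x y \<Longrightarrow> \<not> r y x"
  shows "sorted_wrt r xs \<Longrightarrow> sorted_wrt r ys \<Longrightarrow> set xs = set ys \<Longrightarrow> xs = ys"
proof (induction xs arbitrary: ys)
  case (Cons x xs)
  then obtain y zs where ys_eq: "ys = y # zs" by (cases ys) auto
  have "x = y"
  proof (rule ccontr)
    assume "x \<noteq> y"
    then have "y \<in> set xs" "x \<in> set zs" using Cons.prems(3) ys_eq by auto
    then show False using Cons.prems(1,2) ys_eq asym by auto
  qed
  moreover have "x \<notin> set xs" "y \<notin> set zs" using Cons.prems(1,2) ys_eq asym by auto
  ultimately have "set xs = set zs" using Cons.prems(3) ys_eq by auto
  then show ?case using Cons.IH [of zs] Cons.prems ys_eq \<open>x = y\<close> by auto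
qed simp

lemma distinct_if_sorted_wrt_asym:
  assumes "\<And>x y. r x y \<Longrightarrow> \<not> r y x"
  shows "sorted_wrt r xs \<Longrightarrow> distinct xs"
  using assms by (induction xs) auto

lemma filter_append_filter_if_upward_closed:
  "sorted_wrt (\<lambda>x y. P x \<longrightarrow> P y) xs \<Longrightarrow> filter (\<lambda>x. \<not> P x) xs @ filter P xs = xs"
proof (induction xs)
  case (Cons x xs)
  show ?case
  proof (cases "P x")
    case True
    then have "\<forall>y\<in>set xs. P y" using Cons.prems by simp
    then show ?thesis using True by (simp add: filter_empty_conv filter_True)
  qed (use Cons in simp)
qed simp

text \<open>
  The shared part of an increment proof consists of the maximal common nodes of the two belts,
  the rest of the maximal nodes with new leaves only.
\<close>

definition shared :: "nat \<Rightarrow> nat \<Rightarrow> tree list" where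
  "shared m n = frontier (\<lambda>v. v \<in> nodes (mmb n)) (mmb m)"

definition cover :: "nat \<Rightarrow> nat \<Rightarrow> tree list" where
  "cover m n = frontier (settled m) (mmb n)"

definition belt_increment :: "nat \<Rightarrow> nat \<Rightarrow> tree increment_proof" where
  "belt_increment m n =
    (shared m n, drop (length (shared m n)) (cover m n),
     rebuild (\<lambda>v. v \<in> nodes (mmb n)) (mmb m), rebuild (settled m) (mmb n))"

lemma set_shared: "m \<le> n \<Longrightarrow> set (shared m n) = maximal_nodes (\<lambda>v. v \<in> nodes (mmb n)) (mmb m)"
  unfolding shared_def
  by (rule set_frontier [OF spans_mmb]) (auto simp: Leaf_in_nodes_iff leaves_mmb)

lemma set_cover: "set (cover m n) = maximal_nodes (settled m) (mmb n)"
  unfolding cover_def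
  by (rule set_frontier [OF spans_mmb]) (auto simp: settled_def Leaf_in_nodes_iff leaves_mmb)

lemma sorted_cover: "sorted_wrt left_of (cover m n)"
  unfolding cover_def by (rule sorted_frontier [OF spans_mmb])

lemma has_old_leaf_if_old: "v \<in> nodes (mmb m) \<Longrightarrow> leaves v \<inter> {1..m} \<noteq> {}"
  using leaves_subset_if_node [of v "mmb m"] leaves_nonempty_if_node [OF spans_mmb, of v m]
  by (auto simp: leaves_mmb)

lemma cover_upward_closed: "sorted_wrt (\<lambda>u v. u \<notin> nodes (mmb m) \<longrightarrow> v \<notin> nodes (mmb m)) (cover m n)"
proof (rule sorted_wrt_mono_rel [OF _ sorted_cover])
  fix u v assume in_cover: "u \<in> set (cover m n)" "v \<in> set (cover m n)" and "left_of u v"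
  show "u \<notin> nodes (mmb m) \<longrightarrow> v \<notin> nodes (mmb m)"
  proof
    assume "u \<notin> nodes (mmb m)"
    then have "leaves u \<inter> {1..m} = {}" "leaves u \<subseteq> {1..n}"
      using in_cover(1) leaves_subset_if_node [of u "mmb n"]
      by (auto simp: set_cover maximal_nodes_def settled_def leaves_mmb)
    moreover obtain i where "i \<in> leaves u" using \<open>left_of u v\<close> by (auto simp: left_of_def)
    ultimately have "m < i" by (metis IntI atLeastAtMost_iff empty_iff not_less subsetD)
    then have "leaves v \<inter> {1..m} = {}"
      using \<open>left_of u v\<close> \<open>i \<in> leaves u\<close> by (fastforce simp: left_of_def)
    then show "v \<notin> nodes (mmb m)" using has_old_leaf_if_old by blast
  qed
qed

lemma filter_old_cover:
  assumes "m < n"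
  shows "filter (\<lambda>v. v \<in> nodes (mmb m)) (cover m n) = shared m n"
proof (rule sorted_wrt_unique [OF left_of_asym])
  show "sorted_wrt left_of (filter (\<lambda>v. v \<in> nodes (mmb m)) (cover m n))"
    using sorted_cover by (rule sorted_wrt_filter)
  show "sorted_wrt left_of (shared m n)"
    unfolding shared_def by (rule sorted_frontier [OF spans_mmb])
  have "settled m w \<longleftrightarrow> w \<in> nodes (mmb m)" if "v \<in> nodes w" "v \<in> nodes (mmb m)" for v w
    using has_old_leaf_if_old [OF that(2)] leaves_subset_if_node [OF that(1)]
    by (auto simp: settled_def)
  then show "set (filter (\<lambda>v. v \<in> nodes (mmb m)) (cover m n)) = set (shared m n)"
    using assms by (auto simp: set_shared set_cover maximal_nodes_def settled_def)
qed

lemma shared_append_drop_cover: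
  assumes "m < n"
  shows "shared m n @ drop (length (shared m n)) (cover m n) = cover m n"
  using filter_append_filter_if_upward_closed [OF cover_upward_closed, of m n]
    filter_old_cover [OF assms]
  by simp (metis append_eq_conv_conj)

lemma cover_antichain:
  assumes "u \<in> set (cover m n)" "v \<in> set (cover m n)" "u \<in> nodes v"
  shows "u = v"
proof (rule ccontr)
  assume "u \<noteq> v"
  then have "left_of u v \<or> left_of v u"
    using assms(1,2) sorted_cover [of m n]
    by (metis in_set_conv_nth linorder_neqE_nat sorted_wrt_nth_less)
  moreover have "leaves u \<subseteq> leaves v" using assms(3) by (rule leaves_subset_if_node)
  ultimately show False unfolding left_of_def by blast
qed

lemma mmb_not_Missing: "1 \<le> n \<Longrightarrow> mmb n \<noteq> Missing"
  by (simp add: mmb_eq)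

lemma is_increment_proof_belt:
  assumes "1 \<le> m" "m < n"
  shows "is_increment_proof m n (belt_increment m n)"
proof -
  have "distinct (cover m n)"
    using left_of_asym sorted_cover by (rule distinct_if_sorted_wrt_asym)
  moreover have "set (cover m n) \<subseteq> nodes (mmb n)"
    unfolding cover_def by (rule frontier_subset_nodes)
  moreover have "(\<Union>v\<in>set (shared m n). leaves v) = {1..m}" "(\<Union>v\<in>set (cover m n). leaves v) = {1..n}"
    unfolding shared_def cover_def leaves_frontier leaves_mmb by auto
  moreover have
    "reduce_nodes Node Missing (rebuild (\<lambda>v. v \<in> nodes (mmb n)) (mmb m)) (shared m n) [] =
      Some (mmb m)"
    "reduce_nodes Node Missing (rebuild (settled m) (mmb n)) (cover m n) [] = Some (mmb n)"
    unfolding shared_def cover_def using assms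
    by (auto intro!: reduce_rebuild [OF spans_mmb] simp: mmb_not_Missing)
  ultimately show ?thesis
    unfolding is_increment_proof_def belt_increment_def prod.case
      shared_append_drop_cover [OF assms(2)]
    using cover_antichain by blast
qed

fun missing_depth :: "tree \<Rightarrow> nat" where
  "missing_depth (Node l r) = (if l = Missing then Suc (missing_depth r) else 0)"
| "missing_depth _ = 0"

text \<open>
  Chains of nodes without left child have length at most two, so the number of instructions is
  linear in the number of nodes they combine.
\<close>

lemma length_rebuild:
  "spans t a b \<Longrightarrow> t \<noteq> Missing \<Longrightarrow> (\<And>v. v \<in> nodes t \<Longrightarrow> missing_depth v \<le> 2) \<Longrightarrow>
   length (rebuild Q t) + 5 \<le> 6 * length (frontier Q t) + missing_depth t"
proof (induction t arbitrary: a b)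
  case (Node l r)
  from Node.prems(1) obtain c where spans: "spans l a c" "spans r c b" and "r \<noteq> Missing"
    by (rule spans_NodeE)
  then have right: "length (rebuild Q r) + 5 \<le> 6 * length (frontier Q r) + missing_depth r"
    using Node.IH(2) Node.prems(3) by simp
  show ?case
  proof (cases "l = Missing")
    case True
    then show ?thesis using right by auto
  next
    case False
    then have "length (rebuild Q l) + 5 \<le> 6 * length (frontier Q l) + missing_depth l"
      using Node.IH(1) [OF spans(1)] Node.prems(3) by simp
    moreover have "missing_depth l \<le> 2" "missing_depth r \<le> 2"
      using Node.prems(3) False \<open>r \<noteq> Missing\<close> by (simp_all add: nodes_self)
    ultimately show ?thesis using right False by auto
  qed
qed auto

lemma missing_depth_perfect: "v \<in> nodes (perfect h k) \<Longrightarrow> missing_depth v = 0"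
  by (induction h arbitrary: k) (auto simp: perfect.simps)

lemma missing_depth_mountain:
  "v \<in> insert (mountain i N) (nodes (mountain i N)) \<Longrightarrow> missing_depth v = 0"
  using nodes_self [of "mountain i N"] by (auto simp: mountain_def missing_depth_perfect)

lemma missing_depth_last_range:
  "1 \<le> N \<Longrightarrow> v \<in> insert (last_range i N) (nodes (last_range i N)) \<Longrightarrow> missing_depth v \<le> 1"
proof (induction i N rule: halving_induct)
  case (halve i N)
  then show ?case
    using missing_depth_mountain [of v i N] missing_depth_mountain [of "mountain i N" i N]
    by (cases "range_starts N") (auto simp: belt_unfold)
qed simp

lemma missing_depth_left_belt: "1 \<le> N \<Longrightarrow> v \<in> nodes (left_belt i N) \<Longrightarrow> missing_depth v \<le> 2"
proof (induction i N rule: halving_induct)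
  case (halve i N)
  then show ?case
    using missing_depth_last_range [of "N div 2" v "Suc i"]
      missing_depth_last_range [of "N div 2" "last_range (Suc i) (N div 2)" "Suc i"]
    by (cases "range_starts N") (auto simp: belt_unfold)
qed simp

lemma missing_depth_mmb: "v \<in> nodes (mmb n) \<Longrightarrow> missing_depth v \<le> 2"
  using missing_depth_left_belt [of "Suc n" v 0] missing_depth_last_range [of "Suc n" v 0]
    missing_depth_last_range [of "Suc n" "last_range 0 (Suc n)" 0]
  by (cases "n = 0") (auto simp: mmb_eq)

lemma length_rebuild_mmb:
  assumes "1 \<le> n"
  shows "length (rebuild Q (mmb n)) \<le> 6 * length (frontier Q (mmb n))"
proof -
  have "mmb n \<noteq> Missing" using assms by (rule mmb_not_Missing)
  then have "length (rebuild Q (mmb n)) + 5 \<le>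
      6 * length (frontier Q (mmb n)) + missing_depth (mmb n)"
    using spans_mmb missing_depth_mmb by (intro length_rebuild)
  moreover have "missing_depth (mmb n) \<le> 2"
    using nodes_self [OF \<open>mmb n \<noteq> Missing\<close>] by (rule missing_depth_mmb)
  ultimately show ?thesis by linarith
qed

lemma length_increment_message:
  assumes "1 \<le> m" "m < n"
  shows "length (increment_message (hash_increment_proof H d x (belt_increment m n)))
    \<le> 104 * floor_log (n - m) + 250"
proof -
  have cover: "length (cover m n) \<le> 8 * floor_log (n - m) + 19"
    using length_frontier [OF spans_mmb, of "settled m" n] card_reworked [OF assms(2)]
    by (simp add: cover_def reworked_def)
  have "length (shared m n) \<le> length (cover m n)"
    using shared_append_drop_cover [OF assms(2)] by (metis le_add1 length_append)
  moreover have "length (rebuild (\<lambda>v. v \<in> nodes (mmb n)) (mmb m)) \<le> 6 * length (shared m n)"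
    "length (rebuild (settled m) (mmb n)) \<le> 6 * length (cover m n)"
    using assms by (auto simp: shared_def cover_def intro!: length_rebuild_mmb)
  ultimately show ?thesis
    using cover by (simp add: increment_message_def hash_increment_proof_def belt_increment_def)
qed

lemma reduce_nodes_label:
  "reduce_nodes Node Missing is vs stk = Some t \<Longrightarrow>
   reduce_nodes (\<lambda>a b. H (a @ b)) d is (map (label H d x) vs) (map (label H d x) stk) =
     Some (label H d x t)"
  by (induction Node Missing "is" vs stk rule: reduce_nodes.induct) auto

lemma increment_accepts_if_is_increment_proof:
  assumes "is_increment_proof m n ip"
  shows "increment_accepts H d (root_hash H d x m) (root_hash H d x n)
    (hash_increment_proof H d x ip)"
proof -
  obtain C D "is" js where ip_eq: "ip = (C, D, is, js)" by (metis prod_cases4)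
  show ?thesis
    using assms reduce_nodes_label [of _ _ "[]" _ H d x]
    by (force simp: ip_eq is_increment_proof_def increment_accepts_def hash_increment_proof_def
        root_hash_def)
qed

section \<open>Executing programs\<close>

fun sem :: "hash_fun \<Rightarrow> hash \<Rightarrow> nat \<Rightarrow> cmd \<Rightarrow> config \<Rightarrow> config option" where
  "sem H d B Skip s = Some s"
| "sem H d B (Store a e) (M, inp, out) =
    (if aval M a < B then Some (M(aval M a := (aval M e, snd (M (aval M a)))), inp, out)
     else None)"
| "sem H d B (StoreHash a e) (M, inp, out) =
    (if aval M a < B then Some (M(aval M a := (fst (M (aval M a)), hval H d M e)), inp, out)
     else None)"
| "sem H d B (Fetch a) (M, inp, out) =
    (if aval M a < B \<and> inp \<noteq> [] then Some (M(aval M a := hd inp), tl inp, out) else None)"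
| "sem H d B (Publish e) (M, inp, out) = Some (M, inp, out @ [hval H d M e])"
| "sem H d B (Seq c1 c2) s = (case sem H d B c1 s of None \<Rightarrow> None | Some s' \<Rightarrow> sem H d B c2 s')"
| "sem H d B (If b c1 c2) (M, inp, out) =
    (if bval H d M inp b then sem H d B c1 (M, inp, out) else sem H d B c2 (M, inp, out))"
| "sem H d B (While b c) s = None"

text \<open>A loop has no static cost bound; the value \<open>0\<close> is never used because \<open>sem\<close> rejects loops.\<close>

fun cost_bound :: "cmd \<Rightarrow> nat" where
  "cost_bound Skip = 1"
| "cost_bound (Store a e) = 1 + acost a + acost e"
| "cost_bound (StoreHash a e) = 1 + acost a + hcost e"
| "cost_bound (Fetch a) = 1 + acost a"
| "cost_bound (Publish e) = 1 + hcost e"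
| "cost_bound (Seq c1 c2) = 1 + cost_bound c1 + cost_bound c2"
| "cost_bound (If b c1 c2) = 1 + bcost b + cost_bound c1 + cost_bound c2"
| "cost_bound (While b c) = 0"

lemma exec_If:
  assumes "exec H d B (if bval H d M inp b then c1 else c2) (M, inp, out) t s'"
  shows "exec H d B (If b c1 c2) (M, inp, out) (1 + bcost b + t) s'"
proof (cases "bval H d M inp b")
  case True
  then show ?thesis using assms by (intro exec.IfTrue) simp_all
next
  case False
  then show ?thesis using assms by (intro exec.IfFalse) simp_all
qed

lemma exec_if_sem: "sem H d B c s = Some s' \<Longrightarrow> \<exists>t \<le> cost_bound c. exec H d B c s t s'"
proof (induction c arbitrary: s s')
  case Skip
  then show ?case using exec.Skip [of H d B s] by auto
next
  case (Store a e)
  then show ?case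
    using exec.Store [OF refl, of "fst s" a B H d e] by (cases s) (auto split: if_splits)
next
  case (StoreHash a e)
  then show ?case
    using exec.StoreHash [OF refl, of "fst s" a B H d e] by (cases s) (auto split: if_splits)
next
  case (Fetch a)
  obtain M inp out where s_eq: "s = (M, inp, out)" by (cases s)
  with Fetch obtain tok rest where "inp = tok # rest" "aval M a < B"
    by (cases inp) (auto split: if_splits)
  then show ?case
    using Fetch s_eq exec.Fetch [of M a B H d tok rest out] by auto
next
  case (Publish e)
  then show ?case
    using exec.Publish [of H d B e "fst s"] by (cases s) auto
next
  case (Seq c1 c2)
  then obtain s1 where "sem H d B c1 s = Some s1" "sem H d B c2 s1 = Some s'"
    by (auto split: option.splits)
  then obtain t1 t2 where "t1 \<le> cost_bound c1" "exec H d B c1 s t1 s1"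
    "t2 \<le> cost_bound c2" "exec H d B c2 s1 t2 s'"
    using Seq.IH by blast
  then show ?case
    by (intro exI [of _ "1 + t1 + t2"] conjI exec.Seq) simp_all
next
  case (If b c1 c2)
  obtain M inp out where s_eq: "s = (M, inp, out)" by (cases s)
  let ?c = "if bval H d M inp b then c1 else c2"
  have "sem H d B ?c s = Some s'" using If.prems s_eq by (simp split: if_splits)
  then have "\<exists>t \<le> cost_bound ?c. exec H d B ?c s t s'" using If.IH by metis
  then obtain t where "t \<le> cost_bound ?c" "exec H d B ?c s t s'" by blast
  then show ?case
    using exec_If [of H d B M inp b c1 c2 out t s'] s_eq
    by (intro exI [of _ "1 + bcost b + t"]) (simp split: if_splits)
qed simp

lemma exec_deterministic:
  "exec H d B c s t s' \<Longrightarrow> exec H d B' c s t' s'' \<Longrightarrow> s' = s''"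
proof (induction arbitrary: B' t' s'' rule: exec.induct)
  case (Seq c1 s1 t1 s2 c2 t2 s3)
  from Seq.prems show ?case by (cases rule: exec.cases) (use Seq.IH in blast)
next
  case (IfTrue M inp b c1 out t s c2)
  from IfTrue.prems show ?case by (cases rule: exec.cases) (use IfTrue in blast)+
next
  case (IfFalse M inp b c2 out t s c1)
  from IfFalse.prems show ?case by (cases rule: exec.cases) (use IfFalse in blast)+
next
  case (WhileTrue M inp b c out t1 s t2 s')
  from WhileTrue.prems show ?case by (cases rule: exec.cases) (use WhileTrue in blast)+
qed (auto elim: exec.cases)

lemma exec_unchanged_outside: "exec H d B c s t s' \<Longrightarrow> B \<le> a \<Longrightarrow> fst s' a = fst s a"
  by (induction rule: exec.induct) auto

lemma exec_fits: "exec H d B c (M, inp, out) t (M', inp', out') \<Longrightarrow> fits B M \<Longrightarrow> fits B M'"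
  using exec_unchanged_outside [of H d B c "(M, inp, out)" t "(M', inp', out')"]
  by (auto simp: fits_def)

definition reaches ::
    "hash_fun \<Rightarrow> hash \<Rightarrow> nat \<Rightarrow> cmd \<Rightarrow> config \<Rightarrow> nat \<Rightarrow> token list \<Rightarrow> hash list \<Rightarrow>
      (memory \<Rightarrow> bool) \<Rightarrow> bool" where
  "reaches H d B c s t inp out Q \<longleftrightarrow> (\<exists>u M. exec H d B c s u (M, inp, out) \<and> u \<le> t \<and> Q M)"

lemma reaches_if_sem:
  "sem H d B c s = Some (M, inp, out) \<Longrightarrow> Q M \<Longrightarrow> cost_bound c \<le> t \<Longrightarrow> reaches H d B c s t inp out Q"
  unfolding reaches_def using exec_if_sem le_trans by blast

lemma reaches_weaken:
  assumes "reaches H d B c s t inp out P" "t \<le> t'" "\<And>M. P M \<Longrightarrow> Q M"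
  shows "reaches H d B c s t' inp out Q"
  using assms unfolding reaches_def by (meson le_trans)

lemma reaches_Seq:
  assumes "reaches H d B c1 s t1 inp' out' P"
    and "\<And>M. P M \<Longrightarrow> reaches H d B c2 (M, inp', out') t2 inp out Q"
    and "1 + t1 + t2 \<le> t"
  shows "reaches H d B (Seq c1 c2) s t inp out Q"
proof -
  obtain u1 M1 where first: "exec H d B c1 s u1 (M1, inp', out')" "u1 \<le> t1" "P M1"
    using assms(1) by (auto simp: reaches_def)
  obtain u2 M2 where second: "exec H d B c2 (M1, inp', out') u2 (M2, inp, out)" "u2 \<le> t2" "Q M2"
    using assms(2) [OF first(3)] by (auto simp: reaches_def)
  have "exec H d B (Seq c1 c2) s (1 + u1 + u2) (M2, inp, out)"
    using first(1) second(1) by (rule exec.Seq)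
  moreover have "1 + u1 + u2 \<le> t" using first(2) second(2) assms(3) by linarith
  ultimately show ?thesis using second(3) by (auto simp: reaches_def)
qed

definition loop_cost :: "bexp \<Rightarrow> cmd \<Rightarrow> nat \<Rightarrow> nat" where
  "loop_cost b c n = (1 + bcost b) + (1 + bcost b + cost_bound c) * n"

definition affine :: "(nat \<Rightarrow> nat) \<Rightarrow> bool" where
  "affine f \<longleftrightarrow> (\<exists>p q. \<forall>n. f n = p + q * n)"

lemma affine_linear: "affine (\<lambda>n. p + q * n)"
  unfolding affine_def by blast

lemma affine_const: "affine (\<lambda>n. p)"
  using affine_linear [of p 0] by simp

lemma affine_add:
  assumes "affine f" "affine g"
  shows "affine (\<lambda>n. f n + g n)"
proof -
  obtain p q where "\<And>n. f n = p + q * n" using assms(1) by (auto simp: affine_def)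
  moreover obtain r s where "\<And>n. g n = r + s * n" using assms(2) by (auto simp: affine_def)
  ultimately have "(\<lambda>n. f n + g n) = (\<lambda>n. (p + r) + (q + s) * n)" by (simp add: algebra_simps)
  then show ?thesis by (simp only: affine_linear)
qed

lemma affine_le: "affine f \<Longrightarrow> m \<le> n \<Longrightarrow> f m \<le> f n"
  by (auto simp: affine_def)

lemma affine_loop_cost: "affine (loop_cost b c)"
  unfolding loop_cost_def [abs_def] by (rule affine_linear)

lemmas affine_intros = affine_const affine_add affine_loop_cost

lemma reaches_While_tokens:
  assumes init: "I 0 M"
    and guard: "\<And>i M. i \<le> length ts \<Longrightarrow> I i M \<Longrightarrow>
      bval H d M (drop i ts @ inp) b \<longleftrightarrow> i < length ts"
    and body: "\<And>i M rest. i < length ts \<Longrightarrow> I i M \<Longrightarrow>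
      \<exists>M'. sem H d B c (M, ts ! i # rest, out) = Some (M', rest, out) \<and> I (Suc i) M'"
  shows "reaches H d B (While b c) (M, ts @ inp, out) (loop_cost b c (length ts)) inp out
    (I (length ts))"
proof -
  have "reaches H d B (While b c) (M, drop i ts @ inp, out) (loop_cost b c (length ts - i)) inp out
      (I (length ts))"
    if "i \<le> length ts" "I i M" for i M
    using that
  proof (induction "length ts - i" arbitrary: i M)
    case 0
    then have "\<not> bval H d M inp b" using guard [of i M] by simp
    then have "exec H d B (While b c) (M, inp, out) (1 + bcost b) (M, inp, out)"
      by (rule exec.WhileFalse)
    then show ?case using 0 by (auto simp: reaches_def loop_cost_def)
  next
    case (Suc k)
    then have "i < length ts" and remaining: "k = length ts - Suc i" by auto
    let ?inp = "drop i ts @ inp" and ?inp' = "drop (Suc i) ts @ inp"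
    have "?inp = ts ! i # ?inp'"
      using \<open>i < length ts\<close> by (simp add: Cons_nth_drop_Suc)
    then obtain M1 where step: "sem H d B c (M, ?inp, out) = Some (M1, ?inp', out)" "I (Suc i) M1"
      using body [OF \<open>i < length ts\<close> Suc.prems(2), of ?inp'] by metis
    obtain t1 where once: "t1 \<le> cost_bound c" "exec H d B c (M, ?inp, out) t1 (M1, ?inp', out)"
      using exec_if_sem [OF step(1)] by blast
    obtain t2 M2 where again: "exec H d B (While b c) (M1, ?inp', out) t2 (M2, inp, out)"
      "t2 \<le> loop_cost b c k" "I (length ts) M2"
      using Suc.hyps(1) [OF remaining _ step(2)] \<open>i < length ts\<close> remaining
      unfolding reaches_def by auto
    have "bval H d M ?inp b" using guard Suc.prems \<open>i < length ts\<close> by simp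
    then have "exec H d B (While b c) (M, ?inp, out) (1 + bcost b + t1 + t2) (M2, inp, out)"
      using once(2) again(1) by (rule exec.WhileTrue)
    moreover have "1 + bcost b + t1 + t2 \<le> loop_cost b c (length ts - i)"
      using once(1) again(2) Suc.hyps(2) [symmetric] by (simp add: loop_cost_def)
    ultimately show ?case using again(3) unfolding reaches_def by blast
  qed
  from this [of 0 M] init show ?thesis by simp
qed

section \<open>Verification of membership proofs\<close>

abbreviation reg :: "nat \<Rightarrow> aexp" where "reg k \<equiv> Val (Num k)"

definition indexed :: "nat \<Rightarrow> nat \<Rightarrow> aexp" where
  "indexed b k = Plus (Num b) (Plus (Plus (reg k) (reg k)) (Plus (reg k) (reg k)))"

lemma aval_indexed [simp]: "aval M (indexed b k) = b + 4 * fst (M k)"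
  by (simp add: indexed_def)

definition commit_cmd :: cmd where
  "commit_cmd = Seq (StoreHash (Num 2) (Cell (Num 0))) (Fetch (Num 0))"

text \<open>
  Cell 6 doubles as the loop counter, so that \<open>indexed 8 6\<close> is the cell for the next proof entry.
\<close>

definition climb_cmd :: cmd where
  "climb_cmd =
    Seq (Fetch (indexed 8 6))
     (Seq (If (Less (Val (indexed 8 6)) (Num 1))
         (StoreHash (indexed 14 6) (Hash (Cell (indexed 8 6)) (Cell (indexed 10 6))))
       (If (Less (Val (indexed 8 6)) (Num 2))
         (StoreHash (indexed 14 6) (Hash (Cell (indexed 10 6)) (Cell (indexed 8 6))))
         (StoreHash (indexed 14 6) (Hash Default (Cell (indexed 10 6))))))
      (Store (Num 6) (Plus (reg 6) (Num 1))))"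

definition verdict_cmd :: cmd where
  "verdict_cmd = If (Same (Cell (indexed 10 6)) (Cell (Num 0)))
    (Store (Num 4) (Num 1)) (Store (Num 4) (Num 0))"

definition climb_all_cmd :: cmd where
  "climb_all_cmd = Seq (While More climb_cmd) verdict_cmd"

definition member_cmd :: cmd where
  "member_cmd = Seq (Seq (Fetch (Num 10)) (Store (Num 6) (Num 0))) climb_all_cmd"

definition update_cmd :: cmd where
  "update_cmd = Seq (Fetch (Num 6)) climb_all_cmd"

definition climb_all_cost :: "nat \<Rightarrow> nat" where
  "climb_all_cost n = 8 + cost_bound verdict_cmd + loop_cost More climb_cmd n"

lemma affine_climb_all_cost: "affine climb_all_cost"
  unfolding climb_all_cost_def [abs_def] by (intro affine_intros)

lemma recompute_snoc: "recompute H d h (\<pi> @ [e]) = climb H d (recompute H d h \<pi>) e"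
  by (simp add: recompute_def)

lemma sem_climb:
  assumes "stores_proof H d M h \<pi>" "14 + 4 * length \<pi> < B"
  shows "\<exists>M'. sem H d B climb_cmd (M, step_token e # inp, out) = Some (M', inp, out) \<and>
    stores_proof H d M' h (\<pi> @ [e]) \<and> M' 0 = M 0 \<and> M' 2 = M 2"
proof -
  let ?n = "length \<pi>"
  define M' where "M' = M(8 + 4 * ?n := step_token e,
     14 + 4 * ?n := (fst (M (14 + 4 * ?n)), recompute H d h (\<pi> @ [e])), 6 := (Suc ?n, snd (M 6)))"
  have "fst (M 6) = ?n" "snd (M (10 + 4 * ?n)) = recompute H d h \<pi>"
    using assms(1) by (auto simp: stores_proof_def)
  then have "sem H d B climb_cmd (M, step_token e # inp, out) = Some (M', inp, out)"
    using assms(2) by (cases e) (auto simp: climb_cmd_def M'_def recompute_snoc)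
  moreover have "M' (8 + 4 * j) = step_token ((\<pi> @ [e]) ! j)" if "j < Suc ?n" for j
  proof (cases "j = ?n")
    case False
    then have "M' (8 + 4 * j) = M (8 + 4 * j)" using that by (simp add: M'_def)
    then show ?thesis using assms(1) that False by (simp add: stores_proof_def nth_append)
  qed (simp add: M'_def)
  moreover have "snd (M' (10 + 4 * j)) = recompute H d h (take j (\<pi> @ [e]))" if "j \<le> Suc ?n" for j
  proof (cases "j = Suc ?n")
    case False
    then have "M' (10 + 4 * j) = M (10 + 4 * j)" using that unfolding M'_def by simp presburger
    then show ?thesis using assms(1) that False by (simp add: stores_proof_def)
  qed (simp add: M'_def)
  ultimately show ?thesis
    by (auto simp: stores_proof_def M'_def)
qed

lemma reaches_climb_loop:
  assumes "stores_proof H d M h \<pi>" "15 + 4 * (length \<pi> + length es) \<le> B"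
  shows "reaches H d B (While More climb_cmd) (M, map step_token es, out)
    (loop_cost More climb_cmd (length es)) [] out
    (\<lambda>M'. stores_proof H d M' h (\<pi> @ es) \<and> M' 0 = M 0 \<and> M' 2 = M 2)"
proof -
  let ?I = "\<lambda>i M'. stores_proof H d M' h (\<pi> @ take i es) \<and> M' 0 = M 0 \<and> M' 2 = M 2"
  have "reaches H d B (While More climb_cmd) (M, map step_token es @ [], out)
    (loop_cost More climb_cmd (length (map step_token es))) [] out
    (?I (length (map step_token es)))"
  proof (rule reaches_While_tokens)
    fix i M1 rest assume "i < length (map step_token es)" "?I i M1"
    then show "\<exists>M2. sem H d B climb_cmd (M1, map step_token es ! i # rest, out) =
        Some (M2, rest, out) \<and> ?I (Suc i) M2"
      using sem_climb [of H d M1 h "\<pi> @ take i es" B "es ! i" rest out] assms(2)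
      by (auto simp: take_Suc_conv_app_nth min_def)
  qed (use assms(1) in auto)
  then show ?thesis by simp
qed

lemma reaches_climb_all:
  assumes "stores_proof H d M h \<pi>" "15 + 4 * (length \<pi> + length es) \<le> B"
  shows "reaches H d B climb_all_cmd (M, map step_token es, out)
    (1 + loop_cost More climb_cmd (length es) + cost_bound verdict_cmd) [] out
    (\<lambda>M'. fst (M' 4) = of_bool (recompute H d h (\<pi> @ es) = snd (M 0)) \<and>
      stores_proof H d M' h (\<pi> @ es) \<and> M' 0 = M 0 \<and> M' 2 = M 2)"
  unfolding climb_all_cmd_def
proof (rule reaches_Seq [OF reaches_climb_loop [OF assms]])
  fix M1 assume climbed: "stores_proof H d M1 h (\<pi> @ es) \<and> M1 0 = M 0 \<and> M1 2 = M 2"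
  let ?verdict = "of_bool (recompute H d h (\<pi> @ es) = snd (M 0))"
  have "snd (M1 (10 + 4 * fst (M1 6))) = recompute H d h (\<pi> @ es)"
    using climbed unfolding stores_proof_def by (metis order_refl take_all_iff)
  then have "sem H d B verdict_cmd (M1, [], out) = Some (M1(4 := (?verdict, snd (M1 4))), [], out)"
    using assms(2) climbed by (simp add: verdict_cmd_def)
  then show "reaches H d B verdict_cmd (M1, [], out) (cost_bound verdict_cmd) [] out
      (\<lambda>M'. fst (M' 4) = ?verdict \<and> stores_proof H d M' h (\<pi> @ es) \<and> M' 0 = M 0 \<and> M' 2 = M 2)"
    by (rule reaches_if_sem) (use climbed in \<open>simp_all add: stores_proof_def\<close>)
qed simp

lemma reaches_member:
  assumes "15 + 4 * length es \<le> B"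
  shows "reaches H d B member_cmd (M, (0, h) # map step_token es, out)
    (climb_all_cost (length es)) [] out
    (\<lambda>M'. fst (M' 4) = of_bool (recompute H d h es = snd (M 0)) \<and>
      stores_proof H d M' h es \<and> M' 0 = M 0 \<and> M' 2 = M 2)"
proof -
  let ?init = "Seq (Fetch (Num 10)) (Store (Num 6) (Num 0))"
  let ?M = "M(10 := (0, h), 6 := (0, snd (M 6)))"
  have "sem H d B ?init (M, (0, h) # map step_token es, out) = Some (?M, map step_token es, out)"
    using assms by simp
  then have "reaches H d B ?init (M, (0, h) # map step_token es, out) 6 (map step_token es) out
      (\<lambda>M'. M' = ?M)"
    by (rule reaches_if_sem) simp_all
  moreover have "stores_proof H d ?M h []" by (simp add: stores_proof_def recompute_def)
  ultimately show ?thesis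
    unfolding member_cmd_def climb_all_cost_def
    using reaches_climb_all [of H d ?M h "[]" es B out] assms
    by (elim reaches_Seq) auto
qed

lemma stores_proof_take:
  "stores_proof H d M h \<pi> \<Longrightarrow> j \<le> length \<pi> \<Longrightarrow> stores_proof H d (M(6 := (j, g))) h (take j \<pi>)"
  by (auto simp: stores_proof_def min_def)

lemma reaches_update:
  assumes "stores_proof H d M h \<pi>" "j \<le> length \<pi>" "15 + 4 * (j + length es) \<le> B"
  shows "reaches H d B update_cmd (M, (j, []) # map step_token es, out)
    (climb_all_cost (length es)) [] out
    (\<lambda>M'. fst (M' 4) = of_bool (recompute H d h (take j \<pi> @ es) = snd (M 0)) \<and>
      stores_proof H d M' h (take j \<pi> @ es) \<and> M' 0 = M 0 \<and> M' 2 = M 2)"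
proof -
  let ?M = "M(6 := (j, []))"
  have "sem H d B (Fetch (Num 6)) (M, (j, []) # map step_token es, out) =
      Some (?M, map step_token es, out)"
    using assms(3) by simp
  then have "reaches H d B (Fetch (Num 6)) (M, (j, []) # map step_token es, out)
      2 (map step_token es) out (\<lambda>M'. M' = ?M)"
    by (rule reaches_if_sem) simp_all
  then show ?thesis
    unfolding update_cmd_def climb_all_cost_def
    using reaches_climb_all [OF stores_proof_take [OF assms(1,2)], of es B "[]" out] assms(2,3)
    by (elim reaches_Seq) (auto simp: min_absorb2)
qed

section \<open>Verification of increment proofs\<close>

text \<open>
  Cells 1, 3, 5 hold the numbers of shared nodes, further nodes and remaining instructions for the
  old root; 7 is the position in the node list, 9 the stack height, 11 the number of nodes that may
  be shifted, 13 is 1 as long as nothing failed. The node list occupies the cells \<open>17 + 4 * i\<close>,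
  the stack the cells \<open>19 + 4 * i\<close>.
\<close>

definition header_cmd :: cmd where
  "header_cmd =
    Seq (Fetch (Num 1)) (Seq (Fetch (Num 3)) (Seq (Fetch (Num 5)) (Store (Num 7) (Num 0))))"

definition load_cmd :: cmd where
  "load_cmd = Seq (Fetch (indexed 17 7)) (Store (Num 7) (Plus (reg 7) (Num 1)))"

definition fail_cmd :: cmd where
  "fail_cmd = Store (Num 13) (Num 0)"

definition shift_cmd :: cmd where
  "shift_cmd = If (Less (reg 7) (reg 11))
    (Seq (StoreHash (indexed 19 9) (Cell (indexed 17 7)))
      (Seq (Store (Num 7) (Plus (reg 7) (Num 1))) (Store (Num 9) (Plus (reg 9) (Num 1)))))
    fail_cmd"

definition join_cmd :: cmd where
  "join_cmd = If (Less (Num 1) (reg 9))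
    (Seq (StoreHash (indexed 11 9) (Hash (Cell (indexed 11 9)) (Cell (indexed 15 9))))
      (Store (Num 9) (Minus (reg 9) (Num 1))))
    fail_cmd"

definition join_default_cmd :: cmd where
  "join_default_cmd = If (Less (Num 0) (reg 9))
    (StoreHash (indexed 15 9) (Hash Default (Cell (indexed 15 9))))
    fail_cmd"

definition instr_cmd :: cmd where
  "instr_cmd = Seq (Store (Num 5) (Minus (reg 5) (Num 1))) (Seq (Fetch (Num 15))
    (If (Less (Num 0) (reg 13))
      (If (Less (reg 15) (Num 1)) shift_cmd (If (Less (reg 15) (Num 2)) join_cmd join_default_cmd))
      Skip))"

definition begin_cmd :: "aexp \<Rightarrow> cmd" where
  "begin_cmd e = Seq (Store (Num 11) e) (Seq (Store (Num 7) (Num 0)) (Store (Num 9) (Num 0)))"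

definition check_cmd :: "nat \<Rightarrow> cmd" where
  "check_cmd k =
    Seq (If (Same (Cell (Num 19)) (Cell (Num k))) Skip fail_cmd)
     (Seq (If (Less (reg 7) (reg 11)) fail_cmd Skip)
      (Seq (If (Less (reg 9) (Num 1)) fail_cmd Skip) (If (Less (Num 1) (reg 9)) fail_cmd Skip)))"

definition replay_cmd :: "bexp \<Rightarrow> aexp \<Rightarrow> nat \<Rightarrow> cmd" where
  "replay_cmd b e k = Seq (begin_cmd e) (Seq (While b instr_cmd) (check_cmd k))"

definition replay_cost :: "bexp \<Rightarrow> aexp \<Rightarrow> nat \<Rightarrow> nat \<Rightarrow> nat" where
  "replay_cost b e k n =
    2 + cost_bound (begin_cmd e) + cost_bound (check_cmd k) + loop_cost b instr_cmd n"

abbreviation "more_nodes \<equiv> Less (reg 7) (Plus (reg 1) (reg 3))"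

abbreviation "more_old_instrs \<equiv> Less (Num 0) (reg 5)"

definition receive_cmd :: cmd where
  "receive_cmd = Seq header_cmd (Seq (While more_nodes load_cmd) (Store (Num 13) (Num 1)))"

definition receive_cost :: "nat \<Rightarrow> nat" where
  "receive_cost n = 5 + cost_bound header_cmd + loop_cost more_nodes load_cmd n"

definition verify_cmd :: cmd where
  "verify_cmd = Seq receive_cmd (Seq (replay_cmd more_old_instrs (reg 1) 2)
    (Seq (replay_cmd More (Plus (reg 1) (reg 3)) 0) (Store (Num 4) (reg 13))))"

definition verify_cost :: "nat \<Rightarrow> nat" where
  "verify_cost n = 7 + receive_cost n + replay_cost more_old_instrs (reg 1) 2 n
    + replay_cost More (Plus (reg 1) (reg 3)) 0 n"

fun run_instr ::
    "('a \<Rightarrow> 'a \<Rightarrow> 'a) \<Rightarrow> 'a \<Rightarrow> instr \<Rightarrow> ('a list \<times> 'a list) option \<Rightarrow> ('a list \<times> 'a list) option" where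
  "run_instr f d Shift (Some (a # as, stk)) = Some (as, a # stk)"
| "run_instr f d Join (Some (as, b # a # stk)) = Some (as, f a b # stk)"
| "run_instr f d JoinDefault (Some (as, a # stk)) = Some (as, f d a # stk)"
| "run_instr f d _ _ = None"

lemma fold_run_instr_None [simp]: "fold (run_instr f d) is None = None"
  by (induction "is") auto

lemma fold_run_instr_empty: "fold (run_instr f d) is (Some ([], [])) \<noteq> Some (as, [r])"
  by (cases "is"; cases "hd is") auto

lemma reduce_nodes_eq_fold:
  "reduce_nodes f d is as stk = Some r \<longleftrightarrow> fold (run_instr f d) is (Some (as, stk)) = Some ([], [r])"
  by (induction f d "is" as stk rule: reduce_nodes.induct) (auto simp: fold_run_instr_empty)

definition hashes_at :: "memory \<Rightarrow> nat \<Rightarrow> hash list \<Rightarrow> bool" where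
  "hashes_at M b hs \<longleftrightarrow> (\<forall>i < length hs. snd (M (b + 4 * i)) = hs ! i)"

lemma hashes_at_Nil [simp]: "hashes_at M b []"
  by (simp add: hashes_at_def)

lemma hashes_at_Cons: "hashes_at M b (h # hs) \<longleftrightarrow> snd (M b) = h \<and> hashes_at M (b + 4) hs"
  by (auto simp: hashes_at_def nth_Cons less_Suc_eq_0_disj add.assoc split: nat.splits)

lemma hashes_at_append:
  "hashes_at M b (hs @ hs') \<longleftrightarrow> hashes_at M b hs \<and> hashes_at M (b + 4 * length hs) hs'"
  by (induction hs arbitrary: b) (simp_all add: hashes_at_Cons add.assoc)

lemma hashes_at_upd:
  "(\<And>i. i < length hs \<Longrightarrow> b + 4 * i \<noteq> k) \<Longrightarrow> hashes_at (M(k := v)) b hs \<longleftrightarrow> hashes_at M b hs"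
  by (simp add: hashes_at_def)

lemma hashes_at_upd_beyond:
  "length hs \<le> n \<Longrightarrow> hashes_at (M(b + 4 * n := v)) b hs \<longleftrightarrow> hashes_at M b hs"
  by (simp add: hashes_at_def)

lemma node_cell_neq_stack_cell: "17 + 4 * i \<noteq> 19 + 4 * (j::nat)"
  by presburger

definition frame :: "nat \<Rightarrow> memory \<Rightarrow> memory \<Rightarrow> bool" where
  "frame b M M' \<longleftrightarrow> (\<forall>a. even a \<or> a < b \<longrightarrow> M' a = M a)"

lemma frame_trans: "frame b M M' \<Longrightarrow> frame b M' M'' \<Longrightarrow> frame b M M''"
  by (simp add: frame_def)

definition replaying :: "hash list \<Rightarrow> nat \<Rightarrow> memory \<Rightarrow> (hash list \<times> hash list) option \<Rightarrow> bool" where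
  "replaying hs l M S \<longleftrightarrow> l \<le> length hs \<and> fst (M 11) = l \<and> hashes_at M 17 hs \<and>
     (case S of None \<Rightarrow> fst (M 13) = 0
      | Some (as, stk) \<Rightarrow> fst (M 13) = 1 \<and> fst (M 7) \<le> l \<and> as = drop (fst (M 7)) (take l hs) \<and>
          fst (M 9) = length stk \<and> length stk \<le> fst (M 7) \<and> hashes_at M 19 (rev stk))"

lemma replaying_upd:
  "k \<notin> {7, 9, 11, 13} \<Longrightarrow> k < 17 \<Longrightarrow> replaying hs l (M(k := v)) S \<longleftrightarrow> replaying hs l M S"
  by (cases S) (auto simp: replaying_def hashes_at_upd)

lemma sem_fail_cmd:
  assumes "replaying hs l M S" "13 < B"
  shows "\<exists>M'. sem H d B fail_cmd (M, inp, out) = Some (M', inp, out) \<and>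
    replaying hs l M' None \<and> frame 7 M M'"
  using assms
  by (intro exI [of _ "M(13 := (0, snd (M 13)))"])
     (auto simp: fail_cmd_def replaying_def frame_def hashes_at_upd)

lemma sem_shift_cmd:
  assumes "replaying hs l M (Some (as, stk))" "19 + 4 * length hs \<le> B"
  shows "\<exists>M'. sem H d B shift_cmd (M, inp, out) = Some (M', inp, out) \<and>
    replaying hs l M' (run_instr f d Shift (Some (as, stk))) \<and> frame 7 M M'"
proof (cases as)
  case Nil
  then show ?thesis
    using assms sem_fail_cmd [OF assms(1), of B H d inp out]
    by (auto simp: shift_cmd_def replaying_def)
next
  case (Cons a as')
  let ?p = "fst (M 7)" and ?n = "length stk"
  have rest: "a # as' = drop ?p (take l hs)" and stored: "l \<le> length hs" "hashes_at M 17 hs"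
    using assms(1) Cons by (auto simp: replaying_def)
  then have "?p < length (take l hs)" by (metis drop_all list.distinct(1) not_less)
  then have position_less: "?p < l" and "a # as' = hs ! ?p # drop (Suc ?p) (take l hs)"
    using rest by (simp_all add: Cons_nth_drop_Suc [symmetric])
  then have as'_eq: "as' = drop (Suc ?p) (take l hs)" and top: "snd (M (17 + 4 * ?p)) = a"
    using stored by (simp_all add: hashes_at_def)
  define M' where "M' = M(19 + 4 * ?n := (fst (M (19 + 4 * ?n)), a),
    7 := (Suc ?p, snd (M 7)), 9 := (Suc ?n, snd (M 9)))"
  have "sem H d B shift_cmd (M, inp, out) = Some (M', inp, out)"
    using assms position_less top by (auto simp: shift_cmd_def M'_def replaying_def)
  moreover have "replaying hs l M' (Some (as', a # stk))"
    using assms(1) position_less as'_eq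
    by (auto simp: replaying_def M'_def hashes_at_upd hashes_at_upd_beyond hashes_at_append
        hashes_at_Cons node_cell_neq_stack_cell)
  moreover have "frame 7 M M'" by (auto simp: frame_def M'_def)
  ultimately show ?thesis by (auto simp: Cons)
qed

lemma sem_join_cmd:
  fixes H :: hash_fun
  assumes "replaying hs l M (Some (as, stk))" "19 + 4 * length hs \<le> B"
  shows "\<exists>M'. sem H d B join_cmd (M, inp, out) = Some (M', inp, out) \<and>
    replaying hs l M' (run_instr (\<lambda>a b. H (a @ b)) d Join (Some (as, stk))) \<and> frame 7 M M'"
proof (cases "1 < length stk")
  case False
  then have "run_instr (\<lambda>a b. H (a @ b)) d Join (Some (as, stk)) = None"
    by (cases stk; cases "tl stk") auto
  then show ?thesis
    using False assms sem_fail_cmd [OF assms(1), of B H d inp out]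
    by (auto simp: join_cmd_def replaying_def)
next
  case True
  then obtain b a rest where stk_eq: "stk = b # a # rest" by (cases stk; cases "tl stk") auto
  let ?r = "length rest"
  have top: "snd (M (19 + 4 * ?r)) = a" "snd (M (23 + 4 * ?r)) = b"
    using assms(1) by (simp_all add: replaying_def stk_eq hashes_at_append hashes_at_Cons ac_simps)
  define M' where "M' = M(19 + 4 * ?r := (fst (M (19 + 4 * ?r)), H (a @ b)),
    9 := (Suc ?r, snd (M 9)))"
  have "sem H d B join_cmd (M, inp, out) = Some (M', inp, out)"
    using assms top by (auto simp: join_cmd_def M'_def replaying_def stk_eq)
  moreover have "replaying hs l M' (Some (as, H (a @ b) # rest))"
    using assms(1)
    by (auto simp: replaying_def stk_eq M'_def hashes_at_upd hashes_at_upd_beyond hashes_at_append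
        hashes_at_Cons node_cell_neq_stack_cell)
  moreover have "frame 7 M M'" by (auto simp: frame_def M'_def)
  ultimately show ?thesis by (auto simp: stk_eq)
qed

lemma sem_join_default_cmd:
  fixes H :: hash_fun
  assumes "replaying hs l M (Some (as, stk))" "19 + 4 * length hs \<le> B"
  shows "\<exists>M'. sem H d B join_default_cmd (M, inp, out) = Some (M', inp, out) \<and>
    replaying hs l M' (run_instr (\<lambda>a b. H (a @ b)) d JoinDefault (Some (as, stk))) \<and> frame 7 M M'"
proof (cases stk)
  case Nil
  then show ?thesis
    using assms sem_fail_cmd [OF assms(1), of B H d inp out]
    by (auto simp: join_default_cmd_def replaying_def)
next
  case (Cons a rest)
  let ?r = "length rest"
  have top: "snd (M (19 + 4 * ?r)) = a"
    using assms(1) by (simp add: replaying_def Cons hashes_at_append hashes_at_Cons)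
  define M' where "M' = M(19 + 4 * ?r := (fst (M (19 + 4 * ?r)), H (d @ a)))"
  have "sem H d B join_default_cmd (M, inp, out) = Some (M', inp, out)"
    using assms top by (auto simp: join_default_cmd_def M'_def replaying_def Cons)
  moreover have "replaying hs l M' (Some (as, H (d @ a) # rest))"
    using assms(1)
    by (auto simp: replaying_def Cons M'_def hashes_at_upd hashes_at_upd_beyond hashes_at_append
        hashes_at_Cons node_cell_neq_stack_cell)
  moreover have "frame 7 M M'" by (auto simp: frame_def M'_def)
  ultimately show ?thesis by (auto simp: Cons)
qed

lemma sem_instr:
  fixes H :: hash_fun
  assumes "replaying hs l M S" "19 + 4 * length hs \<le> B"
  shows "\<exists>M'. sem H d B instr_cmd (M, instr_token i # inp, out) = Some (M', inp, out) \<and>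
    replaying hs l M' (run_instr (\<lambda>a b. H (a @ b)) d i S) \<and>
    fst (M' 5) = fst (M 5) - 1 \<and> frame 5 M M'"
proof -
  define M1 where "M1 = M(5 := (fst (M 5) - 1, snd (M 5)), 15 := instr_token i)"
  have fetched: "replaying hs l M1 S" "fst (M1 5) = fst (M 5) - 1" "frame 5 M M1"
    using assms(1) by (auto simp: M1_def replaying_upd frame_def)
  have frame: "fst (M' 5) = fst (M 5) - 1 \<and> frame 5 M M'" if "frame 7 M1 M'" for M'
    using that fetched by (auto simp: frame_def)
  show ?thesis
  proof (cases S)
    case None
    then have "sem H d B instr_cmd (M, instr_token i # inp, out) = Some (M1, inp, out)"
      using fetched(1) assms(2) by (simp add: instr_cmd_def replaying_def M1_def)
    then show ?thesis using None fetched by auto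
  next
    case (Some s)
    obtain as stk where S_eq: "S = Some (as, stk)" by (cases s) (simp add: Some)
    define c where
      "c = (case i of Shift \<Rightarrow> shift_cmd | Join \<Rightarrow> join_cmd | JoinDefault \<Rightarrow> join_default_cmd)"
    have "sem H d B instr_cmd (M, instr_token i # inp, out) = sem H d B c (M1, inp, out)"
      using fetched(1) assms(2) S_eq
      by (cases i) (simp_all add: instr_cmd_def replaying_def M1_def c_def)
    moreover have "\<exists>M'. sem H d B c (M1, inp, out) = Some (M', inp, out) \<and>
        replaying hs l M' (run_instr (\<lambda>a b. H (a @ b)) d i S) \<and> frame 7 M1 M'"
      using fetched(1) assms(2) unfolding S_eq
      by (cases i) (simp_all only: c_def instr.case sem_shift_cmd sem_join_cmd sem_join_default_cmd)
    ultimately show ?thesis using frame by metis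
  qed
qed

lemma sem_begin_cmd:
  assumes "13 < B"
  shows "sem H d B (begin_cmd e) (M, inp, out) =
    Some (M(11 := (aval M e, snd (M 11)), 7 := (0, snd (M 7)), 9 := (0, snd (M 9))), inp, out)"
  using assms by (simp add: begin_cmd_def)

lemma sem_check_cmd:
  assumes "replaying hs l M S" "13 < B" "k \<noteq> 13"
  shows "sem H d B (check_cmd k) (M, inp, out) =
    Some (M(13 := (of_bool (S = Some ([], [snd (M k)])), snd (M 13))), inp, out)"
proof (cases S)
  case None
  then show ?thesis
    using assms
    by (auto simp: replaying_def check_cmd_def fail_cmd_def fun_upd_idem_iff prod_eq_iff)
next
  case (Some s)
  obtain as stk where s_eq: "s = (as, stk)" by (cases s)
  note state = assms(1) [unfolded replaying_def Some s_eq option.case prod.case]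
  have flag: "M 13 = (Suc 0, snd (M 13))" using state by (simp add: prod_eq_iff)
  have empty: "as = [] \<longleftrightarrow> \<not> fst (M 7) < fst (M 11)" using state by auto
  consider (none) "stk = []" | (single) r where "stk = [r]" | (several) "1 < length stk"
    by (cases stk; cases "tl stk") auto
  then show ?thesis
  proof cases
    case single
    then have "snd (M 19) = r" using state by (auto simp: hashes_at_def)
    then show ?thesis using single state empty assms(2,3) Some s_eq flag
      by (auto simp: check_cmd_def fail_cmd_def fun_upd_idem_iff)
  qed (use state empty assms(2,3) Some s_eq flag in
      \<open>auto simp: check_cmd_def fail_cmd_def fun_upd_idem_iff\<close>)
qed

lemma reaches_instr_loop:
  fixes H :: hash_fun
  assumes "replaying hs l M S" "19 + 4 * length hs \<le> B"
    and guard: "\<And>i M'. i \<le> length is \<Longrightarrow> fst (M' 5) = fst (M 5) - i \<Longrightarrow>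
      bval H d M' (drop i (map instr_token is) @ inp) b \<longleftrightarrow> i < length is"
  shows "reaches H d B (While b instr_cmd) (M, map instr_token is @ inp, out)
    (loop_cost b instr_cmd (length is)) inp out
    (\<lambda>M'. replaying hs l M' (fold (run_instr (\<lambda>a b. H (a @ b)) d) is S) \<and> frame 5 M M')"
proof -
  let ?run = "run_instr (\<lambda>a b. H (a @ b)) d"
  let ?I = "\<lambda>i M'. replaying hs l M' (fold ?run (take i is) S) \<and>
    fst (M' 5) = fst (M 5) - i \<and> frame 5 M M'"
  have "reaches H d B (While b instr_cmd) (M, map instr_token is @ inp, out)
    (loop_cost b instr_cmd (length (map instr_token is))) inp out
    (?I (length (map instr_token is)))"
  proof (rule reaches_While_tokens)
    fix i M1 rest assume position: "i < length (map instr_token is)" and "?I i M1"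
    then obtain M2 where
      "sem H d B instr_cmd (M1, instr_token (is ! i) # rest, out) = Some (M2, rest, out)"
      "replaying hs l M2 (?run (is ! i) (fold ?run (take i is) S))"
      "fst (M2 5) = fst (M1 5) - 1" "frame 5 M1 M2"
      using sem_instr assms(2) by blast
    then show "\<exists>M2. sem H d B instr_cmd (M1, map instr_token is ! i # rest, out) =
        Some (M2, rest, out) \<and> ?I (Suc i) M2"
      using position \<open>?I i M1\<close> by (auto simp: take_Suc_conv_app_nth intro: frame_trans)
  qed (use assms(1) guard in \<open>auto simp: frame_def\<close>)
  then show ?thesis by (rule reaches_weaken) auto
qed

definition loaded :: "memory \<Rightarrow> hash list \<Rightarrow> hash list \<Rightarrow> memory \<Rightarrow> bool" where
  "loaded M C D M' \<longleftrightarrow> hashes_at M' 17 (C @ D) \<and> fst (M' 1) = length C \<and> fst (M' 3) = length D \<and>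
     (\<forall>a. even a \<longrightarrow> M' a = M a)"

lemma loaded_frame:
  "loaded M C D M' \<Longrightarrow> frame 5 M' M'' \<Longrightarrow> hashes_at M'' 17 (C @ D) \<Longrightarrow> loaded M C D M''"
  by (simp add: loaded_def frame_def)

lemma reaches_check:
  assumes "loaded M C D M1" "replaying (C @ D) l M1 S" "even k" "19 + 4 * (length C + length D) \<le> B"
  shows "reaches H d B (check_cmd k) (M1, inp, out) (cost_bound (check_cmd k)) inp out
    (\<lambda>M'. loaded M C D M' \<and> fst (M' 13) = of_bool (S = Some ([], [snd (M k)])))"
proof (rule reaches_if_sem)
  let ?M = "M1(13 := (of_bool (S = Some ([], [snd (M1 k)])), snd (M1 13)))"
  have "k \<noteq> 13" using assms(3) by auto
  then show "sem H d B (check_cmd k) (M1, inp, out) = Some (?M, inp, out)"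
    using assms(2,4) by (intro sem_check_cmd) auto
  show "loaded M C D ?M \<and> fst (?M 13) = of_bool (S = Some ([], [snd (M k)]))"
    using assms(1,3) by (simp add: loaded_def hashes_at_upd)
qed simp

lemma reaches_replay:
  fixes H :: hash_fun
  assumes loaded: "loaded M C D M0"
    and prefix: "aval M0 e \<le> length (C @ D)" "take (aval M0 e) (C @ D) = vs"
    and flag: "fst (M0 13) = of_bool ok" and "even k"
    and cells: "19 + 4 * (length C + length D) \<le> B"
    and guard: "\<And>i M'. i \<le> length is \<Longrightarrow> fst (M' 5) = fst (M0 5) - i \<Longrightarrow>
      bval H d M' (drop i (map instr_token is) @ inp) b \<longleftrightarrow> i < length is"
  shows "reaches H d B (replay_cmd b e k) (M0, map instr_token is @ inp, out)
    (replay_cost b e k (length is)) inp out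
    (\<lambda>M'. loaded M C D M' \<and> fst (M' 13) = of_bool (ok \<and>
      reduce_nodes (\<lambda>a b. H (a @ b)) d is vs [] = Some (snd (M k))))"
  unfolding replay_cmd_def
proof (intro reaches_Seq)
  let ?inp = "map instr_token is @ inp"
  let ?start = "if ok then Some (vs, []) else None"
  let ?end = "fold (run_instr (\<lambda>a b. H (a @ b)) d) is ?start"
  let ?state = "replaying (C @ D) (aval M0 e)"
  define M1 where
    "M1 = M0(11 := (aval M0 e, snd (M0 11)), 7 := (0, snd (M0 7)), 9 := (0, snd (M0 9)))"
  have start: "?state M1 ?start" "frame 5 M0 M1" "fst (M1 5) = fst (M0 5)"
    using loaded prefix flag by (auto simp: loaded_def replaying_def M1_def frame_def hashes_at_upd)
  have "sem H d B (begin_cmd e) (M0, ?inp, out) = Some (M1, ?inp, out)"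
    using cells by (simp add: sem_begin_cmd M1_def)
  then show "reaches H d B (begin_cmd e) (M0, ?inp, out) (cost_bound (begin_cmd e)) ?inp out
      (\<lambda>M'. M' = M1)"
    by (rule reaches_if_sem) simp_all
  show "reaches H d B (While b instr_cmd) (M', ?inp, out)
      (loop_cost b instr_cmd (length is)) inp out (\<lambda>M'. ?state M' ?end \<and> frame 5 M1 M')"
    if "M' = M1" for M'
    unfolding that using start(1)
    by (rule reaches_instr_loop) (use cells in \<open>simp_all add: start(3) guard\<close>)
  fix M2 assume replayed: "?state M2 ?end \<and> frame 5 M1 M2"
  then have "loaded M C D M2"
    using loaded start(2) by (auto intro: loaded_frame frame_trans simp: replaying_def)
  moreover have "?end = Some ([], [snd (M k)]) \<longleftrightarrow>
      ok \<and> reduce_nodes (\<lambda>a b. H (a @ b)) d is vs [] = Some (snd (M k))"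
    by (simp add: reduce_nodes_eq_fold)
  ultimately show "reaches H d B (check_cmd k) (M2, inp, out) (cost_bound (check_cmd k)) inp out
      (\<lambda>M'. loaded M C D M' \<and> fst (M' 13) = of_bool (ok \<and>
        reduce_nodes (\<lambda>a b. H (a @ b)) d is vs [] = Some (snd (M k))))"
    using reaches_check [of M C D M2 "aval M0 e" ?end k B] replayed \<open>even k\<close> cells by simp
qed (auto simp: replay_cost_def)

lemma reaches_load:
  assumes "fst (M 7) = 0" "fst (M 1) + fst (M 3) = length hs" "19 + 4 * length hs \<le> B"
  shows "reaches H d B (While more_nodes load_cmd) (M, map (Pair 0) hs @ inp, out)
    (loop_cost more_nodes load_cmd (length hs)) inp out (\<lambda>M'. hashes_at M' 17 hs \<and> frame 7 M M')"
proof -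
  let ?I = "\<lambda>i M'. fst (M' 7) = i \<and> hashes_at M' 17 (take i hs) \<and> frame 7 M M'"
  let ?ts = "map (Pair (0::nat)) hs"
  have "reaches H d B (While more_nodes load_cmd) (M, ?ts @ inp, out)
    (loop_cost more_nodes load_cmd (length ?ts)) inp out (?I (length ?ts))"
  proof (rule reaches_While_tokens)
    fix i M1 rest assume position: "i < length ?ts" and state: "?I i M1"
    define M2 where "M2 = M1(17 + 4 * i := (0, hs ! i), 7 := (Suc i, snd (M1 7)))"
    have "sem H d B load_cmd (M1, ?ts ! i # rest, out) = Some (M2, rest, out)"
      using position state assms(3) by (simp add: load_cmd_def M2_def)
    moreover have "hashes_at M2 17 (take (Suc i) hs)"
      using position state
      by (simp add: M2_def take_Suc_conv_app_nth hashes_at_append hashes_at_Cons hashes_at_upd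
          hashes_at_upd_beyond min_def)
    moreover have "frame 7 M M2" using state by (simp add: M2_def frame_def)
    moreover have "fst (M2 7) = Suc i" by (simp add: M2_def)
    ultimately show "\<exists>M2. sem H d B load_cmd (M1, ?ts ! i # rest, out) = Some (M2, rest, out) \<and>
        ?I (Suc i) M2"
      by blast
  qed (use assms(1,2) in \<open>auto simp: frame_def\<close>)
  then show ?thesis by (rule reaches_weaken) auto
qed

lemma reaches_receive:
  assumes cells: "19 + 4 * (length C + length D) \<le> B"
  shows "reaches H d B receive_cmd (M, increment_message (C, D, is, js), out)
    (receive_cost (length (C @ D))) (map instr_token is @ map instr_token js) out
    (\<lambda>M'. loaded M C D M' \<and> fst (M' 5) = length is \<and> fst (M' 13) = 1)"
  unfolding receive_cmd_def
proof (intro reaches_Seq)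
  let ?msg = "increment_message (C, D, is, js)"
  let ?nodes = "map (Pair 0) (C @ D)" and ?instrs = "map instr_token is @ map instr_token js"
  define M1 where
    "M1 = M(1 := (length C, []), 3 := (length D, []), 5 := (length is, []), 7 := (0, snd (M 7)))"
  have header: "fst (M1 1) = length C" "fst (M1 3) = length D" "fst (M1 5) = length is"
    "fst (M1 7) = 0" "\<And>a. even a \<Longrightarrow> M1 a = M a"
    by (auto simp: M1_def)
  have "sem H d B header_cmd (M, ?msg, out) = Some (M1, ?nodes @ ?instrs, out)"
    using cells by (simp add: header_cmd_def increment_message_def M1_def)
  then show "reaches H d B header_cmd (M, ?msg, out) (cost_bound header_cmd) (?nodes @ ?instrs) out
      (\<lambda>M'. M' = M1)"
    by (rule reaches_if_sem) simp_all
  show "reaches H d B (While more_nodes load_cmd) (M', ?nodes @ ?instrs, out)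
      (loop_cost more_nodes load_cmd (length (C @ D))) ?instrs out
      (\<lambda>M'. hashes_at M' 17 (C @ D) \<and> frame 7 M1 M')"
    if "M' = M1" for M'
    unfolding that using cells header by (intro reaches_load) simp_all
  fix M2 assume "hashes_at M2 17 (C @ D) \<and> frame 7 M1 M2"
  then have "loaded M C D (M2(13 := (1, snd (M2 13))))" "fst (M2 5) = length is"
    using header by (auto simp: loaded_def frame_def hashes_at_upd)
  then show "reaches H d B (Store (Num 13) (Num 1)) (M2, ?instrs, out) 3 ?instrs out
      (\<lambda>M'. loaded M C D M' \<and> fst (M' 5) = length is \<and> fst (M' 13) = 1)"
    using cells by (intro reaches_if_sem [where M = "M2(13 := (1, snd (M2 13)))"]) auto
qed (auto simp: receive_cost_def)

lemma affine_receive_cost: "affine receive_cost"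
  unfolding receive_cost_def [abs_def] by (intro affine_intros)

lemma affine_replay_cost: "affine (replay_cost b e k)"
  unfolding replay_cost_def [abs_def] by (intro affine_intros)

lemma affine_verify_cost: "affine verify_cost"
  unfolding verify_cost_def [abs_def]
  by (intro affine_intros affine_receive_cost affine_replay_cost)

lemma verify_cost_ge:
  assumes "p \<le> n" "q \<le> n" "r \<le> n"
  shows "1 + receive_cost p + (1 + replay_cost more_old_instrs (reg 1) 2 q +
    (1 + replay_cost More (Plus (reg 1) (reg 3)) 0 r + 4)) \<le> verify_cost n"
  using affine_le [OF affine_receive_cost assms(1)]
    affine_le [OF affine_replay_cost assms(2), of more_old_instrs "reg 1" 2]
    affine_le [OF affine_replay_cost assms(3), of More "Plus (reg 1) (reg 3)" 0]
  unfolding verify_cost_def by linarith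

lemma reaches_verify:
  assumes cells: "19 + 4 * (length C + length D) \<le> B"
  shows "reaches H d B verify_cmd (M, increment_message (C, D, is, js), out)
    (verify_cost (length (increment_message (C, D, is, js)))) [] out
    (\<lambda>M'. fst (M' 4) = of_bool (increment_accepts H d (snd (M 2)) (snd (M 0)) (C, D, is, js)) \<and>
      (\<forall>a. even a \<and> a \<noteq> 4 \<longrightarrow> M' a = M a))" (is "reaches H d B _ _ _ _ _ ?verified")
proof (rule reaches_weaken)
  let ?msg = "increment_message (C, D, is, js)"
  let ?is = "map instr_token is" and ?js = "map instr_token js"
  let ?reduce = "reduce_nodes (\<lambda>a b. H (a @ b)) d"
  let ?old_root = "?reduce is C [] = Some (snd (M 2))"
  let ?new_root = "?reduce js (C @ D) [] = Some (snd (M 0))"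
  let ?cost = "1 + receive_cost (length (C @ D)) +
    (1 + replay_cost more_old_instrs (reg 1) 2 (length is) +
    (1 + replay_cost More (Plus (reg 1) (reg 3)) 0 (length js) + 4))"
  show "?cost \<le> verify_cost (length ?msg)"
    by (rule verify_cost_ge) (simp_all add: increment_message_def)
  show "reaches H d B verify_cmd (M, ?msg, out) ?cost [] out ?verified"
    unfolding verify_cmd_def
  proof (intro reaches_Seq [OF _ _ order_refl])
    show "reaches H d B receive_cmd (M, ?msg, out) (receive_cost (length (C @ D))) (?is @ ?js) out
        (\<lambda>M'. loaded M C D M' \<and> fst (M' 5) = length is \<and> fst (M' 13) = 1)"
      using cells by (rule reaches_receive)
    show "reaches H d B (replay_cmd more_old_instrs (reg 1) 2) (M1, ?is @ ?js, out)
        (replay_cost more_old_instrs (reg 1) 2 (length is)) ?js out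
        (\<lambda>M'. loaded M C D M' \<and> fst (M' 13) = of_bool (True \<and> ?old_root))"
      if "loaded M C D M1 \<and> fst (M1 5) = length is \<and> fst (M1 13) = 1" for M1
      using that cells by (intro reaches_replay) (simp_all add: loaded_def)
    show "reaches H d B (replay_cmd More (Plus (reg 1) (reg 3)) 0) (M1, ?js, out)
        (replay_cost More (Plus (reg 1) (reg 3)) 0 (length js)) [] out
        (\<lambda>M'. loaded M C D M' \<and> fst (M' 13) = of_bool (?old_root \<and> ?new_root))"
      if "loaded M C D M1 \<and> fst (M1 13) = of_bool (True \<and> ?old_root)" for M1
      using that cells
      by (intro reaches_replay [where inp = "[]", unfolded append_Nil2])
        (simp_all add: loaded_def nat_neq_iff)
    show "reaches H d B (Store (Num 4) (reg 13)) (M1, [], out) 4 [] out ?verified"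
      if "loaded M C D M1 \<and> fst (M1 13) = of_bool (?old_root \<and> ?new_root)" for M1
      using that cells
      by (intro reaches_if_sem [where M = "M1(4 := (fst (M1 13), snd (M1 4)))"])
        (auto simp: loaded_def increment_accepts_def)
  qed
qed

section \<open>The manager\<close>

text \<open>
  The manager stores mountains by height, since a mountain keeps its height, but not its index,
  while others are merged to its left. There are at most two mountains of height \<open>h\<close>. The cells
  \<open>addr r h\<close> hold, for \<open>r = 0\<close>, their number and the peak of the right one; for \<open>r = 1\<close> and if there
  are two, the address of the next such height and the peak of the left one; for \<open>r = 2\<close> and
  \<open>h > 0\<close>, the range node at the right one; for \<open>r = 3\<close>, provided the right one ends its range, the
  belt node before that range. Cell 0 holds the address of the least height with two mountains,
  or 0.
\<close>

definition addr :: "nat \<Rightarrow> nat \<Rightarrow> nat" where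
  "addr r h = 8 + 4 * h + r"

lemma addr_eq_iff: "r < 4 \<Longrightarrow> r' < 4 \<Longrightarrow> addr r h = addr r' h' \<longleftrightarrow> r = r' \<and> h = h'"
  unfolding addr_def by presburger

lemma addr_neq: "k < 8 \<Longrightarrow> addr r h \<noteq> k" "k < 8 \<Longrightarrow> k \<noteq> addr r h"
  by (simp_all add: addr_def)

lemma addr_pos: "0 < addr r h"
  by (simp add: addr_def)

lemma addr_not_less: "k \<le> 8 \<Longrightarrow> \<not> addr r h < k"
  by (simp add: addr_def)

lemma addr_add:
  "Suc (addr 0 h) = addr (Suc 0) h" "addr 0 h + 2 = addr 2 h" "addr 0 h + 3 = addr 3 h"
  "addr 0 h + 4 = addr 0 (Suc h)" "addr 0 h + 5 = addr (Suc 0) (Suc h)"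
  "addr 0 h + 6 = addr 2 (Suc h)" "addr 0 h + 7 = addr 3 (Suc h)"
  "addr 0 h + 8 = addr 0 (Suc (Suc h))"
  "addr 0 h + 10 = addr 2 (Suc (Suc h))" "addr 0 h + 11 = addr 3 (Suc (Suc h))"
  by (simp_all add: addr_def)

lemmas addr_simps = addr_eq_iff addr_neq addr_pos addr_not_less addr_add

abbreviation off :: "nat \<Rightarrow> aexp" where "off k \<equiv> Plus (reg 2) (Num k)"

text \<open>
  A height 0 mountain is merged with the new leaf at once; this is recorded by a 1 in cell 1, which
  holds the leaf. Otherwise the merge takes place at the address in cell 0. Cells 2 and 3 receive
  the peaks to be merged, the address of their height and that of the next pair.
\<close>

definition select_cmd :: cmd where
  "select_cmd = If (Less (Num 0) (Val (Num (addr 0 0))))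
    (Seq (Store (Num 1) (Num 1)) (Seq (Store (Num 2) (Num (addr 0 0))) (Seq (Store (Num 3) (reg 0))
      (Seq (StoreHash (Num 2) (Cell (Num (addr 0 0)))) (StoreHash (Num 3) (Cell (Num 1)))))))
    (Seq (Store (Num 2) (reg 0)) (Seq (Store (Num 3) (Val (Plus (reg 0) (Num 1))))
      (Seq (StoreHash (Num 2) (Cell (Plus (reg 0) (Num 1)))) (StoreHash (Num 3) (Cell (reg 0))))))"

text \<open>
  Cells 4, 5 and 6 receive the merged peak, the belt node before its range and its range node. The
  offsets from the address in cell 2 lead to the next two heights.
\<close>

definition join_pair_cmd :: cmd where
  "join_pair_cmd =
    Seq (StoreHash (Num 5) (Cell (off 3)))
    (Seq (StoreHash (Num 6) (Hash (Cell (off 6)) (Cell (Num 4))))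
    (Seq (Store (off 5) (reg 3))
    (Seq (StoreHash (off 5) (Cell (off 4)))
    (Seq (Store (Num 0) (off 4)) (Store (off 4) (Num 2))))))"

definition join_single_cmd :: cmd where
  "join_single_cmd =
    Seq (If (Less (Num 0) (Val (off 8)))
        (If (Less (Num 1) (Val (off 8)))
          (Seq (StoreHash (Num 5) (Hash (Cell (off 11)) (Cell (off 10))))
            (StoreHash (Num 6) (Hash Default (Cell (Num 4)))))
          (Seq (StoreHash (Num 5) (Cell (off 11)))
            (StoreHash (Num 6) (Hash (Cell (off 10)) (Cell (Num 4))))))
        (Seq (StoreHash (Num 5) Default) (StoreHash (Num 6) (Hash Default (Cell (Num 4))))))
    (Seq (Store (Num 0) (reg 3)) (Store (off 4) (Num 1)))"

definition store_merged_cmd :: cmd where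
  "store_merged_cmd =
    Seq (StoreHash (off 4) (Cell (Num 4)))
    (Seq (StoreHash (off 6) (Cell (Num 6)))
    (Seq (StoreHash (off 7) (Cell (Num 5)))
    (Seq (Store (reg 2) (Num 0))
    (Seq (Publish (Cell (Num 4)))
    (Seq (Publish (Cell (Num 6)))
    (Seq (Publish (Hash (Cell (Num 5)) (Cell (Num 6))))
      (If (Less (Num 0) (reg 1)) Skip
        (StoreHash (Num 5) (Hash (Cell (Num 5)) (Cell (Num 6)))))))))))"

definition merge_cmd :: cmd where
  "merge_cmd =
    Seq (Seq (StoreHash (Num 4) (Hash (Cell (Num 2)) (Cell (Num 3))))
      (If (Less (Num 0) (Val (off 4))) join_pair_cmd join_single_cmd))
    store_merged_cmd"

definition carry_cmd :: cmd where
  "carry_cmd = Seq select_cmd (If (Less (Num 0) (reg 2)) merge_cmd (StoreHash (Num 5) Default))"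

definition push_cmd :: cmd where
  "push_cmd =
    Seq (If (Less (Num 0) (reg 1)) Skip
      (Seq (If (Less (Num 0) (Val (Num (addr 0 1))))
            (StoreHash (Num 6) (Hash (Cell (Num (addr 2 1))) (Cell (Num 1))))
            (StoreHash (Num 6) (Hash Default (Cell (Num 1)))))
      (Seq (Store (Num (addr 0 0)) (Num 1))
      (Seq (StoreHash (Num (addr 0 0)) (Cell (Num 1)))
        (StoreHash (Num (addr 3 0)) (Cell (Num 5)))))))
    (Seq (Publish (Cell (Num 1))) (Seq (Publish (Cell (Num 6)))
      (Publish (Hash (Cell (Num 5)) (Cell (Num 6))))))"

definition append_cmd :: cmd where
  "append_cmd = Seq (Fetch (Num 1)) (Seq carry_cmd push_cmd)"

fun top_pair :: "nat \<Rightarrow> nat \<Rightarrow> nat" where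
  "top_pair i N = (if N < 5 then 0 else if N mod 4 = 1 then addr 0 (Suc i)
     else top_pair (Suc i) (N div 2))"

declare top_pair.simps [simp del]

lemma top_pair_double: "top_pair i (2 * q) = top_pair (Suc i) q"
proof (cases "q < 3")
  case True
  then show ?thesis by (simp add: top_pair.simps)
next
  case False
  have "2 * q mod 4 \<noteq> Suc 0" by presburger
  with False show ?thesis by (subst top_pair.simps) simp
qed

lemma top_pair_Suc_double:
  "top_pair i (Suc (2 * q)) = (if even q \<and> 2 \<le> q then addr 0 (Suc i) else top_pair (Suc i) q)"
proof -
  have "Suc (2 * q) mod 4 = 1 \<longleftrightarrow> even q" by presburger
  then show ?thesis by (subst top_pair.simps) (auto simp: top_pair.simps [of _ q])
qed

lemma top_pair_power: "top_pair i (2 ^ r * q) = top_pair (i + r) q"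
  by (induction r arbitrary: i) (auto simp: top_pair_double mult.assoc)

lemma top_pair_trailing_ones:
  "carry N (Suc r) a \<Longrightarrow> top_pair i N = (if a = 0 then 0 else addr 0 (Suc (i + r)))"
proof (induction r arbitrary: i N)
  case 0
  then have "N = Suc (2 * (2 * a))" by (simp add: carry_def)
  then show ?case using top_pair_Suc_double [of i "2 * a"] by (auto simp: top_pair.simps [of _ 0])
next
  case (Suc r)
  define q where "q = N div 2"
  have half: "carry q (Suc r) a"
    using carry.carry_div [OF Suc.prems, of 1] by (simp add: q_def)
  then have "odd q"
    by (metis carry_def even_Suc even_mult_iff even_power even_numeral zero_less_Suc)
  moreover have "N = Suc (2 * q)"
    using Suc.prems half by (simp add: carry_def)
  ultimately show ?case using Suc.IH [OF half] by (simp add: top_pair_Suc_double)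
qed

text \<open>
  For \<open>u = N div 2 ^ g\<close>, the mountain of index \<open>g\<close> has height \<open>g + 1\<close> iff \<open>odd_peak u\<close>, and the
  mountain of index \<open>g + 1\<close> to its left has height \<open>g + 1\<close> iff \<open>even_peak u\<close>.
\<close>

abbreviation odd_peak :: "nat \<Rightarrow> bool" where
  "odd_peak u \<equiv> odd u \<and> 3 \<le> u"

abbreviation even_peak :: "nat \<Rightarrow> bool" where
  "even_peak u \<equiv> even (u div 2) \<and> 4 \<le> u"

definition slot :: "memory \<Rightarrow> (tree \<Rightarrow> hash) \<Rightarrow> nat \<Rightarrow> nat \<Rightarrow> bool \<Rightarrow> bool" where
  "slot M lab g u ends_range \<longleftrightarrow>
     fst (M (addr 0 (Suc g))) = of_bool (even_peak u) + of_bool (odd_peak u) \<and>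
     (odd_peak u \<longrightarrow> snd (M (addr 0 (Suc g))) = lab (mountain g u) \<and>
        snd (M (addr 2 (Suc g))) = lab (last_range g u) \<and>
        (ends_range \<longrightarrow> snd (M (addr 3 (Suc g))) = lab (left_belt g u))) \<and>
     (even u \<and> even_peak u \<longrightarrow> snd (M (addr 0 (Suc g))) = lab (mountain (Suc g) (u div 2)) \<and>
        snd (M (addr 2 (Suc g))) = lab (last_range (Suc g) (u div 2))) \<and>
     (odd u \<and> even_peak u \<longrightarrow>
        M (addr 1 (Suc g)) = (top_pair (Suc g) (u div 2), lab (mountain (Suc g) (u div 2))))"

abbreviation index_ends_range :: "nat \<Rightarrow> nat \<Rightarrow> bool" where
  "index_ends_range N g \<equiv> g = 0 \<or> range_starts (N div 2 ^ (g - 1))"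

definition manager_inv :: "(tree \<Rightarrow> hash) \<Rightarrow> nat \<Rightarrow> memory \<Rightarrow> bool" where
  "manager_inv lab N M \<longleftrightarrow>
     fst (M 0) = top_pair 0 N \<and>
     fst (M (addr 0 0)) = of_bool (even N \<and> 2 \<le> N) \<and>
     (even N \<and> 2 \<le> N \<longrightarrow> snd (M (addr 0 0)) = lab (mountain 0 N) \<and>
        snd (M (addr 3 0)) = lab (left_belt 0 N)) \<and>
     (\<forall>g. slot M lab g (N div 2 ^ g) (index_ends_range N g))"

lemma slot_cong:
  assumes "slot M lab g u w" "\<And>r. r < 4 \<Longrightarrow> M' (addr r (Suc g)) = M (addr r (Suc g))" "w' \<longrightarrow> w"
  shows "slot M' lab g u w'"
  using assms(1,3) assms(2) [of 0] assms(2) [of 1] assms(2) [of 2] assms(2) [of 3]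
  unfolding slot_def by auto

locale append_step = carry +
  fixes H :: hash_fun and d :: hash and x :: "nat \<Rightarrow> bool list" and M :: memory and B :: nat
  assumes N_pos: "1 \<le> N"
    and inv: "manager_inv (label H d x) N M"
    and leaf_cells: "12 \<le> B"
    and peak_cells: "a \<noteq> 0 \<Longrightarrow> 16 + 4 * j \<le> B"
begin

abbreviation "lab \<equiv> label H d x"

abbreviation "run \<equiv> sem H d B"

abbreviation "fetched \<equiv> M(1 := (0, H (x N)))"

abbreviation "pair_left \<equiv> mountain j (2 * a)"

definition selected :: memory where
  "selected = M(1 := (of_bool (j = 0), H (x N)), 2 := (addr 0 j, lab pair_left),
     3 := (top_pair (Suc j) a, lab pair_right))"

definition carried :: "memory \<Rightarrow> bool" where
  "carried M' \<longleftrightarrow>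
    fst (M' 0) = top_pair 0 (Suc N) \<and> M' 1 = (of_bool (j = 0), H (x N)) \<and>
    snd (M' 5) = lab (left_belt 0 (Suc N)) \<and> (j = 0 \<longrightarrow> snd (M' 6) = lab (last_range 0 (Suc N))) \<and>
    slot M' lab j (Suc (2 * a)) True \<and> fst (M' (addr 0 j)) = 0 \<and>
    (\<forall>r h. r < 4 \<longrightarrow> h \<noteq> j \<longrightarrow> h \<noteq> Suc j \<longrightarrow> M' (addr r h) = M (addr r h))"

lemma slot_at: "slot M lab g (N div 2 ^ g) (index_ends_range N g)"
  using inv by (simp add: manager_inv_def)

lemma slot_at_exponent: "slot M lab j (2 * a) (index_ends_range N j)"
  using slot_at [of j] by (simp add: div_exponent)

lemma slot_above_exponent: "slot M lab (Suc j) a (range_starts (2 * a))"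
proof -
  have "N div 2 ^ Suc j = a"
    using div_exponent by (simp add: power_Suc2 div_mult2_eq del: power_Suc)
  then show ?thesis using slot_at [of "Suc j"] by (simp add: div_exponent)
qed

lemma slot_below_exponent: "j = Suc r \<Longrightarrow> slot M lab r (Suc (2 * (2 * a))) (index_ends_range N r)"
  using slot_at [of r] by (simp only: div_below_exponent)

lemma odd_N_iff: "odd N \<longleftrightarrow> j \<noteq> 0"
proof -
  have "even (Suc N) \<longleftrightarrow> j \<noteq> 0" unfolding Suc_eq by (cases j) simp_all
  then show ?thesis by simp
qed

lemma run_select:
  assumes "a \<noteq> 0"
  shows "run select_cmd (fetched, inp, out) = Some (selected, inp, out)"
proof (cases j)
  case 0
  then have N_eq: "N = 2 * a" using Suc_eq by simp
  have "fst (M (addr 0 0)) = 1" "snd (M (addr 0 0)) = lab (mountain 0 N)" "fst (M 0) = top_pair 1 a"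
    using inv assms by (auto simp: N_eq manager_inv_def top_pair_double)
  then show ?thesis
    using leaf_cells 0 assms unfolding selected_def
    by (simp add: N_eq select_cmd_def addr_simps fun_upd_twist)
next
  case (Suc r)
  have pair: "snd (M (addr 0 j)) = lab pair_right"
    "M (addr 1 j) = (top_pair (Suc j) a, lab pair_left)"
    using slot_below_exponent [OF Suc] Suc assms mountain_Suc_double [of r "2 * a"]
    by (auto simp: slot_def top_pair_double)
  have "fst (M 0) = addr 0 j" "fst (M (addr 0 0)) = 0"
    using inv top_pair_trailing_ones [of N r a 0] carry_axioms Suc assms odd_N_iff
    by (auto simp: manager_inv_def)
  then show ?thesis
    using leaf_cells Suc pair unfolding selected_def
    by (simp add: select_cmd_def addr_simps fun_upd_twist)
qed

lemma neighbour_count: "a \<noteq> 0 \<Longrightarrow> fst (M (addr 0 (Suc j))) = of_bool (even a)"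
  using slot_at_exponent by (cases "a = 1") (auto simp: slot_def)

lemma even_neighbour:
  assumes "a \<noteq> 0" "even a"
  shows "snd (M (addr 0 (Suc j))) = lab (mountain (Suc j) a)"
    and "snd (M (addr 2 (Suc j))) = lab (last_range (Suc j) a)"
proof -
  have "2 \<le> a" using assms by (cases "a = 1") auto
  then show "snd (M (addr 0 (Suc j))) = lab (mountain (Suc j) a)"
    "snd (M (addr 2 (Suc j))) = lab (last_range (Suc j) a)"
    using slot_at_exponent assms(2) by (auto simp: slot_def)
qed

lemma pair_index_ends_range:
  assumes "a \<noteq> 0" "j = Suc r"
  shows "index_ends_range N r"
proof (cases r)
  case (Suc s)
  have "carry (N div 2 ^ s) 2 a"
    using carry_div [of s] assms(2) Suc by simp
  then have "N div 2 ^ s = Suc (2 * Suc (2 * (2 * a)))" by (simp add: carry_def)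
  moreover have "Suc (2 * (2 * a)) mod 4 = 1" by presburger
  ultimately show ?thesis
    using Suc assms(1) range_starts_Suc_double [of "Suc (2 * (2 * a))"] by simp
qed simp

text \<open>
  If \<open>a\<close> is even, the left neighbour of the merged pair is in the same range as the pair, so the
  belt node before that range is read off at the pair; otherwise the neighbour ends its own range.
\<close>

lemma left_belt_at_pair:
  assumes "a \<noteq> 0" "even a"
  shows "snd (M (addr 3 j)) = lab (left_belt (Suc j) a)"
proof -
  have continues: "left_belt j (2 * a) = left_belt (Suc j) a"
    using assms left_belt_power [of a j 1] by simp
  show ?thesis
  proof (cases j)
    case 0
    then have "N = 2 * a" using Suc_eq by simp
    then show ?thesis using inv 0 assms(1) continues by (simp add: manager_inv_def)
  next
    case (Suc r)
    have "slot M lab r (Suc (2 * (2 * a))) True"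
      using slot_below_exponent [OF Suc] pair_index_ends_range [OF assms(1) Suc] by simp
    then have "snd (M (addr 3 j)) = lab (left_belt r (Suc (2 * (2 * a))))"
      using Suc assms(1) by (simp add: slot_def)
    moreover have "\<not> range_starts (Suc (2 * (2 * a)))"
      unfolding range_starts_Suc_double by presburger
    then have "left_belt r (Suc (2 * (2 * a))) = left_belt j (2 * a)"
      using Suc assms(1) by (simp add: left_belt_continues)
    ultimately show ?thesis by (simp add: continues)
  qed
qed

lemma odd_neighbour:
  assumes "odd a"
  shows "fst (M (addr 0 (Suc (Suc j)))) =
      of_bool (range_starts (Suc (2 * a))) + of_bool (3 \<le> a)"
    and "3 \<le> a \<Longrightarrow> snd (M (addr 2 (Suc (Suc j)))) = lab (last_range (Suc j) a)"
    and "3 \<le> a \<Longrightarrow> snd (M (addr 3 (Suc (Suc j)))) = lab (left_belt (Suc j) a)"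
proof -
  have "a mod 4 = 1 \<longleftrightarrow> even (a div 2)" using assms by presburger
  moreover have "4 \<le> a \<longleftrightarrow> 5 \<le> a" if "a mod 4 = 1" using that by presburger
  ultimately have "range_starts (Suc (2 * a)) \<longleftrightarrow> even_peak a"
    unfolding range_starts_Suc_double by blast
  then show "fst (M (addr 0 (Suc (Suc j)))) =
      of_bool (range_starts (Suc (2 * a))) + of_bool (3 \<le> a)"
    "3 \<le> a \<Longrightarrow> snd (M (addr 2 (Suc (Suc j)))) = lab (last_range (Suc j) a)"
    "3 \<le> a \<Longrightarrow> snd (M (addr 3 (Suc (Suc j)))) = lab (left_belt (Suc j) a)"
    using slot_above_exponent assms range_starts_double [of a] by (simp_all add: slot_def)
qed

lemma merged_starts:
  assumes "range_starts (Suc (2 * a))"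
  shows "merged_left = Node (left_belt (Suc j) a) (last_range (Suc j) a)"
    and "merged_range = Node Missing merged_peak"
  using assms by (simp_all add: left_belt_starts last_range_starts)

lemma merged_continues:
  assumes "a \<noteq> 0" "\<not> range_starts (Suc (2 * a))"
  shows "merged_left = left_belt (Suc j) a"
    and "merged_range = Node (last_range (Suc j) a) merged_peak"
  using assms by (simp_all add: left_belt_continues last_range_continues)

definition peaked :: memory where
  "peaked = selected(4 := (fst (selected 4), lab merged_peak))"

lemma run_peak:
  assumes "a \<noteq> 0"
  shows "run (StoreHash (Num 4) (Hash (Cell (Num 2)) (Cell (Num 3)))) (selected, inp, out) =
    Some (peaked, inp, out)"
proof -
  have "lab merged_peak = H (lab pair_left @ lab pair_right)"
    using mountain_Suc_double_eq_Node [of a j] assms by simp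
  then show ?thesis
    using leaf_cells by (simp add: peaked_def selected_def)
qed

lemma peaked_cells:
  "peaked 1 = (of_bool (j = 0), H (x N))" "fst (peaked 2) = addr 0 j"
  "fst (peaked 3) = top_pair (Suc j) a"
  "snd (peaked 4) = lab merged_peak" "peaked (addr r h) = M (addr r h)"
  by (simp_all add: peaked_def selected_def addr_simps)

lemma cells_below: "a \<noteq> 0 \<Longrightarrow> r < 4 \<Longrightarrow> h \<le> Suc j \<Longrightarrow> addr r h < B"
  using peak_cells by (auto simp: addr_def)

definition joined :: "memory \<Rightarrow> bool" where
  "joined M' \<longleftrightarrow>
    M' 1 = (of_bool (j = 0), H (x N)) \<and> fst (M' 2) = addr 0 j \<and>
    snd (M' 4) = lab merged_peak \<and> snd (M' 5) = lab merged_left \<and> snd (M' 6) = lab merged_range \<and>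
    fst (M' 0) = top_pair j (Suc (2 * a)) \<and>
    fst (M' (addr 0 (Suc j))) = 1 + of_bool (even a) \<and>
    (even a \<longrightarrow> M' (addr 1 (Suc j)) = (top_pair (Suc j) a, lab (mountain (Suc j) a))) \<and>
    (\<forall>r h. r < 4 \<longrightarrow> h \<noteq> Suc j \<longrightarrow> M' (addr r h) = M (addr r h))"

lemma run_join_pair:
  assumes "a \<noteq> 0" "even a"
  shows "\<exists>M'. run join_pair_cmd (peaked, inp, out) = Some (M', inp, out) \<and> joined M'"
proof -
  have "\<not> range_starts (Suc (2 * a))" using assms(2) unfolding range_starts_Suc_double by presburger
  note belt = merged_continues [OF assms(1) this]
  have "2 \<le> a" using assms by (cases "a = 1") auto
  then show ?thesis
    using leaf_cells cells_below [OF assms(1)] assms(2) even_neighbour [OF assms]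
      left_belt_at_pair [OF assms]
    by (simp add: join_pair_cmd_def joined_def peaked_cells [simplified] addr_simps belt
        top_pair_Suc_double)
qed

lemma run_join_single:
  assumes "odd a"
  shows "\<exists>M'. run join_single_cmd (peaked, inp, out) = Some (M', inp, out) \<and> joined M'"
proof -
  have "a \<noteq> 0" "3 \<le> a \<or> a = 1" using assms by presburger+
  then have cells: "8 \<le> B" "\<And>r. r < 4 \<Longrightarrow> addr r (Suc j) < B"
    using leaf_cells cells_below by auto
  note [simp] = join_single_cmd_def joined_def peaked_cells [simplified] addr_simps
    top_pair_Suc_double
  consider (starts) "3 \<le> a" "range_starts (Suc (2 * a))"
    | (continues) "3 \<le> a" "\<not> range_starts (Suc (2 * a))"
    | (alone) "a = 1" using \<open>3 \<le> a \<or> a = 1\<close> by blast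
  then show ?thesis
  proof cases
    case starts
    then show ?thesis
      using cells assms odd_neighbour [OF assms] by (simp add: merged_starts)
  next
    case continues
    then show ?thesis
      using cells assms odd_neighbour [OF assms] by (simp add: merged_continues)
  next
    case alone
    then have "\<not> 3 \<le> a" "\<not> range_starts (Suc (2 * a))"
      "left_belt (Suc j) a = Missing" "last_range (Suc j) a = Missing"
      by (simp_all add: range_starts_def)
    then show ?thesis
      using cells assms odd_neighbour [OF assms] \<open>a \<noteq> 0\<close> by (simp add: merged_continues)
  qed
qed

lemma top_pair_Suc_N: "top_pair j (Suc (2 * a)) = top_pair 0 (Suc N)"
  by (simp only: Suc_eq top_pair_power add_0)

lemma run_store_merged:
  assumes "a \<noteq> 0" "joined M1"
  shows "\<exists>M'. run store_merged_cmd (M1, inp, out) =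
      Some (M', inp, out @ [lab merged_peak, lab merged_range, lab merged_belt]) \<and> carried M'"
proof -
  have cells: "8 \<le> B" "\<And>r h. r < 4 \<Longrightarrow> h \<le> Suc j \<Longrightarrow> addr r h < B"
    using leaf_cells cells_below [OF assms(1)] by auto
  have "even a \<Longrightarrow> 2 \<le> a" using assms(1) by (cases "a = 1") auto
  then show ?thesis
    using cells assms last_range_Suc_zero
    by (auto simp: store_merged_cmd_def joined_def carried_def slot_def addr_simps left_belt_Suc
        top_pair_Suc_N)
qed

lemma run_merge:
  assumes "a \<noteq> 0"
  shows "\<exists>M'. run merge_cmd (selected, inp, out) =
      Some (M', inp, out @ [lab merged_peak, lab merged_range, lab merged_belt]) \<and> carried M'"
proof -
  let ?join = "if even a then join_pair_cmd else join_single_cmd"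
  have branch: "run (If (Less (Num 0) (Val (off 4))) join_pair_cmd join_single_cmd)
      (peaked, inp, out) = run ?join (peaked, inp, out)"
    using neighbour_count [OF assms] by (simp add: peaked_cells addr_simps)
  have "\<exists>M1. run ?join (peaked, inp, out) = Some (M1, inp, out) \<and> joined M1"
    by (simp add: assms run_join_pair run_join_single)
  then obtain M1 where join: "run ?join (peaked, inp, out) = Some (M1, inp, out)" and "joined M1"
    by blast
  obtain M2 where store: "run store_merged_cmd (M1, inp, out) =
      Some (M2, inp, out @ [lab merged_peak, lab merged_range, lab merged_belt])" and "carried M2"
    using run_store_merged [OF assms \<open>joined M1\<close>] by blast
  have "run merge_cmd (selected, inp, out) =
      Some (M2, inp, out @ [lab merged_peak, lab merged_range, lab merged_belt])"
    unfolding merge_cmd_def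
    by (simp only: sem.simps(6) run_peak [OF assms] branch join store option.case)
  then show ?thesis using \<open>carried M2\<close> by blast
qed

lemma run_carry_pair:
  assumes "a \<noteq> 0"
  shows "\<exists>M'. run carry_cmd (fetched, inp, out) =
      Some (M', inp, out @ [lab merged_peak, lab merged_range, lab merged_belt]) \<and> carried M'"
  using run_select [OF assms, of inp out] run_merge [OF assms, of inp out]
  by (simp add: carry_cmd_def selected_def addr_pos)

lemma run_carry_no_pair:
  assumes "a = 0"
  shows "\<exists>M'. run carry_cmd (fetched, inp, out) = Some (M', inp, out) \<and> carried M'"
proof -
  obtain r where j_eq: "j = Suc r" using Suc_eq N_pos assms by (cases j) auto
  have "top_pair 0 N = 0"
    using top_pair_trailing_ones [of N r a 0] carry_axioms assms j_eq by simp
  then have no_pair: "fst (M 0) = 0" "fst (M (addr 0 0)) = 0"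
    using inv odd_N_iff j_eq by (auto simp: manager_inv_def)
  have empty: "fst (M (addr 0 j)) = 0" "fst (M (addr 0 (Suc j))) = 0"
    using slot_below_exponent [OF j_eq] slot_at_exponent assms j_eq by (simp_all add: slot_def)
  define M' where "M' = M(1 := (0, H (x N)), 2 := (0, H (x N)), 3 := (0, snd (M 0)),
    5 := (fst (M 5), d))"
  have "run carry_cmd (fetched, inp, out) = Some (M', inp, out)"
    using leaf_cells no_pair
    by (simp add: carry_cmd_def select_cmd_def M'_def addr_simps fun_upd_twist)
  moreover have "carried M'"
    using no_pair empty assms j_eq top_pair_Suc_N unfolding carried_def
    by (simp add: M'_def addr_simps left_belt_Suc slot_def top_pair.simps)
  ultimately show ?thesis by blast
qed

lemma run_carry:
  "\<exists>M' pub. run carry_cmd (fetched, inp, out) = Some (M', inp, out @ pub) \<and> carried M' \<and>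
    (a \<noteq> 0 \<longrightarrow> {lab merged_peak, lab merged_range, lab merged_belt} \<subseteq> set pub)"
proof (cases "a = 0")
  case True
  then show ?thesis using run_carry_no_pair [of inp out] by (metis append_Nil2)
next
  case False
  then show ?thesis using run_carry_pair [of inp out] by fastforce
qed

lemma lab_mmb: "lab (mmb N) = H (lab (left_belt 0 (Suc N)) @ lab (last_range 0 (Suc N)))"
  using N_pos by (simp add: mmb_eq)

definition pushed :: "memory \<Rightarrow> memory \<Rightarrow> bool" where
  "pushed M1 M' \<longleftrightarrow> fst (M' 0) = fst (M1 0) \<and>
    M' (addr 0 0) = (if j = 0 then M1 (addr 0 0) else (1, H (x N))) \<and>
    (j \<noteq> 0 \<longrightarrow> snd (M' (addr 3 0)) = lab (left_belt 0 (Suc N))) \<and>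
    (\<forall>r h. r < 4 \<longrightarrow> 1 \<le> h \<longrightarrow> M' (addr r h) = M1 (addr r h))"

lemma range_node_at_one:
  assumes "carried M1" "1 \<le> j"
  shows "0 < fst (M1 (addr 0 1)) \<longleftrightarrow> j \<noteq> 1"
    and "j \<noteq> 1 \<Longrightarrow> snd (M1 (addr 2 1)) = lab (last_range 0 N)"
proof -
  have "0 < fst (M1 (addr 0 1)) \<and> snd (M1 (addr 2 1)) = lab (last_range 0 N)" if "j \<noteq> 1"
  proof -
    have "M1 (addr r 1) = M (addr r 1)" if "r < 4" for r
      using assms \<open>j \<noteq> 1\<close> that by (simp add: carried_def)
    moreover have "odd_peak N"
    proof -
      obtain s where "j = Suc (Suc s)" using assms(2) \<open>j \<noteq> 1\<close> by (cases j; cases "j - 1") auto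
      then have "4 dvd Suc N" by (simp add: Suc_eq mult.assoc)
      then show ?thesis by presburger
    qed
    ultimately show ?thesis
      using slot_at [of 0] by (simp add: slot_def)
  qed
  moreover have "fst (M1 (addr 0 1)) = 0" if "j = 1"
    using assms(1) that unfolding carried_def by metis
  ultimately show "0 < fst (M1 (addr 0 1)) \<longleftrightarrow> j \<noteq> 1"
    "j \<noteq> 1 \<Longrightarrow> snd (M1 (addr 2 1)) = lab (last_range 0 N)"
    by auto
qed

lemma run_push:
  assumes "carried M1"
  shows "\<exists>M'. run push_cmd (M1, inp, out) =
      Some (M', inp, out @ [lab (Leaf N), lab (last_range 0 (Suc N)), lab (mmb N)]) \<and> pushed M1 M'"
proof (cases "j = 0")
  case True
  then have "run push_cmd (M1, inp, out) =
      Some (M1, inp, out @ [lab (Leaf N), lab (last_range 0 (Suc N)), lab (mmb N)])"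
    using assms lab_mmb unfolding carried_def by (simp add: push_cmd_def)
  then show ?thesis using True pushed_def [of M1 M1] by auto
next
  case False
  define M' where "M' = M1(6 := (fst (M1 6), lab (last_range 0 (Suc N))), addr 0 0 := (1, H (x N)),
      addr 3 0 := (fst (M1 (addr 3 0)), lab (left_belt 0 (Suc N))))"
  have "M1 1 = (0, H (x N))" "snd (M1 5) = lab (left_belt 0 (Suc N))"
    using assms False unfolding carried_def by simp_all
  moreover have "addr 0 0 < B" "addr 3 0 < B" "6 < B" using leaf_cells by (simp_all add: addr_def)
  ultimately have "run push_cmd (M1, inp, out) =
      Some (M', inp, out @ [lab (Leaf N), lab (last_range 0 (Suc N)), lab (mmb N)])"
    using False range_node_at_one [OF assms] last_range_Suc lab_mmb
    by (cases "j = 1") (simp_all add: push_cmd_def M'_def addr_simps fun_upd_twist)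
  moreover have "pushed M1 M'"
    using False by (simp add: pushed_def M'_def addr_simps)
  ultimately show ?thesis by blast
qed

lemma slot_Suc_below:
  assumes "Suc g < j" and same: "\<And>r. r < 4 \<Longrightarrow> M' (addr r (Suc g)) = M (addr r (Suc g))"
  shows "slot M' lab g (Suc N div 2 ^ g) w"
proof -
  obtain e where j_eq: "j = Suc (Suc (g + e))" using assms(1) less_iff_Suc_add by auto
  define u where "u = 2 ^ e * Suc (2 * a)"
  have "Suc N = 2 ^ g * (4 * u)" by (simp add: Suc_eq j_eq u_def power_add del: mult_Suc_right)
  moreover have u_pos: "1 \<le> u" by (simp add: u_def Suc_le_eq)
  ultimately have new: "Suc N div 2 ^ g = 4 * u" and old: "N div 2 ^ g = 4 * u - 1"
    using div_eq_if_Suc_eq_mult [of N "2 ^ g" "4 * u - 1"] by simp_all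
  have "(4 * u - 1) div 2 = 2 * u - 1" "odd (4 * u - 1)" "odd (2 * u - 1)"
    using u_pos by presburger+
  then show ?thesis
    using slot_at [of g] same u_pos
      mountain_shift [OF u_pos, of g] last_range_shift [OF u_pos, of g]
    unfolding new old by (simp add: slot_def)
qed

lemma slot_Suc:
  assumes "carried M1" and same: "\<And>r h. r < 4 \<Longrightarrow> 1 \<le> h \<Longrightarrow> M' (addr r h) = M1 (addr r h)"
  shows "slot M' lab g (Suc N div 2 ^ g) (index_ends_range (Suc N) g)"
proof -
  have unchanged: "M' (addr r (Suc g)) = M (addr r (Suc g))" if "r < 4" "Suc g \<noteq> j" "g \<noteq> j" for r
    using assms that by (simp add: carried_def)
  have "slot M' lab j (Suc (2 * a)) True"
    using assms slot_cong [of M1 lab j "Suc (2 * a)" True M' True] by (simp add: carried_def)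
  consider (above) "Suc j < g" | (next_index) "g = Suc j" | (merged) "g = j"
    | (cleared) "Suc g = j" | (below) "Suc g < j"
    by linarith
  then show ?thesis
  proof cases
    case above
    then have "index_ends_range (Suc N) g \<longleftrightarrow> index_ends_range N g" "Suc N div 2 ^ g = N div 2 ^ g"
      using Suc_div_above [of g] Suc_div_above [of "g - 1"] by auto
    then show ?thesis using above slot_cong [OF slot_at [of g]] unchanged by simp
  next
    case next_index
    have "index_ends_range (Suc N) g \<longrightarrow> index_ends_range N g"
      using next_index
      by (auto simp: div_exponent Suc_div_exponent range_starts_double range_starts_Suc_double;
          presburger)
    then show ?thesis
      using next_index slot_cong [OF slot_at [of g]] unchanged Suc_div_above [of g] by simp
  next
    case merged
    then show ?thesis
      using slot_cong [OF \<open>slot M' lab j (Suc (2 * a)) True\<close>] Suc_div_exponent by simp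
  next
    case cleared
    have "fst (M' (addr 0 (Suc g))) = 0" using assms cleared by (simp add: carried_def)
    moreover have "Suc N div 2 ^ g = 2 * Suc (2 * a)" unfolding Suc_eq cleared [symmetric] by simp
    ultimately show ?thesis by (simp add: slot_def)
  next
    case below
    then show ?thesis using unchanged by (intro slot_Suc_below) auto
  qed
qed

lemma manager_inv_Suc:
  assumes "carried M1" "pushed M1 M'"
  shows "manager_inv lab (Suc N) M'"
proof -
  have "slot M' lab g (Suc N div 2 ^ g) (index_ends_range (Suc N) g)" for g
    using assms by (intro slot_Suc) (auto simp: pushed_def)
  then show ?thesis
    using assms odd_N_iff N_pos mountain_0_Suc
    by (auto simp: manager_inv_def carried_def pushed_def)
qed

lemma run_append:
  "\<exists>M' pub. run append_cmd (M, [(0, H (x N))], []) = Some (M', [], pub @ [lab (mmb N)]) \<and>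
    manager_inv lab (Suc N) M' \<and> lab ` new_nodes \<subseteq> set (pub @ [lab (mmb N)])"
proof -
  obtain M1 pub where carry: "run carry_cmd (fetched, [], []) = Some (M1, [], pub)" "carried M1"
    "a \<noteq> 0 \<longrightarrow> {lab merged_peak, lab merged_range, lab merged_belt} \<subseteq> set pub"
    using run_carry [of "[]" "[]"] by auto
  obtain M2 where push: "run push_cmd (M1, [], pub) =
      Some (M2, [], pub @ [lab (Leaf N), lab (last_range 0 (Suc N)), lab (mmb N)])" "pushed M1 M2"
    using run_push [OF carry(2)] by blast
  have "run append_cmd (M, [(0, H (x N))], []) =
      Some (M2, [], (pub @ [lab (Leaf N), lab (last_range 0 (Suc N))]) @ [lab (mmb N)])"
    using carry(1) push(1) leaf_cells by (simp add: append_cmd_def)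
  moreover have "lab ` new_nodes \<subseteq>
      set ((pub @ [lab (Leaf N), lab (last_range 0 (Suc N))]) @ [lab (mmb N)])"
    using carry(3) by (auto simp: new_nodes_def)
  ultimately show ?thesis using manager_inv_Suc [OF carry(2) push(2)] by blast
qed

end

section \<open>The scheme\<close>

definition belt_scheme :: scheme where
  "belt_scheme = \<lparr>append_prog = append_cmd, commitment_prog = commit_cmd,
     increment_prog = verify_cmd, membership_prog = member_cmd, update_prog = update_cmd,
     increment_choice = belt_increment\<rparr>"

lemma belt_scheme_simps [simp]:
  "append_prog belt_scheme = append_cmd" "commitment_prog belt_scheme = commit_cmd"
  "increment_prog belt_scheme = verify_cmd" "membership_prog belt_scheme = member_cmd"
  "update_prog belt_scheme = update_cmd" "increment_choice belt_scheme = belt_increment"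
  by (simp_all add: belt_scheme_def)

definition message_bound :: "nat \<Rightarrow> nat" where
  "message_bound k = 250 + 104 * floor_log k"

definition mem_bound :: "nat \<Rightarrow> nat" where
  "mem_bound n = 19 + 4 * message_bound n"

definition time_bound :: "nat \<Rightarrow> nat" where
  "time_bound k =
    cost_bound commit_cmd + climb_all_cost (message_bound k) + verify_cost (message_bound k)"

lemma affine_comp:
  assumes "affine f" "affine g"
  shows "affine (\<lambda>n. f (g n))"
proof -
  obtain p q where f_eq: "\<And>n. f n = p + q * n" using assms(1) unfolding affine_def by blast
  obtain r s where g_eq: "\<And>n. g n = r + s * n" using assms(2) unfolding affine_def by blast
  have "f (g n) = (p + q * r) + (q * s) * n" for n
    by (simp add: f_eq g_eq distrib_left mult.assoc)
  then show ?thesis unfolding affine_def by blast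
qed

lemma mono_affine_floor_log: "affine f \<Longrightarrow> mono (\<lambda>k. f (floor_log k))"
  by (intro monoI affine_le [of f] monoD [OF floor_log_mono])

lemma affine_floor_log_bigo:
  assumes "affine f"
  shows "(\<lambda>k. real (f (floor_log k))) \<in> O(\<lambda>k. ln (real k))"
proof -
  obtain p q where f_eq: "\<And>n. f n = p + q * n" using assms unfolding affine_def by blast
  show ?thesis
  proof (rule bigoI)
    show "\<forall>\<^sub>F k in at_top. norm (real (f (floor_log k))) \<le>
        (real p + real q / ln 2) * norm (ln (real k))"
      using eventually_ge_at_top [of 3]
    proof eventually_elim
      case (elim k)
      have "ln (exp 1) \<le> ln (real k)"
        using elim exp_le by (subst ln_le_cancel_iff) auto
      then have ln_ge_1: "1 \<le> ln (real k)" by simp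
      have "real (floor_log k) \<le> ln (real k) / ln 2"
        using elim by (simp add: floor_log_altdef log_def)
      then have "real q * real (floor_log k) \<le> real q * (ln (real k) / ln 2)"
        by (intro mult_left_mono) simp_all
      moreover have "real p * 1 \<le> real p * ln (real k)"
        using ln_ge_1 by (intro mult_left_mono) simp_all
      ultimately show ?case using ln_ge_1 by (simp add: f_eq algebra_simps)
    qed
  qed
qed

lemma affine_mem: "affine (\<lambda>n. 19 + 4 * (250 + 104 * n))"
  using affine_comp [OF affine_linear affine_linear] .

lemma affine_time:
  "affine (\<lambda>n. cost_bound commit_cmd + climb_all_cost (250 + 104 * n) +
    verify_cost (250 + 104 * n))"
  by (intro affine_const affine_add affine_comp [OF affine_climb_all_cost]
      affine_comp [OF affine_verify_cost] affine_linear)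

lemma mono_mem_bound: "mono mem_bound"
  unfolding mem_bound_def [abs_def] message_bound_def
  using mono_affine_floor_log [OF affine_mem] .

lemma mono_time_bound: "mono time_bound"
  unfolding time_bound_def [abs_def] message_bound_def
  using mono_affine_floor_log [OF affine_time] .

lemma mem_bound_bigo: "(\<lambda>n. real (mem_bound n)) \<in> O(\<lambda>n. ln (real n))"
  unfolding mem_bound_def message_bound_def using affine_floor_log_bigo [OF affine_mem] .

lemma time_bound_bigo: "(\<lambda>k. real (time_bound k)) \<in> O(\<lambda>k. ln (real k))"
  unfolding time_bound_def message_bound_def using affine_floor_log_bigo [OF affine_time] .

lemma climb_all_cost_le_time_bound: "n \<le> message_bound k \<Longrightarrow> climb_all_cost n \<le> time_bound k"
  using affine_le [OF affine_climb_all_cost] unfolding time_bound_def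
  by (meson le_add2 le_add1 le_trans)

lemma verify_cost_le_time_bound: "n \<le> message_bound k \<Longrightarrow> verify_cost n \<le> time_bound k"
  using affine_le [OF affine_verify_cost] unfolding time_bound_def by (meson le_add2 le_trans)

lemma runs_if_reaches:
  assumes "reaches H d B c (M, msg, []) t [] pub Q" "fits B M"
  shows "\<exists>u M'. runs H d B c M msg u M' pub \<and> u \<le> t \<and> fits B M' \<and> Q M'"
proof -
  obtain u M' where "exec H d B c (M, msg, []) u (M', [], pub)" "u \<le> t" "Q M'"
    using assms(1) by (auto simp: reaches_def)
  then show ?thesis using exec_fits assms(2) unfolding runs_def by blast
qed

lemma updates_commitment_belt:
  assumes "3 \<le> B" "cost_bound commit_cmd \<le> c"
  shows "updates_commitment_within H d x belt_scheme B c n"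
  unfolding updates_commitment_within_def
proof (intro allI impI)
  fix M assume "fits B M"
  let ?M = "M(2 := (fst (M 2), snd (M 0)), 0 := (0, root_hash H d x n))"
  have "sem H d B commit_cmd (M, [(0, root_hash H d x n)], []) = Some (?M, [], [])"
    using assms(1) by (simp add: commit_cmd_def)
  then have "reaches H d B commit_cmd (M, [(0, root_hash H d x n)], []) c [] [] (\<lambda>M'. M' = ?M)"
    using assms(2) by (intro reaches_if_sem) simp_all
  then obtain t where "runs H d B commit_cmd M [(0, root_hash H d x n)] t ?M []" "t \<le> c" "fits B ?M"
    using runs_if_reaches \<open>fits B M\<close> by blast
  then show "\<exists>t M'. runs H d B (commitment_prog belt_scheme) M
        (map (Pair 0) (commitment H d x n)) t M' [] \<and>
      t \<le> c \<and> fits B M' \<and> snd (M' 0) = root_hash H d x n \<and> snd (M' 2) = snd (M 0) \<and>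
      (\<forall>a. even a \<and> a \<notin> {0, 2} \<longrightarrow> M' a = M a)"
    by (intro exI [of _ t] exI [of _ ?M]) (simp add: commitment_def)
qed

lemma retrieves_membership_belt:
  assumes "m < i" "i \<le> n"
  shows "retrieves_membership_within H d x belt_scheme (mem_bound n) (time_bound (n - m)) n i"
  unfolding retrieves_membership_within_def
proof (intro allI impI)
  fix M assume start: "fits (mem_bound n) M \<and> snd (M 0) = root_hash H d x n"
  let ?es = "membership_proof H d x n i"
  have "length ?es \<le> 2 * floor_log (n - m) + 5" "length ?es \<le> 2 * floor_log n + 5"
    using assms by (auto intro!: length_membership_proof)
  then have "15 + 4 * length ?es \<le> mem_bound n"
    and cost: "climb_all_cost (length ?es) \<le> time_bound (n - m)"
    by (auto simp: mem_bound_def message_bound_def intro!: climb_all_cost_le_time_bound)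
  then obtain t M' where
    "runs H d (mem_bound n) member_cmd M ((0, H (x i)) # map step_token ?es) t M' []"
    "t \<le> climb_all_cost (length ?es)" "fits (mem_bound n) M'"
    "fst (M' 4) = of_bool (recompute H d (H (x i)) ?es = snd (M 0))"
    "stores_proof H d M' (H (x i)) ?es" "M' 0 = M 0" "M' 2 = M 2"
    using runs_if_reaches [OF reaches_member] start by blast
  moreover have "recompute H d (H (x i)) ?es = snd (M 0)"
    using start assms by (simp add: recompute_membership_proof)
  ultimately show "\<exists>t M'. runs H d (mem_bound n) (membership_prog belt_scheme) M
        ((0, H (x i)) # map step_token ?es) t M' [] \<and>
      t \<le> time_bound (n - m) \<and> fits (mem_bound n) M' \<and> fst (M' 4) = 1 \<and>
      stores_proof H d M' (H (x i)) ?es \<and> M' 0 = M 0 \<and> M' 2 = M 2"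
    using cost by (intro exI [of _ t] exI [of _ M']) auto
qed

lemma updates_membership_belt:
  assumes "1 \<le> i" "i \<le> m" "m < n"
  shows "updates_membership_within H d x belt_scheme (mem_bound n) (time_bound (n - m)) m n i"
  unfolding updates_membership_within_def
proof (intro allI impI)
  let ?old = "membership_proof H d x m i" and ?new = "membership_proof H d x n i"
  let ?j = "kept m n i"
  let ?es = "drop ?j ?new"
  fix M assume start: "fits (mem_bound n) M \<and> snd (M 0) = root_hash H d x n \<and>
    stores_proof H d M (H (x i)) ?old"
  have kept: "?j \<le> length ?old" and new: "take ?j ?old @ ?es = ?new"
    using take_kept [of i m n H d x] assms by auto
  have "length ?old \<le> 2 * floor_log n + 5" "length ?new \<le> 2 * floor_log n + 5"
    using assms by (auto intro!: length_membership_proof)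
  then have cells: "15 + 4 * (?j + length ?es) \<le> mem_bound n"
    using kept by (simp add: mem_bound_def message_bound_def)
  have cost: "climb_all_cost (length ?es) \<le> time_bound (n - m)"
    using length_drop_kept [OF assms, of H d x]
    by (intro climb_all_cost_le_time_bound) (simp add: message_bound_def)
  obtain t M' where "runs H d (mem_bound n) update_cmd M ((?j, []) # map step_token ?es) t M' []"
    "t \<le> climb_all_cost (length ?es)" "fits (mem_bound n) M'"
    "fst (M' 4) = of_bool (recompute H d (H (x i)) ?new = snd (M 0))"
    "stores_proof H d M' (H (x i)) ?new" "M' 0 = M 0" "M' 2 = M 2"
    using runs_if_reaches [OF reaches_update [OF _ kept cells]] start unfolding new by blast
  moreover have "recompute H d (H (x i)) ?new = snd (M 0)"
    using start assms by (simp add: recompute_membership_proof)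
  ultimately show "\<exists>t M'. runs H d (mem_bound n) (update_prog belt_scheme) M
        ((?j, []) # map step_token ?es) t M' [] \<and>
      t \<le> time_bound (n - m) \<and> fits (mem_bound n) M' \<and> fst (M' 4) = 1 \<and>
      stores_proof H d M' (H (x i)) ?new \<and> M' 0 = M 0 \<and> M' 2 = M 2"
    using cost by (intro exI [of _ t] exI [of _ M']) auto
qed

lemma verifies_increment_belt:
  assumes "1 \<le> m" "m < n" "time_bound (n - m) \<le> c"
  shows "verifies_increment_within H d x belt_scheme (mem_bound n) c m n"
  unfolding verifies_increment_within_def
proof (intro allI impI)
  fix M assume start: "fits (mem_bound n) M \<and> snd (M 0) = root_hash H d x n \<and>
    snd (M 2) = root_hash H d x m"
  obtain C D "is" js where ip_eq: "hash_increment_proof H d x (belt_increment m n) = (C, D, is, js)"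
    by (metis prod_cases4)
  let ?msg = "increment_message (C, D, is, js)"
  have len: "length ?msg \<le> message_bound (n - m)"
    using length_increment_message [OF assms(1,2), of H d x] ip_eq by (simp add: message_bound_def)
  moreover have "floor_log (n - m) \<le> floor_log n" by (intro monoD [OF floor_log_mono]) simp
  moreover have "length C + length D \<le> length ?msg" by (simp add: increment_message_def)
  ultimately have "19 + 4 * (length C + length D) \<le> mem_bound n"
    by (simp add: mem_bound_def message_bound_def)
  then obtain t M' where "runs H d (mem_bound n) verify_cmd M ?msg t M' []"
    "t \<le> verify_cost (length ?msg)" "fits (mem_bound n) M'"
    "fst (M' 4) = of_bool (increment_accepts H d (snd (M 2)) (snd (M 0)) (C, D, is, js))"
    "\<forall>a. even a \<and> a \<noteq> 4 \<longrightarrow> M' a = M a"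
    using runs_if_reaches [OF reaches_verify] start by blast
  moreover have "increment_accepts H d (snd (M 2)) (snd (M 0)) (C, D, is, js)"
    using increment_accepts_if_is_increment_proof
      [OF is_increment_proof_belt [OF assms(1,2)], of H d x]
      start ip_eq
    by simp
  moreover have "verify_cost (length ?msg) \<le> c"
    using verify_cost_le_time_bound [OF len] assms(3) by (rule le_trans)
  ultimately show "\<exists>t M'. runs H d (mem_bound n) (increment_prog belt_scheme) M
        (increment_message (hash_increment_proof H d x (increment_choice belt_scheme m n)))
        t M' [] \<and>
      t \<le> c \<and> fits (mem_bound n) M' \<and> fst (M' 4) = 1 \<and>
      (\<forall>a. even a \<and> a \<noteq> 4 \<longrightarrow> M' a = M a)"
    by (intro exI [of _ t] exI [of _ M']) (simp add: ip_eq)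
qed

lemma resyncs_belt:
  assumes "m < n"
  shows "resyncs_within H d x belt_scheme (mem_bound n) (time_bound (n - m)) m n"
  unfolding resyncs_within_def
  using assms verifies_increment_belt retrieves_membership_belt updates_membership_belt
    updates_commitment_belt [of "mem_bound n" "time_bound (n - m)" H d x n]
  by (simp add: mem_bound_def message_bound_def time_bound_def)

lemma verifies_correctly_belt: "verifies_correctly belt_scheme"
  unfolding verifies_correctly_def runs_def belt_scheme_simps
proof (intro conjI allI impI)
  fix H d M and ip :: "hash increment_proof"
  obtain C D "is" js where ip_eq: "ip = (C, D, is, js)" by (metis prod_cases4)
  show "\<exists>B t M'. exec H d B verify_cmd (M, increment_message ip, []) t (M', [], []) \<and>
      fst (M' 4) = of_bool (increment_accepts H d (snd (M 2)) (snd (M 0)) ip)"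
    using reaches_verify [OF order_refl] unfolding ip_eq reaches_def by blast
next
  fix H d M h \<pi>
  show "\<exists>B t M'. exec H d B member_cmd (M, (0, h) # map step_token \<pi>, []) t (M', [], []) \<and>
      fst (M' 4) = of_bool (recompute H d h \<pi> = snd (M 0)) \<and> stores_proof H d M' h \<pi>"
    using reaches_member [OF order_refl] unfolding reaches_def by blast
next
  fix H d M h \<pi> j \<pi>'
  assume "stores_proof H d M h \<pi> \<and> j \<le> length \<pi>"
  then show "\<exists>B t M'. exec H d B update_cmd (M, (j, []) # map step_token \<pi>', []) t (M', [], []) \<and>
      fst (M' 4) = of_bool (recompute H d h (take j \<pi> @ \<pi>') = snd (M 0)) \<and>
      stores_proof H d M' h (take j \<pi> @ \<pi>')"
    using reaches_update [OF _ _ order_refl] unfolding reaches_def by blast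
qed

lemma is_mmb_scheme_belt: "is_mmb_scheme belt_scheme"
  unfolding is_mmb_scheme_def by (simp add: verifies_correctly_belt is_increment_proof_belt)

lemma manager_inv_init: "manager_inv lab (Suc 0) (\<lambda>_. (0, []))"
proof -
  have "slot (\<lambda>_. (0, [])) lab g (Suc 0 div 2 ^ g) w" for g w
  proof -
    have "Suc 0 div 2 ^ g \<le> Suc 0" by (rule div_le_dividend)
    then have "\<not> 3 \<le> Suc 0 div 2 ^ g" "\<not> 4 \<le> Suc 0 div 2 ^ g" by linarith+
    then show ?thesis by (simp add: slot_def)
  qed
  then show ?thesis by (simp add: manager_inv_def top_pair.simps)
qed

lemma reaches_append:
  assumes "manager_inv (label H d x) (Suc n) M"
  shows "\<exists>pub. reaches H d (mem_bound (Suc n)) append_cmd (M, [(0, H (x (Suc n)))], [])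
      (cost_bound append_cmd) [] (pub @ commitment H d x (Suc n))
      (manager_inv (label H d x) (Suc (Suc n))) \<and>
    label H d x ` created (Suc n) \<subseteq> set (pub @ commitment H d x (Suc n))"
proof -
  obtain j a where carry: "carry (Suc n) j a" using ex_carry by blast
  have "16 + 4 * j \<le> mem_bound (Suc n)" if "a \<noteq> 0"
  proof -
    have "2 ^ j * 3 \<le> 2 ^ j * Suc (2 * a)" using that by (intro mult_le_mono2) simp
    moreover have "(1::nat) \<le> 2 ^ j" by simp
    ultimately have "2 ^ j \<le> Suc n" using carry.Suc_eq [OF carry] by linarith
    then have "j \<le> floor_log (Suc n)" by (rule le_floor_log)
    then show ?thesis by (simp add: mem_bound_def message_bound_def)
  qed
  then interpret append_step "Suc n" j a H d x M "mem_bound (Suc n)"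
    using carry assms
    by (simp add: append_step_def append_step_axioms_def mem_bound_def message_bound_def)
  have commitment: "commitment H d x (Suc n) = [lab (mmb (Suc n))]"
    by (simp add: commitment_def root_hash_def)
  obtain M' pub where "run append_cmd (M, [(0, H (x (Suc n)))], []) =
      Some (M', [], pub @ commitment H d x (Suc n))"
    "manager_inv lab (Suc (Suc n)) M'" "lab ` new_nodes \<subseteq> set (pub @ commitment H d x (Suc n))"
    using run_append unfolding commitment by blast
  moreover have "lab ` created (Suc n) \<subseteq> lab ` new_nodes"
    using created_subset_new_nodes by (rule image_mono)
  ultimately show ?thesis
    by (intro exI [of _ pub] conjI reaches_if_sem [where M = M']) auto
qed

lemma manager_memory_inv:
  "manager_memory H d x belt_scheme n M \<Longrightarrow>
    manager_inv (label H d x) (Suc n) M \<and> fits (mem_bound n) M"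
proof (induction rule: manager_memory.induct [case_names init append])
  case init
  then show ?case by (simp add: manager_inv_init fits_def)
next
  case (append n M B t M' pub)
  then obtain t' M1 pub' where run: "exec H d (mem_bound (Suc n)) append_cmd
      (M, [(0, H (x (Suc n)))], []) t' (M1, [], pub')"
    and "manager_inv (label H d x) (Suc (Suc n)) M1"
    using reaches_append unfolding reaches_def by blast
  moreover have "exec H d B append_cmd (M, [(0, H (x (Suc n)))], []) t (M', [], pub)"
    using append by (simp add: runs_def)
  then have "M1 = M'" using exec_deterministic [OF run] by blast
  moreover have "fits (mem_bound (Suc n)) M"
    using append.IH monoD [OF mono_mem_bound, of n "Suc n"] by (simp add: fits_def)
  ultimately show ?case using exec_fits [OF run] by blast
qed

lemma appends_belt:
  assumes "manager_memory H d x belt_scheme n M" "cost_bound append_cmd \<le> c"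
  shows "appends_within H d x belt_scheme (mem_bound (Suc n)) c n M"
proof -
  have "manager_inv (label H d x) (Suc n) M" and fits: "fits (mem_bound (Suc n)) M"
    using manager_memory_inv [OF assms(1)] monoD [OF mono_mem_bound, of n "Suc n"]
    by (auto simp: fits_def)
  then obtain pub where run: "reaches H d (mem_bound (Suc n)) append_cmd
      (M, [(0, H (x (Suc n)))], []) (cost_bound append_cmd) [] (pub @ commitment H d x (Suc n))
      (manager_inv (label H d x) (Suc (Suc n)))"
    and published: "label H d x ` created (Suc n) \<subseteq> set (pub @ commitment H d x (Suc n))"
    using reaches_append by blast
  obtain t M' where "runs H d (mem_bound (Suc n)) append_cmd M [(0, H (x (Suc n)))] t M'
      (pub @ commitment H d x (Suc n))"
    "t \<le> cost_bound append_cmd" "fits (mem_bound (Suc n)) M'"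
    using runs_if_reaches [OF run fits] by blast
  then show ?thesis
    using published order_trans [OF \<open>t \<le> cost_bound append_cmd\<close> assms(2)]
    unfolding appends_within_def created_def
    by (intro exI [of _ t] exI [of _ M'] exI [of _ pub]) simp
qed

lemma succinct_belt: "succinct belt_scheme"
  unfolding succinct_def
proof (intro exI conjI allI impI)
  show "mono mem_bound" by (rule mono_mem_bound)
  show "polylogarithmic time_bound"
    unfolding polylogarithmic_def using time_bound_bigo by (intro exI [of _ 1]) simp
  fix H d x and n :: nat assume "1 \<le> n"
  show "updates_commitment_within H d x belt_scheme (mem_bound n) (time_bound n) n"
    by (rule updates_commitment_belt) (simp_all add: mem_bound_def message_bound_def time_bound_def)
  show "retrieves_membership_within H d x belt_scheme (mem_bound n) (time_bound n) n i"
    if "1 \<le> i \<and> i \<le> n" for i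
    using retrieves_membership_belt [of 0 i n H d x] that by simp
  show "verifies_increment_within H d x belt_scheme (mem_bound n) (time_bound n) m n"
    if "1 \<le> m \<and> m < n" for m
    using that by (intro verifies_increment_belt monoD [OF mono_time_bound]) auto
qed

lemma incremental_belt: "incremental belt_scheme"
  unfolding incremental_def using mono_mem_bound resyncs_belt by blast

lemma optimally_additive_belt: "optimally_additive belt_scheme"
  unfolding optimally_additive_def using mono_mem_bound appends_belt by blast

theorem theorem1:
  shows "\<exists>P. is_mmb_scheme P \<and> succinct P \<and> incremental P \<and> optimally_additive P \<and>
    (\<exists>(mem :: nat \<Rightarrow> nat) (T :: nat \<Rightarrow> nat) (c :: nat).
       mono mem \<and>
       (\<lambda>n. real (mem n)) \<in> O(\<lambda>n. ln (real n)) \<and>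
       (\<lambda>k. real (T k)) \<in> O(\<lambda>k. ln (real k)) \<and>
       (\<forall>H d x.
          (\<forall>n. length (commitment H d x n) \<le> c) \<and>
          (\<forall>n M. manager_memory H d x P n M \<longrightarrow>
             fits (mem n) M \<and> appends_within H d x P (mem (Suc n)) c n M) \<and>
          (\<forall>m n. m < n \<longrightarrow> resyncs_within H d x P (mem n) (T (n - m)) m n)))"
proof (intro exI conjI allI impI)
  show "is_mmb_scheme belt_scheme" by (rule is_mmb_scheme_belt)
  show "succinct belt_scheme" by (rule succinct_belt)
  show "incremental belt_scheme" by (rule incremental_belt)
  show "optimally_additive belt_scheme" by (rule optimally_additive_belt)
  show "mono mem_bound" by (rule mono_mem_bound)
  show "(\<lambda>n. real (mem_bound n)) \<in> O(\<lambda>n. ln (real n))" by (rule mem_bound_bigo)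
  show "(\<lambda>k. real (time_bound k)) \<in> O(\<lambda>k. ln (real k))" by (rule time_bound_bigo)
  fix H d x
  show "length (commitment H d x n) \<le> Suc (cost_bound append_cmd)" for n
    by (simp add: commitment_def)
  show "fits (mem_bound n) M"
    and "appends_within H d x belt_scheme (mem_bound (Suc n)) (Suc (cost_bound append_cmd)) n M"
    if "manager_memory H d x belt_scheme n M" for n M
    using manager_memory_inv [OF that] appends_belt [OF that] by auto
  show "resyncs_within H d x belt_scheme (mem_bound n) (time_bound (n - m)) m n" if "m < n" for m n
    using that by (rule resyncs_belt)
qed

end
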